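(* Let $k$ be an algebraically closed field of arbitrary characteristic. Let $Y,Z$ be Chow semi-stable effective cycles of the same dimension in a projective space $\mathbb{P}^n_k$. Then $Y+Z$ is again Chow semi-stable. Furthermore, if $Y$ is Chow stable, then so is $Y+Z$.
   Context: Let $X$ be an effective cycle of dimension $r$ ($0\le r\le n-1$) and degree $d\ge1$ in $\mathbb{P}^n_k$. $\mathbb{G}=\mathrm{Grass}_k(n-r,n+1)$ parametrizes $(n-r-1)$-dimensional linear subspaces $L\subset\mathbb{P}^n_k$. If $X$ is a variety, its Chow divisor is the prime divisor $Z(X)=\{L\in\mathbb{G}\mid L\cap X\neq\emptyset\}$; for $X=\sum m_iX_i$ one sets $Z(X)=\sum m_iZ(X_i)$. It is a hypersurface of degree $d$ in $\mathbb{G}$ with respect to the Plücker embedding. Let $\mathcal{B}=\bigoplus_{d\ge 0}\mathcal{B}_d$ be the homogeneous coordinate ring of $\mathbb{G}$ in the Plücker embedding, i.e. the subring of $k[U_i^{(j)}: 0\le i\le n,\ 1\le j\le n-r]$ generated by the $(n-r)\times(n-r)$ minors of the matrix $(U_i^{(j)})$, graded so that these minors have degree 1. The defining equation of $Z(X)$ is an element $F\in\mathcal{B}_d$, unique up to a non-zero scalar, called the Chow form of $X$. The group $SL(n+1,k)$ acts linearly on $\mathcal{B}_d$ via its canonical action on $\mathbb{P}^n_k$. $X$ is Chow semi-stable if $0$ is not in the Zariski closure of the $SL(n+1,k)$-orbit of $F$ in $\mathcal{B}_d$; $X$ is Chow stable if this orbit is closed in $\mathcal{B}_d$ and the stabilizer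 of $F$ is finite. *)

theory Defs
  imports
    "HOL-Analysis.Analysis"
    "HOL-Library.Poly_Mapping"
    "HOL-Library.Multiset"
    "HOL-Computational_Algebra.Polynomial"
begin

text \<open>
  Throughout, \<open>'n\<close> is a type with \<open>n + 1\<close> elements, which index the homogeneous coordinates
  of \<open>\<P>\<^sup>n\<close>, and \<open>k\<close> is the field \<open>'a\<close>.
\<close>

section \<open>Multivariate polynomials\<close>

text \<open>Polynomials over \<open>'a\<close> in variables indexed by \<open>'x\<close> (not necessarily finitely many).\<close>

type_synonym ('x, 'a) mpoly = "('x \<Rightarrow>\<^sub>0 nat) \<Rightarrow>\<^sub>0 'a"

definition mvar :: "'x \<Rightarrow> ('x, 'a::comm_ring_1) mpoly" where
  "mvar i = Poly_Mapping.single (Poly_Mapping.single i 1) 1"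

definition mconst :: "'a \<Rightarrow> ('x, 'a::comm_ring_1) mpoly" where
  "mconst c = Poly_Mapping.single 0 c"

text \<open>The value of \<open>p\<close> when \<open>h\<close> is applied to the coefficients and \<open>x i\<close> is put for the \<open>i\<close>-th variable.\<close>

definition msubst ::
    "('a \<Rightarrow> 'b) \<Rightarrow> ('x \<Rightarrow> 'b) \<Rightarrow> ('x, 'a::comm_ring_1) mpoly \<Rightarrow> 'b::comm_ring_1" where
  "msubst h x p =
     (\<Sum>\<mu>\<in>Poly_Mapping.keys p. h (Poly_Mapping.lookup p \<mu>) *
        (\<Prod>i\<in>Poly_Mapping.keys \<mu>. x i ^ Poly_Mapping.lookup \<mu> i))"

abbreviation meval :: "('x \<Rightarrow> 'a) \<Rightarrow> ('x, 'a::comm_ring_1) mpoly \<Rightarrow> 'a" where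
  "meval \<equiv> msubst (\<lambda>c. c)"

definition homogeneous :: "nat \<Rightarrow> ('x, 'a::comm_ring_1) mpoly \<Rightarrow> bool" where
  "homogeneous d p \<longleftrightarrow>
     (\<forall>\<mu>\<in>Poly_Mapping.keys p. (\<Sum>i\<in>Poly_Mapping.keys \<mu>. Poly_Mapping.lookup \<mu> i) = d)"

section \<open>Varieties and cycles in projective space\<close>

definition grass :: "nat \<Rightarrow> ('a::field ^ 'n) set set" where
  "grass m = {W. vec.subspace W \<and> vec.dim W = m}"

text \<open>A point of \<open>\<P>\<^sup>n\<close> is a line through the origin of \<open>k\<^sup>n\<^sup>+\<^sup>1\<close>.\<close>

definition proj_space :: "('a::field ^ 'n) set set" where
  "proj_space = grass 1"

text \<open>The projective linear subspace defined by the linear subspace \<open>W\<close>.\<close>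

definition proj_linear :: "('a::field ^ 'n) set \<Rightarrow> ('a ^ 'n) set set" where
  "proj_linear W = {p \<in> proj_space. p \<subseteq> W}"

definition proj_zeros :: "('n, 'a::field) mpoly set \<Rightarrow> ('a ^ 'n) set set" where
  "proj_zeros S = {p \<in> proj_space. \<forall>f\<in>S. \<forall>v\<in>p. meval (\<lambda>i. v $ i) f = 0}"

definition proj_closed :: "('a::field ^ 'n) set set \<Rightarrow> bool" where
  "proj_closed X \<longleftrightarrow> (\<exists>S. (\<forall>f\<in>S. \<exists>d. homogeneous d f) \<and> X = proj_zeros S)"

definition proj_variety :: "('a::field ^ 'n) set set \<Rightarrow> bool" where
  "proj_variety X \<longleftrightarrow>
     proj_closed X \<and> X \<noteq> {} \<and>
     (\<forall>A B. proj_closed A \<and> proj_closed B \<and> X \<subseteq> A \<union> B \<longrightarrow> X \<subseteq> A \<or> X \<subseteq> B)"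

text \<open>Krull dimension: \<open>C\<close> is a chain \<open>C 0 \<subset> \<dots> \<subset> C l\<close> of irreducible closed subsets of \<open>X\<close>.\<close>

definition variety_chain :: "('a::field ^ 'n) set set \<Rightarrow> nat \<Rightarrow> (nat \<Rightarrow> ('a ^ 'n) set set) \<Rightarrow> bool" where
  "variety_chain X l C \<longleftrightarrow>
     (\<forall>i\<le>l. proj_variety (C i) \<and> C i \<subseteq> X) \<and> (\<forall>i<l. C i \<subset> C (Suc i))"

definition has_dimension :: "('a::field ^ 'n) set set \<Rightarrow> nat \<Rightarrow> bool" where
  "has_dimension X r \<longleftrightarrow>
     (\<exists>C. variety_chain X r C) \<and> (\<forall>l C. variety_chain X l C \<longrightarrow> l \<le> r)"

text \<open>
  An effective cycle \<open>\<Sum> m\<^sub>i X\<^sub>i\<close> is the multiset in which the variety \<open>X\<^sub>i\<close> occurs \<open>m\<^sub>i\<close> times.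
  Varieties have positive degree, so a cycle has degree at least 1 iff it is nonempty.
\<close>

type_synonym ('a, 'n) cycle = "('a ^ 'n) set set multiset"

definition effective_cycle :: "nat \<Rightarrow> ('a::field, 'n::finite) cycle \<Rightarrow> bool" where
  "effective_cycle r X \<longleftrightarrow> X \<noteq> {#} \<and> (\<forall>V\<in>#X. proj_variety V \<and> has_dimension V r)"

section \<open>The homogeneous coordinate ring of the Grassmannian\<close>

text \<open>
  The variable \<open>(i, j)\<close> with \<open>1 \<le> j \<le> m\<close> is the \<open>i\<close>-th coordinate \<open>U\<^sub>i\<^sup>(\<^sup>j\<^sup>)\<close> of the \<open>j\<close>-th of
  \<open>m\<close> vectors spanning a point of \<open>grass m\<close>. The minor is that of the rows \<open>\<rho> 1, \<dots>, \<rho> m\<close>.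
\<close>

definition plucker_minor :: "nat \<Rightarrow> (nat \<Rightarrow> 'n) \<Rightarrow> ('n \<times> nat, 'a::comm_ring_1) mpoly" where
  "plucker_minor m \<rho> =
     (\<Sum>\<pi> | \<pi> permutes {1..m}. of_int (sign \<pi>) * (\<Prod>j\<in>{1..m}. mvar (\<rho> j, \<pi> j)))"

inductive_set plucker_ring :: "nat \<Rightarrow> ('n \<times> nat, 'a::comm_ring_1) mpoly set" for m where
  const: "mconst c \<in> plucker_ring m"
| minor: "inj_on \<rho> {1..m} \<Longrightarrow> plucker_minor m \<rho> \<in> plucker_ring m"
| add: "F \<in> plucker_ring m \<Longrightarrow> G \<in> plucker_ring m \<Longrightarrow> F + G \<in> plucker_ring m"
| mult: "F \<in> plucker_ring m \<Longrightarrow> G \<in> plucker_ring m \<Longrightarrow> F * G \<in> plucker_ring m"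

text \<open>The minors have degree \<open>m\<close> in the variables \<open>U\<close>, and degree 1 in the grading of the ring.\<close>

definition plucker_ring_deg :: "nat \<Rightarrow> nat \<Rightarrow> ('n \<times> nat, 'a::comm_ring_1) mpoly set" where
  "plucker_ring_deg m d = {F \<in> plucker_ring m. homogeneous (m * d) F}"

text \<open>The homogeneous ideal of a subset \<open>D\<close> of \<open>grass m\<close>.\<close>

definition plucker_ideal :: "nat \<Rightarrow> ('a::field ^ 'n) set set \<Rightarrow> ('n \<times> nat, 'a) mpoly set" where
  "plucker_ideal m D =
     {F \<in> plucker_ring m. \<forall>u :: nat \<Rightarrow> 'a ^ 'n.
        vec.span (u ` {1..m}) \<in> D \<longrightarrow> meval (\<lambda>(i, j). u j $ i) F = 0}"

text \<open>\<open>F\<close> is a defining equation of the prime divisor \<open>D\<close> of \<open>grass m\<close>.\<close>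

definition prime_divisor_equation ::
    "nat \<Rightarrow> ('a::field ^ 'n) set set \<Rightarrow> ('n \<times> nat, 'a) mpoly \<Rightarrow> bool" where
  "prime_divisor_equation m D F \<longleftrightarrow>
     (\<exists>d. F \<in> plucker_ring_deg m d) \<and> plucker_ideal m D = (\<lambda>H. F * H) ` plucker_ring m"

section \<open>Chow divisors and Chow forms\<close>

text \<open>For a variety \<open>V\<close> of dimension \<open>r\<close> in \<open>\<P>\<^sup>n\<close>, the Chow divisor is taken in \<open>grass (n - r)\<close>.\<close>

definition chow_divisor :: "nat \<Rightarrow> ('a::field ^ 'n) set set \<Rightarrow> ('a ^ 'n) set set" where
  "chow_divisor m V = {L \<in> grass m. proj_linear L \<inter> V \<noteq> {}}"

text \<open>
  \<open>F\<close>, of degree \<open>d\<close>, is an equation of \<open>\<Sum> m\<^sub>i Z(X\<^sub>i)\<close>: up to a scalar it is \<open>\<Prod> f\<^sub>i ^ m\<^sub>i\<close>,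
  where \<open>f\<^sub>i\<close> is an equation of \<open>Z(X\<^sub>i)\<close>. The product runs over the multiset, hence takes the
  multiplicities into account. As \<open>F\<close> is nonzero, \<open>d\<close> is determined by \<open>F\<close>.
\<close>

definition chow_form ::
    "nat \<Rightarrow> nat \<Rightarrow> ('a::field, 'n::finite) cycle \<Rightarrow> ('n \<times> nat, 'a) mpoly \<Rightarrow> bool" where
  "chow_form m d X F \<longleftrightarrow>
     F \<in> plucker_ring_deg m d \<and>
     (\<exists>c f. c \<noteq> 0 \<and>
        (\<forall>V\<in>#X. prime_divisor_equation m (chow_divisor m V) (f V)) \<and>
        F = mconst c * (\<Prod>V\<in>#X. f V))"

section \<open>The action of the special linear group and Chow stability\<close>

definition special_linear :: "('a::field ^ 'n ^ 'n) set" where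
  "special_linear = {g. det g = 1}"

text \<open>
  The action \<open>(g \<cdot> F)(U) = F(g\<^sup>-\<^sup>1 U)\<close>: if \<open>F\<close> is an equation of \<open>D\<close>, then \<open>g \<cdot> F\<close> is one of the
  image of \<open>D\<close> under \<open>L \<mapsto> g L\<close>.
\<close>

definition sl_act ::
    "'a::field ^ 'n ^ 'n \<Rightarrow> ('n \<times> nat, 'a) mpoly \<Rightarrow> ('n \<times> nat, 'a) mpoly" where
  "sl_act g F =
     msubst mconst (\<lambda>(i, j). \<Sum>l\<in>UNIV. mconst (matrix_inv g $ i $ l) * mvar (l, j)) F"

definition sl_orbit :: "('n::finite \<times> nat, 'a::field) mpoly \<Rightarrow> ('n \<times> nat, 'a) mpoly set" where
  "sl_orbit F = (\<lambda>g :: 'a ^ 'n ^ 'n. sl_act g F) ` special_linear"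

definition sl_stabilizer :: "('n::finite \<times> nat, 'a::field) mpoly \<Rightarrow> ('a ^ 'n ^ 'n) set" where
  "sl_stabilizer F = {g \<in> special_linear. sl_act g F = F}"

text \<open>
  The Zariski topology of a linear subspace \<open>B\<close> of a polynomial ring: polynomial functions on \<open>B\<close>
  are polynomials \<open>P\<close> in the coefficients of the elements of \<open>B\<close>, so the variables of \<open>P\<close> are
  indexed by monomials.
\<close>

definition zariski_closed_in :: "('x, 'a::field) mpoly set \<Rightarrow> ('x, 'a) mpoly set \<Rightarrow> bool" where
  "zariski_closed_in B T \<longleftrightarrow>
     (\<exists>S :: ('x \<Rightarrow>\<^sub>0 nat, 'a) mpoly set.
        T = {F \<in> B. \<forall>P\<in>S. meval (Poly_Mapping.lookup F) P = 0})"

definition zariski_closure_in :: "('x, 'a::field) mpoly set \<Rightarrow> ('x, 'a) mpoly set \<Rightarrow> ('x, 'a) mpoly set" where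
  "zariski_closure_in B T = \<Inter> {T'. zariski_closed_in B T' \<and> T \<subseteq> T'}"

text \<open>
  Here \<open>X\<close> is a cycle of dimension \<open>r\<close> in \<open>\<P>\<^sup>n\<close>, and \<open>CARD('n) - 1 - r\<close> is \<open>n - r\<close>. The Chow form is
  unique up to a nonzero scalar, and the conditions do not depend on that scalar.
\<close>

definition chow_semistable :: "nat \<Rightarrow> ('a::field, 'n::finite) cycle \<Rightarrow> bool" where
  "chow_semistable r X \<longleftrightarrow>
     (let m = CARD('n) - 1 - r in
      \<exists>d F. chow_form m d X F \<and>
        0 \<notin> zariski_closure_in (plucker_ring_deg m d) (sl_orbit F))"

definition chow_stable :: "nat \<Rightarrow> ('a::field, 'n::finite) cycle \<Rightarrow> bool" where
  "chow_stable r X \<longleftrightarrow>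
     (let m = CARD('n) - 1 - r in
      \<exists>d F. chow_form m d X F \<and>
        zariski_closed_in (plucker_ring_deg m d) (sl_orbit F) \<and>
        finite (sl_stabilizer F))"

end

theory Submission
  imports Defs "HOL-Library.Function_Algebras"
begin

text \<open>
  The argument is valuative and avoids the Hilbert-Mumford criterion. A \<^emph>\<open>place\<close> is a partial limit
  functional on functions \<open>s \<mapsto> x s \<in> k\<close>: a ring homomorphism on a valuation ring of (an ultrapower
  of) \<open>k\<close> with residue field \<open>k\<close>. By Chevalley's extension theorem, a point \<open>H\<close> lies in the closure of
  an orbit iff some place sends a family \<open>g s \<cdot> F\<close> of points of the orbit to \<open>H\<close>.

  Semi-stability of \<open>F\<close> means that \<open>g s \<cdot> F\<close> never tends to \<open>0\<close>. By Gauss's lemma the valuation of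
  \<open>(g s \<cdot> F) (g s \<cdot> G)\<close> is the sum of those of the factors, so it cannot be positive if neither of them is.

  If \<open>F\<close> has a closed orbit and a finite stabilizer, then \<open>g\<close> is bounded as soon as \<open>g s \<cdot> F\<close> is: otherwise
  a Cartan decomposition \<open>g = h' D k'\<close> and Farkas' lemma turn \<open>D\<close> into a one-parameter subgroup having
  a limit on some \<open>k \<cdot> F\<close>. The limit belongs to the closed orbit and has an infinite stabilizer. If
  moreover \<open>G\<close> is semi-stable, boundedness of \<open>g s \<cdot> F G\<close> implies that of \<open>g s \<cdot> F\<close>, hence of \<open>g\<close>. So
  the orbit of \<open>F G\<close> contains its limit points, and its stabilizer, an affine variety on which \<open>g\<close> is
  always bounded, is finite.
\<close>

text \<open>Families are indexed by the matrices themselves, and places act on functions with values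
  in k, so no field other than k occurs. The price is that these functions form a ring with zero
  divisors, in which the valuation ring property has to be proved with the help of idempotents. The
  gain is that limits are again objects over k: a bounded family of matrices of determinant 1 tends
  to a point of SL over k itself.

  A point H in the closure of an orbit yields a place because the value at H of a polynomial
  function depends only on its restriction to the orbit.

  The obstacle with products is that one factor of (g s . F)(g s . G) may blow up while the other
  tends to 0. Write the factors as u f and v h, where f and h have nonzero limits. The product
  controls only u v; semi-stability of G says that v does not tend to 0, and this bounds u.\<close>

section \<open>Extension of partial homomorphisms to places\<close>

text \<open>The graph of a homomorphism from a subring of \<open>'b\<close> onto the field
  \<open>'c\<close>. With graphs, extension is plain inclusion, as Zorn's lemma wants it, and
  \<open>zero_unique\<close> makes the relation single-valued.\<close>

locale partial_hom =
  fixes G :: "('b::comm_ring_1 \<times> 'c::alg_closed_field) set"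
  assumes one: "(1, 1) \<in> G"
    and add: "(x, a) \<in> G \<Longrightarrow> (y, b) \<in> G \<Longrightarrow> (x + y, a + b) \<in> G"
    and mult: "(x, a) \<in> G \<Longrightarrow> (y, b) \<in> G \<Longrightarrow> (x * y, a * b) \<in> G"
    and uminus: "(x, a) \<in> G \<Longrightarrow> (- x, - a) \<in> G"
    and surj: "\<exists>x. (x, a) \<in> G"
    and zero_unique: "(0, a) \<in> G \<Longrightarrow> a = 0"
begin

lemma zero: "(0, 0) \<in> G"
  using add[OF one uminus[OF one]] by simp

lemma diff: "(x, a) \<in> G \<Longrightarrow> (y, b) \<in> G \<Longrightarrow> (x - y, a - b) \<in> G"
  using add[OF _ uminus, of x a y b] by simp

lemma unique: "(x, a) \<in> G \<Longrightarrow> (x, b) \<in> G \<Longrightarrow> a = b"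
  using diff[of x a x b] zero_unique[of "a - b"] by simp

lemma sum: "(\<And>i. i \<in> I \<Longrightarrow> (x i, a i) \<in> G) \<Longrightarrow> (\<Sum>i\<in>I. x i, \<Sum>i\<in>I. a i) \<in> G"
  by (induction I rule: infinite_finite_induct) (auto intro: zero add)

lemma power: "(x, a) \<in> G \<Longrightarrow> (x ^ n, a ^ n) \<in> G"
  by (induction n) (auto intro: one mult)

definition rel :: "'b poly \<Rightarrow> 'c poly \<Rightarrow> bool" where
  "rel p q \<longleftrightarrow> (\<forall>i. (coeff p i, coeff q i) \<in> G)"

lemma rel_const: "(x, a) \<in> G \<Longrightarrow> rel [:x:] [:a:]"
  by (auto simp: rel_def coeff_pCons zero split: nat.split)

lemma rel_pCons: "(x, a) \<in> G \<Longrightarrow> rel p q \<Longrightarrow> rel (pCons x p) (pCons a q)"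
  by (auto simp: rel_def coeff_pCons split: nat.split)

lemma rel_surj: "\<exists>p. rel p q"
proof (induction q)
  case 0
  show ?case using zero by (auto simp: rel_def intro!: exI[of _ 0])
next
  case (pCons a q)
  then show ?case using surj[of a] rel_pCons by blast
qed

lemma rel_add: "rel p q \<Longrightarrow> rel p' q' \<Longrightarrow> rel (p + p') (q + q')"
  by (auto simp: rel_def intro: add)

lemma rel_uminus: "rel p q \<Longrightarrow> rel (- p) (- q)"
  by (auto simp: rel_def intro: uminus)

lemma rel_mult: "rel p q \<Longrightarrow> rel p' q' \<Longrightarrow> rel (p * p') (q * q')"
  by (auto simp: rel_def coeff_mult intro: sum mult)

lemma rel_poly: "rel p q \<Longrightarrow> (x, a) \<in> G \<Longrightarrow> (poly p x, poly q a) \<in> G"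
proof (induction p arbitrary: q)
  case 0
  then have "q = 0" by (auto simp: rel_def poly_eq_iff zero_unique)
  then show ?case by (simp add: zero)
next
  case (pCons c p)
  obtain d q' where q: "q = pCons d q'" by (cases q)
  have "(c, d) \<in> G" using pCons.prems(1)[unfolded rel_def q, rule_format, of 0] by simp
  moreover have "rel p q'"
    unfolding rel_def
    using pCons.prems(1)[unfolded rel_def q, rule_format, of "Suc _"] by simp
  ultimately show ?case using pCons.IH pCons.prems(2) q by (auto intro: add mult)
qed

definition adjoin :: "'b \<Rightarrow> 'c \<Rightarrow> ('b \<times> 'c) set" where
  "adjoin x a = {(poly p x, poly q a) | p q. rel p q}"

text \<open>Sending \<open>x\<close> to \<open>a\<close> is well defined on the subring generated by
  \<open>x\<close> as soon as every relation satisfied by \<open>x\<close> reduces to one satisfied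
  by \<open>a\<close>.\<close>

lemma partial_hom_adjoin:
  assumes "\<And>p q. rel p q \<Longrightarrow> poly p x = 0 \<Longrightarrow> poly q a = 0"
  shows "partial_hom (adjoin x a)"
proof
  show "(1, 1) \<in> adjoin x a"
    unfolding adjoin_def using rel_const[OF one] by force
next
  fix y b z c assume "(y, b) \<in> adjoin x a" "(z, c) \<in> adjoin x a"
  then obtain p q p' q' where *: "rel p q" "rel p' q'" "y = poly p x" "b = poly q a"
    "z = poly p' x" "c = poly q' a" by (auto simp: adjoin_def)
  show "(y + z, b + c) \<in> adjoin x a"
    using rel_add[OF *(1,2)] poly_add *(3-) unfolding adjoin_def by (metis (mono_tags, lifting) mem_Collect_eq)
  show "(y * z, b * c) \<in> adjoin x a"
    using rel_mult[OF *(1,2)] poly_mult *(3-) unfolding adjoin_def by (metis (mono_tags, lifting) mem_Collect_eq)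
next
  fix y b assume "(y, b) \<in> adjoin x a"
  then obtain p q where *: "rel p q" "y = poly p x" "b = poly q a" by (auto simp: adjoin_def)
  then show "(- y, - b) \<in> adjoin x a"
    using rel_uminus[OF *(1)] poly_minus unfolding adjoin_def by (metis (mono_tags, lifting) mem_Collect_eq)
next
  fix b
  obtain y where "(y, b) \<in> G" using surj by blast
  then show "\<exists>y. (y, b) \<in> adjoin x a"
    unfolding adjoin_def using rel_const[of y b] by force
next
  fix b assume "(0, b) \<in> adjoin x a"
  then show "b = 0" using assms by (auto simp: adjoin_def)
qed

lemma subset_adjoin: "G \<subseteq> adjoin x a"
proof (safe)
  fix y b assume "(y, b) \<in> G"
  then show "(y, b) \<in> adjoin x a" unfolding adjoin_def using rel_const[of y b] by force
qed

lemma in_adjoin: "(x, a) \<in> adjoin x a"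
proof -
  have "rel [:0, 1:] [:0, 1:]" using rel_pCons[OF zero rel_const[OF one]] by simp
  then show ?thesis unfolding adjoin_def by force
qed

end

section \<open>The valuation ring property of maximal partial homomorphisms\<close>

locale maximal_partial_hom = partial_hom +
  assumes maximal: "partial_hom H \<Longrightarrow> G \<subseteq> H \<Longrightarrow> H = G"
begin

lemma adjoin_value:
  assumes "\<And>p q. rel p q \<Longrightarrow> poly p x = 0 \<Longrightarrow> poly q a = 0"
  shows "(x, a) \<in> G"
proof -
  have "adjoin x a = G" using assms by (intro maximal partial_hom_adjoin subset_adjoin) blast
  then show ?thesis using in_adjoin by blast
qed

text \<open>
  The polynomials over \<open>'c\<close> that lift to polynomials with root \<open>x\<close> form an ideal; a common root
  of this ideal would be a possible value of \<open>x\<close>.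
\<close>

lemma no_value:
  assumes "\<And>a. (x, a) \<notin> G"
  obtains p where "rel p 1" "poly p x = 0"
proof -
  define J where "J = {q. \<exists>p. rel p q \<and> poly p x = 0}"
  have J_add: "q + q' \<in> J" if J: "q \<in> J" "q' \<in> J" for q q'
  proof -
    obtain p p' where "rel p q" "poly p x = 0" "rel p' q'" "poly p' x = 0"
      using J by (auto simp: J_def)
    then have "rel (p + p') (q + q')" "poly (p + p') x = 0" by (auto intro: rel_add)
    then show ?thesis unfolding J_def by blast
  qed
  have J_mult: "s * q \<in> J" if "q \<in> J" for q s
  proof -
    obtain p where "rel p q" "poly p x = 0" using \<open>q \<in> J\<close> by (auto simp: J_def)
    moreover obtain t where "rel t s" using rel_surj by blast
    ultimately have "rel (t * p) (s * q)" "poly (t * p) x = 0" by (auto intro: rel_mult)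
    then show ?thesis by (auto simp: J_def)
  qed
  have ex: "\<exists>q\<in>J. poly q a \<noteq> 0" for a
    using adjoin_value[of x a] assms by (auto simp: J_def)
  obtain q0 where "q0 \<in> J" "q0 \<noteq> 0" using ex[of 0] by fastforce
  then obtain q where q: "q \<in> J" "q \<noteq> 0" and min: "\<And>s. s \<in> J \<Longrightarrow> s \<noteq> 0 \<Longrightarrow> degree q \<le> degree s"
    using ex_has_least_nat[of "\<lambda>q. q \<in> J \<and> q \<noteq> 0" q0 degree] by blast
  have dvd: "q dvd s" if "s \<in> J" for s
  proof -
    have "s mod q = s + (- (s div q)) * q" by (simp add: minus_div_mult_eq_mod [symmetric])
    then have "s mod q \<in> J" using J_add[OF that J_mult[OF q(1), of "- (s div q)"]] by simp
    then have "s mod q = 0" using min[of "s mod q"] degree_mod_less[OF q(2), of s] by fastforce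
    then show ?thesis by auto
  qed
  have "degree q = 0"
  proof (rule ccontr)
    assume "degree q \<noteq> 0"
    then obtain a where "poly q a = 0" using alg_closed_imp_poly_has_root[of q] by auto
    then show False using ex[of a] dvd by (metis dvd_trans poly_eq_0_iff_dvd)
  qed
  then obtain c where c: "q = [:c:]" "c \<noteq> 0" using q(2) by (metis degree_eq_zeroE pCons_0_0)
  then have "1 \<in> J" using J_mult[OF q(1), of "[:1 / c:]"] by (simp add: one_pCons)
  then show ?thesis using that by (auto simp: J_def)
qed

text \<open>Without a value, \<open>e\<close> satisfies a relation lifting the polynomial 1. Powers
  of \<open>e\<close> collapse, so the relation reads \<open>p0 + t * e = 0\<close> with
  \<open>p0\<close> of value 1 and \<open>t\<close> of value 0. Where \<open>e\<close> is 1 this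
  gives \<open>p0 + t = 0\<close>, where \<open>e\<close> is 0 it gives \<open>p0 = 0\<close>; hence
  \<open>(p0 + t) * p0 = 0\<close>, although this product has value 1.\<close>

lemma idempotent_value:
  assumes e: "e * e = e"
  shows "(e, 0) \<in> G \<or> (e, 1) \<in> G"
proof (cases "\<exists>a. (e, a) \<in> G")
  case True
  then obtain a where a: "(e, a) \<in> G" by blast
  then have "a * a = a" using unique[OF mult[OF a a]] e by simp
  then show ?thesis using a by (metis mult_cancel_left1)
next
  case False
  then obtain p where p: "rel p 1" "poly p e = 0" using no_value by metis
  obtain p0 p' where pp: "p = pCons p0 p'" by (cases p)
  have p0: "(p0, 1) \<in> G" using p(1)[unfolded rel_def pp, rule_format, of 0] by simp
  have "rel p' 0"
    unfolding rel_def
  proof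
    fix i show "(coeff p' i, coeff 0 i) \<in> G"
      using p(1)[unfolded rel_def pp, rule_format, of "Suc i"] by (simp add: one_pCons)
  qed
  then have t: "(poly p' 1, 0) \<in> G" using rel_poly[OF _ one] by fastforce
  define t where "t = poly p' 1"
  have "e * poly r e = e * poly r 1" for r
  proof (induction r)
    case (pCons c r)
    have "e * poly (pCons c r) e = e * c + e * (e * poly r e)" by (simp add: algebra_simps)
    also have "e * (e * poly r e) = e * poly r 1"
      using pCons.IH e by (metis mult.assoc)
    finally show ?case by (simp add: algebra_simps)
  qed simp
  then have p0t: "p0 + t * e = 0" using p(2) by (simp add: pp t_def mult.commute)
  have "(p0 + t) * e = 0"
    using arg_cong[OF p0t, of "\<lambda>y. y * e"] e by (simp add: ring_distribs mult.assoc)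
  moreover have "p0 * (1 - e) = 0"
    using arg_cong[OF p0t, of "\<lambda>y. y * (1 - e)"] e by (simp add: ring_distribs mult.assoc)
  moreover have "(p0 + t) * p0 = p0 * ((p0 + t) * e) + (p0 + t) * (p0 * (1 - e))"
    by (simp add: algebra_simps)
  ultimately have "(p0 + t) * p0 = 0" by simp
  moreover have "((p0 + t) * p0, (1 + 0) * 1) \<in> G" using p0 t by (intro mult add) (auto simp: t_def)
  ultimately show ?thesis using zero_unique by force
qed

text \<open>The classical step of Chevalley's extension theorem, with degrees made explicit for a descent.\<close>

lemma not_both_unimodular:
  assumes e: "(x * y, 1) \<in> G" "x * y * x = x" "x * y * y = y"
    and r: "(r 0, 1) \<in> G" "\<And>i. i > 0 \<Longrightarrow> (r i, 0) \<in> G" "(\<Sum>i\<le>N. r i * x ^ i) = 0"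
    and n: "(n 0, 1) \<in> G" "\<And>i. i > 0 \<Longrightarrow> (n i, 0) \<in> G" "(\<Sum>i\<le>M. n i * y ^ i) = 0"
  shows False
  using assms
proof (induction "N + M" arbitrary: N M x y r n rule: less_induct)
  case less
  \<comment> \<open>The descent step when the relation of \<open>x\<close> has the larger degree;
    the other case exchanges \<open>x\<close> and \<open>y\<close>.\<close>
  have ind: False
    if e: "(x * y, 1) \<in> G" "x * y * x = x" "x * y * y = y"
    and r: "(r 0, 1) \<in> G" "\<And>i. i > 0 \<Longrightarrow> (r i, 0) \<in> G" "(\<Sum>i\<le>N. r i * x ^ i) = 0"
    and n: "(n 0, 1) \<in> G" "\<And>i. i > 0 \<Longrightarrow> (n i, 0) \<in> G" "(\<Sum>i\<le>M. n i * y ^ i) = 0"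
    and le: "M \<le> N"
    and IH: "\<And>N' r'. N' < N \<Longrightarrow> (r' 0, 1) \<in> G \<Longrightarrow> (\<And>i. i > 0 \<Longrightarrow> (r' i, 0) \<in> G) \<Longrightarrow>
        (\<Sum>i\<le>N'. r' i * x ^ i) = 0 \<Longrightarrow> False"
    for N M x y r n
  proof (cases "M = 0")
    case True
    then show False using n zero_unique[of 1] by simp
  next
    case False
    \<comment> \<open>After multiplication by this idempotent of value 1, \<open>y\<close> behaves
      as the inverse of \<open>x\<close>, so the relation of \<open>y\<close> can be reversed into
      one of \<open>x\<close>.\<close>
    define e where "e = x * y"
    have "x * y * (x * y) = x * y * x * y" by (simp only: mult.assoc)
    then have ee: "e * e = e" "(e, 1) \<in> G" using e by (simp_all add: e_def)
    have xy: "e * (x ^ M * y ^ j) = e * x ^ (M - j)" if "j \<le> M" for j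
    proof -
      have ek: "e * e ^ j = e" for j by (induction j) (use ee in \<open>auto simp: mult.assoc[symmetric]\<close>)
      have "x ^ M * y ^ j = x ^ (M - j) * e ^ j"
        using that by (simp add: e_def power_mult_distrib mult.assoc[symmetric] power_add[symmetric])
      then have "e * (x ^ M * y ^ j) = e * e ^ j * x ^ (M - j)" by (simp only: mult_ac)
      then show ?thesis using ek[of j] by simp
    qed
    have rev: "(\<Sum>j\<le>M. e * n j * x ^ (M - j)) = 0"
    proof -
      have "(\<Sum>j\<le>M. e * n j * x ^ (M - j)) = (\<Sum>j\<le>M. n j * (e * (x ^ M * y ^ j)))"
        by (intro sum.cong refl) (simp add: xy mult_ac)
      also have "\<dots> = e * x ^ M * (\<Sum>j\<le>M. n j * y ^ j)"
        by (simp add: sum_distrib_left mult_ac)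
      finally show ?thesis using n by simp
    qed
    \<comment> \<open>The reversed relation, shifted to degree \<open>N\<close>, has leading
      coefficient \<open>e * n 0\<close>. Multiplying the relation of \<open>x\<close> by the same
      element and subtracting \<open>r N\<close> times the shifted one cancels the top term. Since
      \<open>r N\<close> has value 0, all values of the coefficients survive.\<close>
    define r' where "r' = (\<lambda>i. e * n 0 * r i - (if N - i \<le> M then r N * (e * n (N - i)) else 0))"
    have rN: "(r N, 0) \<in> G" using r False le by simp
    have top: "r' N = 0" by (simp add: r'_def algebra_simps)
    have "(\<Sum>i\<le>N. (if N - i \<le> M then r N * (e * n (N - i)) else 0) * x ^ i) =
        (\<Sum>j\<le>N. (if j \<le> M then r N * (e * n j) else 0) * x ^ (N - j))"
      by (rule sum.reindex_bij_witness[of _ "\<lambda>j. N - j" "\<lambda>i. N - i"]) auto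
    also have "\<dots> = (\<Sum>j\<le>M. r N * (e * n j) * x ^ (N - j))"
      using le by (intro sum.mono_neutral_cong_right) auto
    also have "\<dots> = r N * x ^ (N - M) * (\<Sum>j\<le>M. e * n j * x ^ (M - j))"
      unfolding sum_distrib_left
    proof (intro sum.cong refl)
      fix j assume "j \<in> {..M}"
      then have "x ^ (N - j) = x ^ (N - M) * x ^ (M - j)"
        using le by (simp add: power_add[symmetric])
      then show "r N * (e * n j) * x ^ (N - j) = r N * x ^ (N - M) * (e * n j * x ^ (M - j))"
        by (simp add: mult_ac)
    qed
    finally have "(\<Sum>i\<le>N. (if N - i \<le> M then r N * (e * n (N - i)) else 0) * x ^ i) = 0"
      unfolding rev by simp
    then have "(\<Sum>i\<le>N. r' i * x ^ i) = e * n 0 * (\<Sum>i\<le>N. r i * x ^ i)"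
      by (simp add: r'_def sum_subtractf left_diff_distrib sum_distrib_left mult.assoc)
    then have "(\<Sum>i\<le>N. r' i * x ^ i) = 0" using r by simp
    moreover obtain N' where N': "N = Suc N'" using False le by (cases N) auto
    ultimately have "(\<Sum>i\<le>N'. r' i * x ^ i) = 0" using top by simp
    moreover have *: "(if N - i \<le> M then r N * (e * n (N - i)) else 0, 0) \<in> G" for i
    proof (cases "N - i = 0")
      case True
      then show ?thesis using mult[OF rN mult[OF ee(2) n(1)]] by simp
    next
      case False
      then show ?thesis using mult[OF rN mult[OF ee(2) n(2)[of "N - i"]]] zero by simp
    qed
    moreover have "(r' 0, 1) \<in> G"
      using diff[OF mult[OF mult[OF ee(2) n(1)] r(1)] *[of 0]] by (simp add: r'_def)
    moreover have "(r' i, 0) \<in> G" if "i > 0" for i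
      using diff[OF mult[OF mult[OF ee(2) n(1)] r(2)[OF that]] *[of i]] by (simp add: r'_def)
    ultimately show False using IH[of N' r'] N' by simp
  qed
  show False
  proof (cases "M \<le> N")
    case True
    show False
    proof (rule ind[OF less.prems True])
      fix N' r' assume "N' < N" "(r' 0, 1) \<in> G" "\<And>i. i > 0 \<Longrightarrow> (r' i, 0) \<in> G"
        "(\<Sum>i\<le>N'. r' i * x ^ i) = 0"
      then show False using less.hyps[OF _ less.prems(1-3) _ _ _ less.prems(7-9), of N' r'] by simp
    qed
  next
    case False
    have e: "(y * x, 1) \<in> G" "y * x * y = y" "y * x * x = x"
      using less.prems(1-3) by (simp_all add: mult_ac)
    show False
    proof (rule ind[OF e less.prems(7-9) less.prems(4-6)])
      fix N' r' assume "N' < M" "(r' 0, 1) \<in> G" "\<And>i. i > 0 \<Longrightarrow> (r' i, 0) \<in> G"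
        "(\<Sum>i\<le>N'. r' i * y ^ i) = 0"
      then show False using less.hyps[OF _ e _ _ _ less.prems(4-6), of N' r'] by simp
    next
      show "N \<le> M" using \<open>\<not> M \<le> N\<close> by simp
    qed
  qed
qed

text \<open>The idempotent \<open>x * y\<close> marks where \<open>x\<close> is invertible. If it
  has value 0, then \<open>1 - x * y\<close> has value 1 and kills \<open>x\<close>, so 0 is an
  admissible value of \<open>x\<close>. If it has value 1 and \<open>x\<close> has no value, then
  \<open>y\<close> must have a value by \<open>not_both_unimodular\<close>, and the reversed
  relation of \<open>x\<close> forces that value to be 0.\<close>

lemma value_or_inverse:
  assumes xyx: "x * y * x = x" "x * y * y = y"
  shows "(\<exists>a. (x, a) \<in> G) \<or> (y, 0) \<in> G \<and> (x * y, 1) \<in> G"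
proof (cases "\<exists>a. (x, a) \<in> G")
  case no_x: False
  have idem: "x * y * (x * y) = x * y" using xyx by (metis mult.assoc)
  then consider "(x * y, 0) \<in> G" | "(x * y, 1) \<in> G" using idempotent_value by blast
  then show ?thesis
  proof cases
    case 1
    have "(x, 0) \<in> G"
    proof (rule adjoin_value)
      fix p q assume pq: "rel p q" "poly p x = 0"
      obtain p0 p' where pp: "p = pCons p0 p'" by (cases p)
      obtain q0 q' where qq: "q = pCons q0 q'" by (cases q)
      have "(p0, q0) \<in> G" using pq(1)[unfolded rel_def pp qq, rule_format, of 0] by simp
      then have "((1 - x * y) * p0, (1 - 0) * q0) \<in> G" by (intro mult diff one 1)
      moreover have "(1 - x * y) * (p0 + x * poly p' x) = (1 - x * y) * p0"
        using xyx(1) by (simp add: algebra_simps) (metis mult.assoc)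
      then have "(1 - x * y) * p0 = 0" using pq(2) by (simp add: pp)
      ultimately show "poly q 0 = 0" using zero_unique qq by simp
    qed
    then show ?thesis by blast
  next
    case 2
    obtain p where p: "rel p 1" "poly p x = 0" using no_value no_x by metis
    have rel1: "(coeff p i, if i = 0 then 1 else 0) \<in> G" for i
      using p(1)[unfolded rel_def, rule_format, of i] by (cases "i = 0") (simp_all add: coeff_1)
    have coeff_p: "(coeff p 0, 1) \<in> G" "\<And>i. i > 0 \<Longrightarrow> (coeff p i, 0) \<in> G"
      using rel1[of 0] rel1 by (simp, metis less_not_refl)
    have sum_p: "(\<Sum>i\<le>degree p. coeff p i * x ^ i) = 0" using p(2) by (simp add: poly_altdef)
    show ?thesis
    proof (cases "\<exists>b. (y, b) \<in> G")
      case True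
      then obtain b where b: "(y, b) \<in> G" by blast
      have "b = 0"
      proof (rule ccontr)
        assume "b \<noteq> 0"
        define M where "M = degree p"
        have xy: "x * y * (x ^ i * y ^ M) = x * y * y ^ (M - i)" if "i \<le> M" for i
        proof -
          have ek: "x * y * (x * y) ^ j = x * y" for j
            by (induction j) (use idem in \<open>auto simp: mult.assoc[symmetric]\<close>)
          have "x ^ i * y ^ M = (x * y) ^ i * y ^ (M - i)"
            using that by (simp add: power_mult_distrib mult.assoc power_add[symmetric])
          then show ?thesis using ek[of i] by (simp add: mult.assoc[symmetric])
        qed
        \<comment> \<open>The relation of \<open>x\<close> multiplied by
          \<open>x * y * y ^ M\<close>; its reduction is \<open>b ^ M = 0\<close>.\<close>
        have "(\<Sum>i\<le>M. x * y * (coeff p i * y ^ (M - i)), \<Sum>i\<le>M. 1 * (coeff 1 i * b ^ (M - i))) \<in> G"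
          using p(1) by (intro sum mult power b 2) (auto simp: rel_def)
        moreover have "(\<Sum>i\<le>M. x * y * (coeff p i * y ^ (M - i))) =
            x * y * y ^ M * (\<Sum>i\<le>M. coeff p i * x ^ i)"
          unfolding sum_distrib_left
        proof (intro sum.cong refl)
          fix i assume "i \<in> {..M}"
          then have "x * y * (x ^ i * y ^ M) = x * y * y ^ (M - i)" using xy by simp
          then have "coeff p i * (x * y * y ^ (M - i)) = coeff p i * (x * y * (x ^ i * y ^ M))" by simp
          then show "x * y * (coeff p i * y ^ (M - i)) = x * y * y ^ M * (coeff p i * x ^ i)"
            by (simp only: mult_ac)
        qed
        moreover have "(\<Sum>i\<le>M. coeff p i * x ^ i) = 0" using sum_p by (simp only: M_def)
        ultimately have "(0, \<Sum>i\<le>M. 1 * (coeff 1 i * b ^ (M - i))) \<in> G"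
          by (simp only: mult_zero_right)
        then have "(\<Sum>i\<le>M. coeff 1 i * b ^ (M - i)) = 0"
          by (auto dest: zero_unique simp only: mult_1_left)
        moreover have "(\<Sum>i\<le>M. coeff 1 i * b ^ (M - i)) = (\<Sum>i\<in>{0}. coeff 1 i * b ^ (M - i))"
          by (rule sum.mono_neutral_right) auto
        ultimately show False using \<open>b \<noteq> 0\<close> by simp
      qed
      then show ?thesis using b 2 by blast
    next
      case False
      then obtain n where n: "rel n 1" "poly n y = 0" using no_value by metis
      have rel1': "(coeff n i, if i = 0 then 1 else 0) \<in> G" for i
        using n(1)[unfolded rel_def, rule_format, of i] by (cases "i = 0") (simp_all add: coeff_1)
      have coeff_n: "(coeff n 0, 1) \<in> G" "\<And>i. i > 0 \<Longrightarrow> (coeff n i, 0) \<in> G"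
        using rel1'[of 0] rel1' by (simp, metis less_not_refl)
      have sum_n: "(\<Sum>i\<le>degree n. coeff n i * y ^ i) = 0" using n(2) by (simp add: poly_altdef)
      show ?thesis
        using not_both_unimodular[OF 2 xyx coeff_p sum_p coeff_n sum_n] by blast
    qed
  qed
qed blast

end

section \<open>Zorn's lemma and the existence of places\<close>

lemma (in partial_hom) extends_to_maximal:
  obtains H where "maximal_partial_hom H" "G \<subseteq> H"
proof -
  define \<A> where "\<A> = {H. partial_hom H \<and> G \<subseteq> H}"
  have "\<Union>C \<in> \<A>" if C: "C \<noteq> {}" "subset.chain \<A> C" for C
  proof -
    have mem: "partial_hom H" "G \<subseteq> H" if "H \<in> C" for H
      using C that by (auto simp: \<A>_def subset.chain_def)
    have pair: "\<exists>H\<in>C. u \<in> H \<and> v \<in> H" if "u \<in> \<Union>C" "v \<in> \<Union>C" for u v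
    proof -
      from that obtain H H' where "H \<in> C" "u \<in> H" "H' \<in> C" "v \<in> H'" by blast
      moreover from this have "H \<subseteq> H' \<or> H' \<subseteq> H"
        using C(2) unfolding subset.chain_def by blast
      ultimately show ?thesis by blast
    qed
    have "partial_hom (\<Union>C)"
    proof
      show "(1, 1) \<in> \<Union>C" using C(1) mem(2) one by blast
    next
      fix x a y b assume "(x, a) \<in> \<Union>C" "(y, b) \<in> \<Union>C"
      then obtain H where H: "H \<in> C" "(x, a) \<in> H" "(y, b) \<in> H" using pair by meson
      interpret H: partial_hom H using mem H by blast
      show "(x + y, a + b) \<in> \<Union>C" "(x * y, a * b) \<in> \<Union>C" using H H.add H.mult by blast+
    next
      fix x a assume "(x, a) \<in> \<Union>C"
      then show "(- x, - a) \<in> \<Union>C" using mem(1) partial_hom.uminus by blast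
    next
      fix a show "\<exists>x. (x, a) \<in> \<Union>C" using C(1) mem(2) surj by blast
    next
      fix a assume "(0, a) \<in> \<Union>C"
      then show "a = 0" using mem(1) partial_hom.zero_unique by blast
    qed
    then show ?thesis using C(1) mem(2) by (auto simp: \<A>_def)
  qed
  moreover have "\<A> \<noteq> {}" using partial_hom_axioms by (auto simp: \<A>_def)
  ultimately obtain H where H: "H \<in> \<A>" "\<forall>X\<in>\<A>. H \<subseteq> X \<longrightarrow> X = H"
    using subset_Zorn_nonempty[of \<A>] by blast
  have "maximal_partial_hom H"
    using H by (auto simp: maximal_partial_hom_def maximal_partial_hom_axioms_def \<A>_def)
  then show ?thesis using that H by (auto simp: \<A>_def)
qed

text \<open>
  The last axiom is the valuation ring property; its second conjunct excludes functions that vanish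
  almost everywhere, for which \<open>inverse x\<close> tends to \<open>0\<close> only because \<open>inverse 0 = 0\<close>.
\<close>

locale place =
  fixes lim :: "('s \<Rightarrow> 'a::alg_closed_field) \<Rightarrow> 'a \<Rightarrow> bool"
  assumes lim_const [intro]: "lim (\<lambda>s. c) c"
    and lim_add: "lim x a \<Longrightarrow> lim y b \<Longrightarrow> lim (\<lambda>s. x s + y s) (a + b)"
    and lim_mult: "lim x a \<Longrightarrow> lim y b \<Longrightarrow> lim (\<lambda>s. x s * y s) (a * b)"
    and lim_unique: "lim x a \<Longrightarrow> lim x b \<Longrightarrow> a = b"
    and lim_or_inverse:
      "(\<exists>a. lim x a) \<or> lim (\<lambda>s. inverse (x s)) 0 \<and> lim (\<lambda>s. x s * inverse (x s)) 1"

text \<open>The ring of all functions on \<open>'s\<close> is von Neumann regular: thanks to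
  \<open>inverse 0 = 0\<close>, the pointwise inverse satisfies both identities required by
  \<open>value_or_inverse\<close>, also where the function vanishes.\<close>

lemma place_exists:
  fixes lim0 :: "('s \<Rightarrow> 'a::alg_closed_field) \<Rightarrow> 'a \<Rightarrow> bool"
  assumes const: "\<And>c. lim0 (\<lambda>s. c) c"
    and add: "\<And>x y a b. lim0 x a \<Longrightarrow> lim0 y b \<Longrightarrow> lim0 (\<lambda>s. x s + y s) (a + b)"
    and mult: "\<And>x y a b. lim0 x a \<Longrightarrow> lim0 y b \<Longrightarrow> lim0 (\<lambda>s. x s * y s) (a * b)"
    and zero: "\<And>a. lim0 (\<lambda>s. 0) a \<Longrightarrow> a = 0"
  obtains lim where "place lim" "\<And>x a. lim0 x a \<Longrightarrow> lim x a"
proof -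
  interpret partial_hom "{(x, a). lim0 x a}"
  proof
    show "\<exists>x. (x, a) \<in> {(x, a). lim0 x a}" for a using const[of a] by blast
  next
    fix x a assume "(x, a) \<in> {(x, a). lim0 x a}"
    then show "(- x, - a) \<in> {(x, a). lim0 x a}"
      using mult[OF const[of "-1"], of x a] by (simp add: fun_Compl_def)
  qed (use const[of 1] add mult zero in \<open>auto simp: one_fun_def plus_fun_def times_fun_def zero_fun_def\<close>)
  obtain H where H: "maximal_partial_hom H" "{(x, a). lim0 x a} \<subseteq> H"
    using extends_to_maximal by blast
  then interpret H: maximal_partial_hom H by blast
  have "place (\<lambda>x a. (x, a) \<in> H)"
  proof
    fix x :: "'s \<Rightarrow> 'a"
    have u: "u * inverse u * u = u" "u * inverse u * inverse u = inverse u" for u :: 'a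
      by (cases "u = 0"; simp)+
    have "x * (\<lambda>s. inverse (x s)) * x = x"
      "x * (\<lambda>s. inverse (x s)) * (\<lambda>s. inverse (x s)) = (\<lambda>s. inverse (x s))"
      by (simp_all only: fun_eq_iff times_fun_def u simp_thms)
    from H.value_or_inverse[OF this]
    show "(\<exists>a. (x, a) \<in> H) \<or> ((\<lambda>s. inverse (x s), 0) \<in> H \<and> (\<lambda>s. x s * inverse (x s), 1) \<in> H)"
      by (simp add: times_fun_def)
  qed (use H(2) const H.add H.mult H.unique in \<open>auto simp: plus_fun_def times_fun_def\<close>)
  then show ?thesis using that[of "\<lambda>x a. (x, a) \<in> H"] H(2) by blast
qed

section \<open>Limits along a place\<close>

context place
begin

definition fin :: "('s \<Rightarrow> 'a) \<Rightarrow> bool" where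
  "fin x \<longleftrightarrow> (\<exists>a. lim x a)"

text \<open>A place determines an ultrafilter on the index set; \<open>ev P\<close> says that \<open>P\<close> belongs to it.\<close>

definition ev :: "('s \<Rightarrow> bool) \<Rightarrow> bool" where
  "ev P \<longleftrightarrow> lim (\<lambda>s. of_bool (P s)) 1"

text \<open>An indicator function is its own pointwise inverse, so either alternative of
  \<open>lim_or_inverse\<close> gives it a limit; being idempotent, this limit is 0 or 1.\<close>

lemma ev_cases: "lim (\<lambda>s. of_bool (P s)) 0 \<or> ev P"
proof -
  define e where "e = (\<lambda>s. of_bool (P s) :: 'a)"
  have "e s * e s = e s" "inverse (e s) = e s" for s by (auto simp: e_def)
  then obtain a where a: "lim e a" using lim_or_inverse[of e] by auto
  have "lim (\<lambda>s. e s * e s) (a * a)" using a by (rule lim_mult[OF a])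
  then have "lim e (a * a)" by (simp only: \<open>\<And>s. e s * e s = e s\<close>)
  then have "a * a = a" using a lim_unique by blast
  then show ?thesis using a unfolding ev_def e_def by (metis mult_cancel_left1)
qed

lemma ev_True [simp]: "ev (\<lambda>s. True)"
  using lim_const[of 1] by (simp add: ev_def)

lemma not_ev_False [simp]: "\<not> ev (\<lambda>s. False)"
  using lim_const[of 0] lim_unique[of "\<lambda>s. 0" 0 1] by (auto simp: ev_def)

lemma ev_conj: "ev P \<Longrightarrow> ev Q \<Longrightarrow> ev (\<lambda>s. P s \<and> Q s)"
  using lim_mult[of "\<lambda>s. of_bool (P s)" 1 "\<lambda>s. of_bool (Q s)" 1] by (simp add: ev_def of_bool_conj)

lemma ev_not: "ev (\<lambda>s. \<not> P s) \<longleftrightarrow> \<not> ev P"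
proof
  show "ev (\<lambda>s. \<not> P s) \<Longrightarrow> \<not> ev P"
    using ev_conj[of P "\<lambda>s. \<not> P s"] by auto
  assume "\<not> ev P"
  then have "lim (\<lambda>s. 1 + (-1) * of_bool (P s)) (1 + (-1) * 0)"
    using ev_cases[of P] by (intro lim_add lim_mult lim_const) auto
  moreover have "(\<lambda>s. 1 + (-1) * of_bool (P s) :: 'a) = (\<lambda>s. of_bool (\<not> P s))" by auto
  ultimately show "ev (\<lambda>s. \<not> P s)" by (simp add: ev_def)
qed

lemma ev_mono: "ev P \<Longrightarrow> (\<And>s. P s \<Longrightarrow> Q s) \<Longrightarrow> ev Q"
proof (rule ccontr)
  assume "ev P" and PQ: "\<And>s. P s \<Longrightarrow> Q s" and "\<not> ev Q"
  then have "ev (\<lambda>s. P s \<and> \<not> Q s)" by (intro ev_conj) (simp_all add: ev_not)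
  moreover have "(\<lambda>s. P s \<and> \<not> Q s) = (\<lambda>s. False)" using PQ by auto
  ultimately show False using not_ev_False by simp
qed

lemma ev_mp: "ev P \<Longrightarrow> ev Q \<Longrightarrow> (\<And>s. P s \<Longrightarrow> Q s \<Longrightarrow> R s) \<Longrightarrow> ev R"
  using ev_conj[of P Q] ev_mono[of "\<lambda>s. P s \<and> Q s" R] by blast

lemma ev_all_finite: "finite I \<Longrightarrow> (\<And>i. i \<in> I \<Longrightarrow> ev (P i)) \<Longrightarrow> ev (\<lambda>s. \<forall>i\<in>I. P i s)"
  by (induction I rule: finite_induct) (auto intro: ev_conj)

lemma lim_of_bool_0: "\<not> ev P \<Longrightarrow> lim (\<lambda>s. of_bool (P s)) 0"
  using ev_cases by blast

text \<open>The indicator \<open>e\<close> of the support tends to 0, and \<open>z = e * z\<close>,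
  so a limit of \<open>z\<close> can only be 0. If there were none, \<open>z * inverse z = e\<close>
  would tend to 1: this is where the second conjunct of \<open>lim_or_inverse\<close>
  enters.\<close>

lemma lim_ev_zero:
  assumes "ev (\<lambda>s. z s = 0)"
  shows "lim z 0"
proof -
  define e where "e = (\<lambda>s. of_bool (z s \<noteq> 0) :: 'a)"
  have e: "lim e 0" unfolding e_def using assms ev_not[of "\<lambda>s. z s \<noteq> 0"] by (intro lim_of_bool_0) simp
  show ?thesis
  proof (cases "\<exists>a. lim z a")
    case True
    then obtain a where a: "lim z a" by blast
    have "(\<lambda>s. e s * z s) = z" by (auto simp: e_def)
    then have "lim z (0 * a)" using lim_mult[OF e a] by simp
    then show ?thesis by simp
  next
    case False
    then have "lim (\<lambda>s. z s * inverse (z s)) 1" using lim_or_inverse by blast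
    moreover have "(\<lambda>s. z s * inverse (z s)) = e" by (auto simp: e_def)
    ultimately show ?thesis using e lim_unique zero_neq_one by metis
  qed
qed

lemma lim_cong:
  assumes "lim x a" "ev (\<lambda>s. x s = y s)"
  shows "lim y a"
proof -
  have "lim (\<lambda>s. y s - x s) 0" using assms(2) by (intro lim_ev_zero) (auto elim: ev_mono)
  from lim_add[OF assms(1) this] show ?thesis by simp
qed

lemma fin_cong: "fin x \<Longrightarrow> ev (\<lambda>s. x s = y s) \<Longrightarrow> fin y"
  unfolding fin_def using lim_cong by blast

lemma lim_uminus: "lim x a \<Longrightarrow> lim (\<lambda>s. - x s) (- a)"
  using lim_mult[OF lim_const[of "-1"], of x a] by simp

lemma lim_sum: "(\<And>i. i \<in> I \<Longrightarrow> lim (x i) (a i)) \<Longrightarrow> lim (\<lambda>s. \<Sum>i\<in>I. x i s) (\<Sum>i\<in>I. a i)"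
  by (induction I rule: infinite_finite_induct) (auto intro: lim_add)

lemma lim_prod: "(\<And>i. i \<in> I \<Longrightarrow> lim (x i) (a i)) \<Longrightarrow> lim (\<lambda>s. \<Prod>i\<in>I. x i s) (\<Prod>i\<in>I. a i)"
  by (induction I rule: infinite_finite_induct) (auto intro: lim_mult)

lemma lim_power: "lim x a \<Longrightarrow> lim (\<lambda>s. x s ^ n) (a ^ n)"
  by (induction n) (auto intro: lim_mult)

lemma fin_const [simp]: "fin (\<lambda>s. c)"
  unfolding fin_def by blast

lemma fin_add: "fin x \<Longrightarrow> fin y \<Longrightarrow> fin (\<lambda>s. x s + y s)"
  unfolding fin_def using lim_add by blast

lemma fin_mult: "fin x \<Longrightarrow> fin y \<Longrightarrow> fin (\<lambda>s. x s * y s)"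
  unfolding fin_def using lim_mult by blast

lemma fin_uminus: "fin x \<Longrightarrow> fin (\<lambda>s. - x s)"
  unfolding fin_def using lim_uminus by blast

lemma not_fin:
  assumes "\<not> fin x"
  shows "lim (\<lambda>s. inverse (x s)) 0" "ev (\<lambda>s. x s \<noteq> 0)"
proof -
  show "lim (\<lambda>s. inverse (x s)) 0" using assms lim_or_inverse unfolding fin_def by blast
  show "ev (\<lambda>s. x s \<noteq> 0)"
    using assms lim_ev_zero[of x] ev_not[of "\<lambda>s. x s = 0"] unfolding fin_def by blast
qed

lemma lim_inverse:
  assumes "lim x a" "a \<noteq> 0"
  shows "lim (\<lambda>s. inverse (x s)) (inverse a)" "ev (\<lambda>s. x s \<noteq> 0)"
proof -
  show ev: "ev (\<lambda>s. x s \<noteq> 0)"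
    using assms lim_ev_zero[of x] lim_unique ev_not[of "\<lambda>s. x s = 0"] by blast
  have "fin (\<lambda>s. inverse (x s))"
    using not_fin(1)[of "\<lambda>s. inverse (x s)"] assms lim_unique by force
  then obtain b where b: "lim (\<lambda>s. inverse (x s)) b" unfolding fin_def by blast
  have "lim (\<lambda>s. 1) (a * b)"
    using lim_mult[OF assms(1) b] by (rule lim_cong) (use ev in \<open>auto elim: ev_mono\<close>)
  then have "a * b = 1" using lim_unique by blast
  then show "lim (\<lambda>s. inverse (x s)) (inverse a)" using b inverse_unique by metis
qed

text \<open>A valuation ring is integrally closed: for unbounded \<open>x\<close> the product of the
  bounded \<open>x ^ n\<close> with the null family \<open>inverse x ^ n\<close> would be almost
  everywhere 1.\<close>

lemma fin_of_fin_power: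
  assumes "fin (\<lambda>s. x s ^ n)" "n > 0"
  shows "fin x"
proof (rule ccontr)
  assume x: "\<not> fin x"
  obtain a where a: "lim (\<lambda>s. x s ^ n) a" using assms fin_def by blast
  have "lim (\<lambda>s. x s ^ n * inverse (x s) ^ n) (a * 0 ^ n)"
    using a not_fin(1)[OF x] by (intro lim_mult lim_power)
  then have "lim (\<lambda>s. 1) (a * 0 ^ n)"
    by (rule lim_cong) (use not_fin(2)[OF x] in \<open>auto elim!: ev_mono simp: power_mult_distrib[symmetric]\<close>)
  then show False using lim_unique assms(2) by (metis lim_const mult_zero_right zero_neq_one zero_power)
qed

text \<open>As \<open>fin (x / y)\<close> means \<open>v x \<ge> v y\<close>, the member \<open>x j\<close> has the minimal valuation.\<close>

lemma dominant_member:
  assumes "finite I"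
  shows "(\<forall>i\<in>I. ev (\<lambda>s. x i s = 0)) \<or>
    (\<exists>j\<in>I. ev (\<lambda>s. x j s \<noteq> 0) \<and> (\<forall>i\<in>I. fin (\<lambda>s. x i s * inverse (x j s))))"
  using assms
proof (induction I rule: finite_induct)
  case (insert k I)
  have fin_zero: "fin (\<lambda>s. x i s * inverse (x j s))" if "ev (\<lambda>s. x i s = 0)" for i j
    unfolding fin_def by (rule exI[of _ 0], rule lim_ev_zero) (use that in \<open>auto elim: ev_mono\<close>)
  have fin_self: "fin (\<lambda>s. x i s * inverse (x i s))" if "ev (\<lambda>s. x i s \<noteq> 0)" for i
    by (rule fin_cong[of "\<lambda>s. 1"]) (use that in \<open>auto elim: ev_mono\<close>)
  consider "ev (\<lambda>s. x k s = 0)" | "ev (\<lambda>s. x k s \<noteq> 0)" using ev_not[of "\<lambda>s. x k s = 0"] by blast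
  then show ?case
  proof cases
    case 1
    then show ?thesis using insert.IH fin_zero by blast
  next
    case k: 2
    from insert.IH show ?thesis
    proof
      assume "\<forall>i\<in>I. ev (\<lambda>s. x i s = 0)"
      then show ?thesis using k fin_zero fin_self by blast
    next
      assume "\<exists>j\<in>I. ev (\<lambda>s. x j s \<noteq> 0) \<and> (\<forall>i\<in>I. fin (\<lambda>s. x i s * inverse (x j s)))"
      then obtain j where j: "j \<in> I" "ev (\<lambda>s. x j s \<noteq> 0)"
        "\<And>i. i \<in> I \<Longrightarrow> fin (\<lambda>s. x i s * inverse (x j s))" by blast
      show ?thesis
      proof (cases "fin (\<lambda>s. x k s * inverse (x j s))")
        case True
        then show ?thesis using j by blast
      next
        case False
        then have jk: "fin (\<lambda>s. x j s * inverse (x k s))"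
          using not_fin(1)[of "\<lambda>s. x k s * inverse (x j s)"] by (auto simp: fin_def mult.commute)
        have "fin (\<lambda>s. x i s * inverse (x k s))" if "i \<in> I" for i
          using fin_mult[OF j(3)[OF that] jk]
          by (rule fin_cong) (use j(2) in \<open>auto elim!: ev_mono\<close>)
        then show ?thesis using k fin_self by blast
      qed
    qed
  qed
qed simp

end

section \<open>Multivariate polynomials\<close>

locale ring_morphism =
  fixes \<phi> :: "'b::comm_ring_1 \<Rightarrow> 'c::comm_ring_1"
  assumes one [simp]: "\<phi> 1 = 1"
    and add: "\<phi> (x + y) = \<phi> x + \<phi> y"
    and mult: "\<phi> (x * y) = \<phi> x * \<phi> y"
begin

lemma zero [simp]: "\<phi> 0 = 0"
  using add[of 0 0] by simp

lemma sum: "\<phi> (\<Sum>i\<in>I. x i) = (\<Sum>i\<in>I. \<phi> (x i))"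
  by (induction I rule: infinite_finite_induct) (auto simp: add)

lemma prod: "\<phi> (\<Prod>i\<in>I. x i) = (\<Prod>i\<in>I. \<phi> (x i))"
  by (induction I rule: infinite_finite_induct) (auto simp: mult)

lemma power: "\<phi> (x ^ n) = \<phi> x ^ n"
  by (induction n) (auto simp: mult)

end

lemma ring_morphism_id: "ring_morphism (\<lambda>c. c)"
  by unfold_locales auto

lemma ring_morphism_mconst: "ring_morphism mconst"
  by unfold_locales (auto simp: mconst_def single_add mult_single)

lemma ring_morphism_pCons: "ring_morphism (\<lambda>c. [:c:])"
  by unfold_locales (auto simp: one_pCons)

abbreviation mono_val :: "('x \<Rightarrow> 'b::comm_monoid_mult) \<Rightarrow> ('x \<Rightarrow>\<^sub>0 nat) \<Rightarrow> 'b" where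
  "mono_val x \<mu> \<equiv> \<Prod>i\<in>Poly_Mapping.keys \<mu>. x i ^ Poly_Mapping.lookup \<mu> i"

lemma mono_val_superset:
  "finite I \<Longrightarrow> Poly_Mapping.keys \<mu> \<subseteq> I \<Longrightarrow> mono_val x \<mu> = (\<Prod>i\<in>I. x i ^ Poly_Mapping.lookup \<mu> i)"
  by (intro prod.mono_neutral_left) (auto simp: in_keys_iff)

lemma mono_val_add: "mono_val x (\<mu> + \<nu>) = mono_val x \<mu> * mono_val x \<nu>"
proof -
  define I where "I = Poly_Mapping.keys \<mu> \<union> Poly_Mapping.keys \<nu>"
  have I: "finite I" "Poly_Mapping.keys \<mu> \<subseteq> I" "Poly_Mapping.keys \<nu> \<subseteq> I" "Poly_Mapping.keys (\<mu> + \<nu>) \<subseteq> I"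
    using keys_add[of \<mu> \<nu>] by (auto simp: I_def)
  show ?thesis
    unfolding mono_val_superset[OF I(1,2)] mono_val_superset[OF I(1,3)] mono_val_superset[OF I(1,4)]
    by (simp add: lookup_add power_add prod.distrib)
qed

lemma poly_mapping_as_sum:
  fixes p :: "'x \<Rightarrow>\<^sub>0 'b::comm_monoid_add"
  shows "p = (\<Sum>\<mu>\<in>Poly_Mapping.keys p. Poly_Mapping.single \<mu> (Poly_Mapping.lookup p \<mu>))"
  by (rule poly_mapping_eqI)
     (auto simp: lookup_sum lookup_single when_def in_keys_iff if_distrib cong: if_cong)

lemma mpoly_induct [case_names single add]:
  assumes "\<And>\<mu> c. P (Poly_Mapping.single \<mu> c)"
    and "\<And>p q. P p \<Longrightarrow> P q \<Longrightarrow> P (p + q)"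
  shows "P (p :: ('x, 'a::comm_ring_1) mpoly)"
proof -
  have "P (\<Sum>\<mu>\<in>A. Poly_Mapping.single \<mu> (f \<mu>))" if "finite A" for A f
    using that
  proof (induction A)
    case empty
    then show ?case using assms(1)[of 0 0] by simp
  qed (auto intro: assms)
  then show ?thesis using poly_mapping_as_sum[of p] by (metis finite_keys)
qed

lemma lookup_mconst_mult [simp]:
  "Poly_Mapping.lookup (mconst c * p) \<mu> = c * Poly_Mapping.lookup (p :: ('x, 'a::comm_ring_1) mpoly) \<mu>"
proof (induction p rule: mpoly_induct)
  case (single \<nu> d)
  then show ?case by (simp add: mconst_def mult_single lookup_single when_def)
qed (simp add: ring_distribs lookup_add)

lemma lookup_mult_sum:
  fixes p q :: "('x, 'a::comm_ring_1) mpoly"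
  assumes "finite A" "finite B" "Poly_Mapping.keys p \<subseteq> A" "Poly_Mapping.keys q \<subseteq> B"
  shows "Poly_Mapping.lookup (p * q) \<kappa> =
    (\<Sum>\<mu>\<in>A. \<Sum>\<nu>\<in>B. Poly_Mapping.lookup p \<mu> * Poly_Mapping.lookup q \<nu> * of_bool (\<mu> + \<nu> = \<kappa>))"
proof -
  have sup: "p = (\<Sum>\<mu>\<in>A. Poly_Mapping.single \<mu> (Poly_Mapping.lookup p \<mu>))"
    if "finite A" "Poly_Mapping.keys p \<subseteq> A" for p :: "('x, 'a) mpoly" and A
    by (subst poly_mapping_as_sum, rule sum.mono_neutral_left) (use that in \<open>auto simp: in_keys_iff\<close>)
  have "p * q = (\<Sum>\<mu>\<in>A. \<Sum>\<nu>\<in>B. Poly_Mapping.single (\<mu> + \<nu>) (Poly_Mapping.lookup p \<mu> * Poly_Mapping.lookup q \<nu>))"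
    by (subst sup[OF assms(1,3)], subst sup[OF assms(2,4)]) (simp add: sum_product mult_single)
  then show ?thesis by (simp add: lookup_sum lookup_single when_def of_bool_def if_distrib cong: if_cong)
qed

lemma msubst_superset:
  assumes "h 0 = 0" "finite A" "Poly_Mapping.keys p \<subseteq> A"
  shows "msubst h x p = (\<Sum>\<mu>\<in>A. h (Poly_Mapping.lookup p \<mu>) * mono_val x \<mu>)"
  unfolding msubst_def using assms by (intro sum.mono_neutral_left) (auto simp: in_keys_iff)

lemma msubst_single: "h 0 = 0 \<Longrightarrow> msubst h x (Poly_Mapping.single \<mu> c) = h c * mono_val x \<mu>"
  by (subst msubst_superset[of _ "{\<mu>}"]) auto

context ring_morphism
begin

lemma msubst_add: "msubst \<phi> x (p + q) = msubst \<phi> x p + msubst \<phi> x q"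
proof -
  define A where "A = Poly_Mapping.keys p \<union> Poly_Mapping.keys q"
  have "finite A" "Poly_Mapping.keys p \<subseteq> A" "Poly_Mapping.keys q \<subseteq> A" "Poly_Mapping.keys (p + q) \<subseteq> A"
    using keys_add[of p q] by (auto simp: A_def)
  then show ?thesis
    by (simp add: msubst_superset[of _ A] lookup_add add ring_distribs sum.distrib)
qed

lemma msubst_mult: "msubst \<phi> x (p * q) = msubst \<phi> x p * msubst \<phi> x q"
proof (induction p rule: mpoly_induct)
  case (single \<mu> c)
  then show ?case
  proof (induction q rule: mpoly_induct)
    case (single \<nu> d)
    then show ?case by (simp add: mult_single msubst_single mono_val_add mult mult_ac)
  qed (simp add: ring_distribs msubst_add)
qed (simp add: ring_distribs msubst_add)

lemma msubst_mconst [simp]: "msubst \<phi> x (mconst c) = \<phi> c"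
  by (simp add: mconst_def msubst_single)

lemma msubst_mvar [simp]: "msubst \<phi> x (mvar i) = x i"
  by (simp add: mvar_def msubst_single)

lemma ring_morphism_msubst: "ring_morphism (msubst \<phi> x)"
proof
  show "msubst \<phi> x 1 = 1"
    using msubst_mconst[of x 1] by (simp add: mconst_def)
qed (auto simp: msubst_add msubst_mult)

lemma msubst_comp: "\<phi> (msubst h x p) = msubst (\<lambda>c. \<phi> (h c)) (\<lambda>i. \<phi> (x i)) p"
  by (simp add: msubst_def sum mult prod power)

end

interpretation mpoly_eval: ring_morphism "meval x" for x :: "'x \<Rightarrow> 'a::comm_ring_1"
  by (rule ring_morphism.ring_morphism_msubst[OF ring_morphism_id])

interpretation mpoly_subst: ring_morphism "msubst mconst x" for x :: "'x \<Rightarrow> ('y, 'a::comm_ring_1) mpoly"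
  by (rule ring_morphism.ring_morphism_msubst[OF ring_morphism_mconst])

lemma mono_val_mvar: "mono_val mvar \<mu> = Poly_Mapping.single \<mu> (1::'a::comm_ring_1)"
proof -
  have pow: "mvar i ^ n = Poly_Mapping.single (Poly_Mapping.single i n) (1::'a)" for i :: 'b and n
    by (induction n) (auto simp: mvar_def mult_single single_add[symmetric])
  have "(\<Prod>i\<in>I. Poly_Mapping.single (Poly_Mapping.single i (f i)) (1::'a)) =
      Poly_Mapping.single (\<Sum>i\<in>I. Poly_Mapping.single i (f i)) 1" for I :: "'b set" and f :: "'b \<Rightarrow> nat"
    by (induction I rule: infinite_finite_induct) (auto simp: mult_single)
  then show ?thesis
    unfolding pow using poly_mapping_as_sum[of \<mu>] by simp
qed

section \<open>Kronecker substitution\<close>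

text \<open>The exponents of a monomial are the coefficients of a univariate polynomial, and its
  weight is the value of that polynomial at \<open>N\<close>. Two distinct polynomials agree at
  finitely many points only, so all but finitely many \<open>N\<close> separate a finite set of
  monomials.\<close>

lemma separating_weights:
  fixes M :: "('x::countable \<Rightarrow>\<^sub>0 nat) set"
  assumes "finite M"
  obtains w :: "'x \<Rightarrow> nat" where
    "inj_on (\<lambda>\<mu>. \<Sum>i\<in>Poly_Mapping.keys \<mu>. w i * Poly_Mapping.lookup \<mu> i) M"
proof -
  define p :: "('x \<Rightarrow>\<^sub>0 nat) \<Rightarrow> int poly" where
    "p \<mu> = (\<Sum>i\<in>Poly_Mapping.keys \<mu>. monom (int (Poly_Mapping.lookup \<mu> i)) (to_nat i))" for \<mu>
  have coeff: "coeff (p \<mu>) (to_nat i) = int (Poly_Mapping.lookup \<mu> i)" for \<mu> i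
    by (auto simp: p_def coeff_sum in_keys_iff if_distrib cong: if_cong)
  have inj: "p \<mu> - p \<nu> \<noteq> 0" if "\<mu> \<noteq> \<nu>" for \<mu> \<nu>
    using that coeff by (metis eq_iff_diff_eq_0 of_nat_eq_iff poly_mapping_eqI)
  define Z where "Z = (\<Union>\<mu>\<in>M. \<Union>\<nu>\<in>M - {\<mu>}. {z. poly (p \<mu> - p \<nu>) z = 0})"
  have "finite Z" unfolding Z_def using assms inj by (intro finite_UN_I finite_Diff poly_roots_finite) auto
  then have "finite {n. int n \<in> Z}" using finite_vimageI[of Z int] by (simp add: vimage_def)
  then obtain N where N: "int N \<notin> Z" by (metis finite_nat_set_iff_bounded less_irrefl mem_Collect_eq)
  have val: "int (\<Sum>i\<in>Poly_Mapping.keys \<mu>. N ^ to_nat i * Poly_Mapping.lookup \<mu> i) = poly (p \<mu>) (int N)" for \<mu>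
    by (simp add: p_def poly_sum poly_monom mult.commute)
  have "inj_on (\<lambda>\<mu>. \<Sum>i\<in>Poly_Mapping.keys \<mu>. N ^ to_nat i * Poly_Mapping.lookup \<mu> i) M"
  proof (rule inj_onI, rule ccontr)
    fix \<mu> \<nu> assume *: "\<mu> \<in> M" "\<nu> \<in> M" "\<mu> \<noteq> \<nu>"
      "(\<Sum>i\<in>Poly_Mapping.keys \<mu>. N ^ to_nat i * Poly_Mapping.lookup \<mu> i) =
       (\<Sum>i\<in>Poly_Mapping.keys \<nu>. N ^ to_nat i * Poly_Mapping.lookup \<nu> i)"
    then have "poly (p \<mu> - p \<nu>) (int N) = 0" using val[of \<mu>] val[of \<nu>] by simp
    then show False using * N by (auto simp: Z_def)
  qed
  then show ?thesis by (rule that)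
qed

definition kronecker :: "('x \<Rightarrow> nat) \<Rightarrow> ('x, 'a::comm_ring_1) mpoly \<Rightarrow> 'a poly" where
  "kronecker w = msubst (\<lambda>c. [:c:]) (\<lambda>i. monom 1 (w i))"

interpretation kronecker: ring_morphism "kronecker w" for w
  unfolding kronecker_def by (rule ring_morphism.ring_morphism_msubst[OF ring_morphism_pCons])

lemma coeff_kronecker:
  fixes p :: "('x, 'a::comm_ring_1) mpoly" and w :: "'x \<Rightarrow> nat"
  defines "W \<equiv> \<lambda>\<mu>. \<Sum>i\<in>Poly_Mapping.keys \<mu>. w i * Poly_Mapping.lookup \<mu> i"
  assumes inj: "inj_on W M" and M: "Poly_Mapping.keys p \<subseteq> M" "\<mu> \<in> M"
  shows "coeff (kronecker w p) (W \<mu>) = Poly_Mapping.lookup p \<mu>"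
proof -
  have "(\<Prod>i\<in>I. monom 1 (w i) ^ Poly_Mapping.lookup \<nu> i) = monom (1::'a) (\<Sum>i\<in>I. w i * Poly_Mapping.lookup \<nu> i)"
    for \<nu> I by (induction I rule: infinite_finite_induct) (auto simp: monom_power mult_monom)
  then have "kronecker w p = (\<Sum>\<nu>\<in>Poly_Mapping.keys p. monom (Poly_Mapping.lookup p \<nu>) (W \<nu>))"
    by (simp add: kronecker_def msubst_def W_def smult_monom)
  then have "coeff (kronecker w p) (W \<mu>) = (\<Sum>\<nu>\<in>Poly_Mapping.keys p. if W \<nu> = W \<mu> then Poly_Mapping.lookup p \<nu> else 0)"
    by (simp add: coeff_sum)
  also have "\<dots> = (\<Sum>\<nu>\<in>Poly_Mapping.keys p. if \<nu> = \<mu> then Poly_Mapping.lookup p \<nu> else 0)"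
    using inj M by (intro sum.cong refl if_cong) (auto simp: inj_on_def)
  finally show ?thesis by (simp add: in_keys_iff)
qed

text \<open>The weights are chosen to separate the monomials of the factors. This makes the
  substitution faithful on each factor, and being a morphism it turns the vanishing product into one
  in a univariate polynomial ring.\<close>

lemma mpoly_no_zero_divisors:
  fixes p q :: "('x::countable, 'a::idom) mpoly"
  assumes "p * q = 0"
  shows "p = 0 \<or> q = 0"
proof -
  obtain w where w: "inj_on (\<lambda>\<mu>. \<Sum>i\<in>Poly_Mapping.keys \<mu>. w i * Poly_Mapping.lookup \<mu> i)
      (Poly_Mapping.keys p \<union> Poly_Mapping.keys q)"
    using separating_weights[of "Poly_Mapping.keys p \<union> Poly_Mapping.keys q"] by auto
  have inj: "r = 0" if "kronecker w r = 0" "Poly_Mapping.keys r \<subseteq> Poly_Mapping.keys p \<union> Poly_Mapping.keys q" for r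
  proof (rule poly_mapping_eqI)
    fix \<mu> show "Poly_Mapping.lookup r \<mu> = Poly_Mapping.lookup 0 \<mu>"
      using coeff_kronecker[OF w that(2), of \<mu>] that by (cases "\<mu> \<in> Poly_Mapping.keys r") (auto simp: in_keys_iff)
  qed
  have "kronecker w p * kronecker w q = 0"
    using kronecker.mult[of w p q] assms by simp
  then show ?thesis using inj[of p] inj[of q] by auto
qed

text \<open>The image of a unit has degree 0. Including the monomial 1 among the separated ones
  gives every other monomial of \<open>p\<close> a positive weight, so its coefficient
  vanishes.\<close>

lemma mpoly_unit_const:
  fixes p q :: "('x::countable, 'a::idom) mpoly"
  assumes "p * q = 1"
  obtains c where "p = mconst c" "c \<noteq> 0"
proof -
  obtain w where w: "inj_on (\<lambda>\<mu>. \<Sum>i\<in>Poly_Mapping.keys \<mu>. w i * Poly_Mapping.lookup \<mu> i)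
      (insert 0 (Poly_Mapping.keys p))"
    using separating_weights[of "insert 0 (Poly_Mapping.keys p)"] by auto
  have "kronecker w p * kronecker w q = 1"
    using kronecker.mult[of w p q] assms by simp
  then have deg: "degree (kronecker w p) = 0"
    using degree_mult_eq[of "kronecker w p" "kronecker w q"] by (cases "kronecker w p = 0 \<or> kronecker w q = 0") auto
  have "Poly_Mapping.lookup p \<mu> = 0" if "\<mu> \<noteq> 0" for \<mu>
  proof (cases "\<mu> \<in> Poly_Mapping.keys p")
    case True
    define W where "W = (\<Sum>i\<in>Poly_Mapping.keys \<mu>. w i * Poly_Mapping.lookup \<mu> i)"
    have "W \<noteq> 0"
    proof
      assume "W = 0"
      then have "\<mu> = 0" using inj_onD[OF w, of \<mu> 0] True by (simp add: W_def)
      then show False using that by simp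
    qed
    then have "coeff (kronecker w p) W = 0" using deg by (simp add: coeff_eq_0)
    then show ?thesis
      using coeff_kronecker[OF w subset_insertI, of \<mu>] True by (simp add: W_def)
  qed (simp add: in_keys_iff)
  then have "p = mconst (Poly_Mapping.lookup p 0)"
    by (intro poly_mapping_eqI) (auto simp: mconst_def lookup_single when_def)
  moreover from this have "Poly_Mapping.lookup p 0 \<noteq> 0" using assms by (auto simp: mconst_def)
  ultimately show ?thesis by (rule that)
qed

section \<open>Linear substitutions\<close>

lemma keys_mult_subset: "Poly_Mapping.keys (p * q) \<subseteq> (\<lambda>(\<mu>, \<nu>). \<mu> + \<nu>) ` (Poly_Mapping.keys p \<times> Poly_Mapping.keys q)"
  using keys_mult[of p q] by auto

text \<open>F(U) becomes F(hU). This is \<open>sl_act\<close> without the inverse, hence a right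
  action.\<close>

definition lin_subst :: "'a::comm_ring_1 ^ 'n::finite ^ 'n \<Rightarrow> ('n \<times> nat, 'a) mpoly \<Rightarrow> ('n \<times> nat, 'a) mpoly" where
  "lin_subst h = msubst mconst (\<lambda>(i, j). \<Sum>l\<in>UNIV. mconst (h $ i $ l) * mvar (l, j))"

interpretation lin_subst: ring_morphism "lin_subst h" for h :: "'a::comm_ring_1 ^ 'n::finite ^ 'n"
  unfolding lin_subst_def by (rule mpoly_subst.ring_morphism_axioms)

lemma lin_subst_mconst [simp]: "lin_subst h (mconst c) = mconst c"
  unfolding lin_subst_def by (rule ring_morphism.msubst_mconst[OF ring_morphism_mconst])

lemma lin_subst_mvar: "lin_subst h (mvar (i, j)) = (\<Sum>l\<in>UNIV. mconst (h $ i $ l) * mvar (l, j))"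
  unfolding lin_subst_def by (subst ring_morphism.msubst_mvar[OF ring_morphism_mconst]) simp

lemma mconst_0 [simp]: "mconst 0 = 0"
  by (simp add: mconst_def)

lemma lin_subst_comp:
  fixes h h' :: "'a::comm_ring_1 ^ 'b::finite ^ 'b"
  shows "lin_subst h (lin_subst h' F) = lin_subst (h' ** h) F"
proof -
  interpret mconst: ring_morphism "mconst :: 'a \<Rightarrow> ('b \<times> nat, 'a) mpoly" by (rule ring_morphism_mconst)
  have "lin_subst h (\<Sum>l\<in>UNIV. mconst (h' $ i $ l) * mvar (l, j)) =
      (\<Sum>l\<in>UNIV. mconst ((h' ** h) $ i $ l) * mvar (l, j))" for i j
  proof -
    have "lin_subst h (\<Sum>l\<in>UNIV. mconst (h' $ i $ l) * mvar (l, j)) =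
      (\<Sum>l\<in>UNIV. \<Sum>k\<in>UNIV. mconst (h' $ i $ l * h $ l $ k) * mvar (k, j))"
      by (simp add: lin_subst.sum lin_subst.mult lin_subst_mvar sum_distrib_left mconst.mult mult.assoc)
    also have "\<dots> = (\<Sum>k\<in>UNIV. \<Sum>l\<in>UNIV. mconst (h' $ i $ l * h $ l $ k) * mvar (k, j))"
      by (rule sum.swap)
    finally show ?thesis
      by (simp add: matrix_matrix_mult_def mconst.sum sum_distrib_right)
  qed
  then show ?thesis
    unfolding lin_subst_def[of h'] lin_subst.msubst_comp lin_subst_mconst
    by (simp add: lin_subst_def[of "h' ** h"] case_prod_unfold)
qed

text \<open>Monomials are weight vectors of the diagonal torus, and their weights see only the row
  index of a variable.\<close>

lemma lin_subst_diag:
  fixes y :: "'b::finite \<Rightarrow> 'a::comm_ring_1"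
  shows
  "Poly_Mapping.lookup (lin_subst (\<chi> i j. if i = j then y i else 0) F) \<mu> =
    mono_val (\<lambda>x. y (fst x)) \<mu> * Poly_Mapping.lookup F \<mu>"
proof -
  interpret mconst: ring_morphism "mconst :: 'a \<Rightarrow> ('b \<times> nat, 'a) mpoly" by (rule ring_morphism_mconst)
  have "(\<Sum>l\<in>UNIV. mconst (if i = l then y i else 0) * mvar (l, j)) = mconst (y i) * mvar (i, j)" for i j
    by (simp add: if_distrib[of mconst] if_distrib[of "\<lambda>x. x * _"] cong: if_cong)
  then have subst: "lin_subst (\<chi> i j. if i = j then y i else 0) = msubst mconst (\<lambda>x. mconst (y (fst x)) * mvar x)"
    unfolding lin_subst_def by (intro arg_cong[of _ _ "msubst mconst"] ext) auto
  show ?thesis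
    unfolding subst
  proof (induction F rule: mpoly_induct)
    case (single \<nu> c)
    have "mono_val (\<lambda>x. mconst (y (fst x)) * mvar x) \<nu> =
        mconst (mono_val (\<lambda>x. y (fst x)) \<nu>) * mono_val mvar \<nu>"
      by (simp add: power_mult_distrib prod.distrib mconst.prod mconst.power)
    then have "msubst mconst (\<lambda>x. mconst (y (fst x)) * mvar x) (Poly_Mapping.single \<nu> c) =
        mconst c * (mconst (mono_val (\<lambda>x. y (fst x)) \<nu>) * Poly_Mapping.single \<nu> 1)"
      by (simp only: msubst_single[of mconst, OF mconst.zero] mono_val_mvar)
    then show ?case by (simp add: lookup_single when_def)
  qed (simp add: ring_morphism.msubst_add[OF ring_morphism_mconst] lookup_add ring_distribs)
qed

lemma lin_subst_one [simp]: "lin_subst (mat 1) F = F"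
  using lin_subst_diag[of "\<lambda>_. 1" F] by (auto simp: mat_def intro: poly_mapping_eqI)

lemma lin_subst_cancel: "h' ** h = mat 1 \<Longrightarrow> lin_subst h (lin_subst h' F) = F"
  by (simp add: lin_subst_comp)

section \<open>Limits of families of polynomials and matrices\<close>

text \<open>Confines the family to a finite-dimensional space, so that coefficients of products and
  substitutions are sums over a fixed finite set and limits can be taken termwise.\<close>

definition bounded_support :: "('s \<Rightarrow> ('x, 'a::comm_ring_1) mpoly) \<Rightarrow> bool" where
  "bounded_support f \<longleftrightarrow> (\<exists>A. finite A \<and> (\<forall>s. Poly_Mapping.keys (f s) \<subseteq> A))"

lemma bounded_supportE:
  assumes "bounded_support f"
  obtains A where "finite A" "\<And>s. Poly_Mapping.keys (f s) \<subseteq> A"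
  using assms unfolding bounded_support_def by auto

lemma bounded_support_const: "bounded_support (\<lambda>s. p)"
  unfolding bounded_support_def by (rule exI[of _ "Poly_Mapping.keys p"]) auto

lemma bounded_support_mconst: "bounded_support (\<lambda>s. mconst (c s))"
  unfolding bounded_support_def mconst_def by (rule exI[of _ "{0}"]) auto

lemma bounded_support_add: "bounded_support f \<Longrightarrow> bounded_support g \<Longrightarrow> bounded_support (\<lambda>s. f s + g s)"
  unfolding bounded_support_def
proof (elim exE conjE)
  fix A B assume *: "finite A" "finite B" "\<forall>s. Poly_Mapping.keys (f s) \<subseteq> A" "\<forall>s. Poly_Mapping.keys (g s) \<subseteq> B"
  have "Poly_Mapping.keys (f s + g s) \<subseteq> A \<union> B" for s using * keys_add[of "f s" "g s"] by blast
  then show "\<exists>A. finite A \<and> (\<forall>s. Poly_Mapping.keys (f s + g s) \<subseteq> A)"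
    using * by (intro exI[of _ "A \<union> B"]) simp
qed

lemma bounded_support_mult: "bounded_support f \<Longrightarrow> bounded_support g \<Longrightarrow> bounded_support (\<lambda>s. f s * g s)"
  unfolding bounded_support_def
proof (elim exE conjE)
  fix A B assume *: "finite A" "finite B" "\<forall>s. Poly_Mapping.keys (f s) \<subseteq> A" "\<forall>s. Poly_Mapping.keys (g s) \<subseteq> B"
  have "Poly_Mapping.keys (f s * g s) \<subseteq> (\<lambda>(\<mu>, \<nu>). \<mu> + \<nu>) ` (A \<times> B)" for s
    using * keys_mult_subset[of "f s" "g s"] by blast
  then show "\<exists>A. finite A \<and> (\<forall>s. Poly_Mapping.keys (f s * g s) \<subseteq> A)"
    using * by (intro exI[of _ "(\<lambda>(\<mu>, \<nu>). \<mu> + \<nu>) ` (A \<times> B)"]) simp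
qed

lemma bounded_support_sum:
  "(\<And>i. i \<in> I \<Longrightarrow> bounded_support (f i)) \<Longrightarrow> bounded_support (\<lambda>s. \<Sum>i\<in>I. f i s)"
  by (induction I rule: infinite_finite_induct) (auto intro: bounded_support_add bounded_support_const)

context place
begin

definition plim :: "('s \<Rightarrow> ('x, 'a) mpoly) \<Rightarrow> ('x, 'a) mpoly \<Rightarrow> bool" where
  "plim f f0 \<longleftrightarrow> bounded_support f \<and>
     (\<forall>\<mu>. lim (\<lambda>s. Poly_Mapping.lookup (f s) \<mu>) (Poly_Mapping.lookup f0 \<mu>))"

definition mlim :: "('s \<Rightarrow> 'a ^ 'n ^ 'm) \<Rightarrow> 'a ^ 'n ^ 'm \<Rightarrow> bool" where
  "mlim h h0 \<longleftrightarrow> (\<forall>i j. lim (\<lambda>s. h s $ i $ j) (h0 $ i $ j))"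

lemma plim_const: "plim (\<lambda>s. p) p"
  by (auto simp: plim_def bounded_support_const)

lemma plim_mconst: "lim c a \<Longrightarrow> plim (\<lambda>s. mconst (c s)) (mconst a)"
  by (auto simp: plim_def bounded_support_mconst) (auto simp: mconst_def lookup_single when_def)

lemma plim_support:
  assumes "plim f f0"
  obtains A where "finite A" "\<And>s. Poly_Mapping.keys (f s) \<subseteq> A" "Poly_Mapping.keys f0 \<subseteq> A"
proof -
  obtain A where "finite A" "\<And>s. Poly_Mapping.keys (f s) \<subseteq> A"
    using assms bounded_supportE[of f] unfolding plim_def by auto
  then show ?thesis by (intro that[of "A \<union> Poly_Mapping.keys f0"]) auto
qed

lemma plim_add: "plim f f0 \<Longrightarrow> plim g g0 \<Longrightarrow> plim (\<lambda>s. f s + g s) (f0 + g0)"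
  by (auto simp: plim_def lookup_add intro: bounded_support_add lim_add)

lemma plim_mult: "plim f f0 \<Longrightarrow> plim g g0 \<Longrightarrow> plim (\<lambda>s. f s * g s) (f0 * g0)"
proof -
  assume f: "plim f f0" and g: "plim g g0"
  obtain A where A: "finite A" "\<And>s. Poly_Mapping.keys (f s) \<subseteq> A" "Poly_Mapping.keys f0 \<subseteq> A"
    using plim_support[OF f] by blast
  obtain B where B: "finite B" "\<And>s. Poly_Mapping.keys (g s) \<subseteq> B" "Poly_Mapping.keys g0 \<subseteq> B"
    using plim_support[OF g] by blast
  show ?thesis
    unfolding plim_def lookup_mult_sum[OF A(1) B(1) A(2) B(2)] lookup_mult_sum[OF A(1) B(1) A(3) B(3)]
  proof (intro conjI allI lim_sum lim_mult lim_const)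
    show "bounded_support (\<lambda>s. f s * g s)"
      using f g unfolding plim_def by (intro bounded_support_mult) simp_all
  qed (use f g in \<open>simp_all add: plim_def\<close>)
qed

lemma plim_sum: "(\<And>i. i \<in> I \<Longrightarrow> plim (f i) (f0 i)) \<Longrightarrow> plim (\<lambda>s. \<Sum>i\<in>I. f i s) (\<Sum>i\<in>I. f0 i)"
  by (induction I rule: infinite_finite_induct) (auto intro: plim_add plim_const)

lemma plim_power: "plim f f0 \<Longrightarrow> plim (\<lambda>s. f s ^ n) (f0 ^ n)"
  by (induction n) (auto intro: plim_mult plim_const)

lemma plim_prod: "(\<And>i. i \<in> I \<Longrightarrow> plim (f i) (f0 i)) \<Longrightarrow> plim (\<lambda>s. \<Prod>i\<in>I. f i s) (\<Prod>i\<in>I. f0 i)"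
  by (induction I rule: infinite_finite_induct) (auto intro: plim_mult plim_const)

lemma plim_unique: "plim f a \<Longrightarrow> plim f b \<Longrightarrow> a = b"
  unfolding plim_def by (intro poly_mapping_eqI) (blast intro: lim_unique)

lemma plim_lin_subst:
  assumes f: "plim f f0" and h: "mlim h h0"
  shows "plim (\<lambda>s. lin_subst (h s) (f s)) (lin_subst h0 f0)"
proof -
  obtain A where A: "finite A" "\<And>s. Poly_Mapping.keys (f s) \<subseteq> A" "Poly_Mapping.keys f0 \<subseteq> A"
    using plim_support[OF f] by blast
  have eq: "lin_subst k p = (\<Sum>\<mu>\<in>A. mconst (Poly_Mapping.lookup p \<mu>) *
      mono_val (\<lambda>x. \<Sum>l\<in>UNIV. mconst (k $ fst x $ l) * mvar (l, snd x)) \<mu>)"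
    if "Poly_Mapping.keys p \<subseteq> A" for k :: "'a ^ 'b ^ 'b" and p
    unfolding lin_subst_def using that A(1)
    by (subst msubst_superset[of _ A]) (auto simp: case_prod_unfold mconst_def)
  show ?thesis
    unfolding eq[OF A(2)] eq[OF A(3)]
    by (intro plim_sum plim_mult plim_prod plim_power plim_mconst plim_const)
       (use f h in \<open>auto simp: plim_def mlim_def\<close>)
qed

lemma mlim_mult: "mlim g g0 \<Longrightarrow> mlim h h0 \<Longrightarrow> mlim (\<lambda>s. g s ** h s) (g0 ** h0)"
  by (auto simp: mlim_def matrix_matrix_mult_def intro!: lim_sum lim_mult)

lemma lim_det: "mlim g g0 \<Longrightarrow> lim (\<lambda>s. det (g s)) (det g0)"
  unfolding det_def mlim_def by (intro lim_sum lim_mult lim_const lim_prod) auto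

lemma plim_exists:
  assumes "bounded_support f" "\<And>\<mu>. fin (\<lambda>s. Poly_Mapping.lookup (f s) \<mu>)"
  obtains f0 where "plim f f0"
proof -
  obtain A where A: "finite A" "\<And>s. Poly_Mapping.keys (f s) \<subseteq> A"
    using bounded_supportE[OF assms(1)] by blast
  have "\<forall>\<mu>. \<exists>a. lim (\<lambda>s. Poly_Mapping.lookup (f s) \<mu>) a"
    using assms(2) unfolding fin_def by blast
  from choice[OF this] obtain a where a: "\<And>\<mu>. lim (\<lambda>s. Poly_Mapping.lookup (f s) \<mu>) (a \<mu>)"
    by blast
  have "plim (\<lambda>s. \<Sum>\<mu>\<in>A. mconst (Poly_Mapping.lookup (f s) \<mu>) * Poly_Mapping.single \<mu> 1)
      (\<Sum>\<mu>\<in>A. mconst (a \<mu>) * Poly_Mapping.single \<mu> 1)"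
    using a by (intro plim_sum plim_mult plim_mconst plim_const)
  moreover have "(\<Sum>\<mu>\<in>A. mconst (Poly_Mapping.lookup (f s) \<mu>) * Poly_Mapping.single \<mu> 1) = f s" for s
  proof (rule poly_mapping_eqI)
    fix \<kappa>
    have "Poly_Mapping.lookup (\<Sum>\<mu>\<in>A. mconst (Poly_Mapping.lookup (f s) \<mu>) * Poly_Mapping.single \<mu> 1) \<kappa> =
        (\<Sum>\<mu>\<in>A. if \<mu> = \<kappa> then Poly_Mapping.lookup (f s) \<mu> else 0)"
      unfolding lookup_sum by (intro sum.cong) (simp_all add: lookup_single when_def)
    also have "\<dots> = Poly_Mapping.lookup (f s) \<kappa>"
      using A(1) A(2)[of s] by (auto simp: in_keys_iff)
    finally show "Poly_Mapping.lookup (\<Sum>\<mu>\<in>A. mconst (Poly_Mapping.lookup (f s) \<mu>) * Poly_Mapping.single \<mu> 1) \<kappa> =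
        Poly_Mapping.lookup (f s) \<kappa>" .
  qed
  ultimately show ?thesis using that by simp
qed

lemma plim_cong:
  assumes "plim f f0" "ev (\<lambda>s. f s = g s)" "bounded_support g"
  shows "plim g f0"
  unfolding plim_def
proof (intro conjI allI)
  fix \<mu>
  have "lim (\<lambda>s. Poly_Mapping.lookup (f s) \<mu>) (Poly_Mapping.lookup f0 \<mu>)"
    using assms(1) unfolding plim_def by blast
  then show "lim (\<lambda>s. Poly_Mapping.lookup (g s) \<mu>) (Poly_Mapping.lookup f0 \<mu>)"
    by (rule lim_cong) (rule ev_mono[OF assms(2)], simp)
qed (rule assms(3))

text \<open>\<open>u\<close> is a coefficient of least valuation: after division by it all
  coefficients are bounded and one of them tends to 1.\<close>

lemma normalized_family:
  assumes f: "bounded_support f" "\<And>s. f s \<noteq> 0"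
  obtains u f0 where "ev (\<lambda>s. u s \<noteq> 0)" "plim (\<lambda>s. mconst (inverse (u s)) * f s) f0" "f0 \<noteq> 0"
proof -
  obtain A where A: "finite A" "\<And>s. Poly_Mapping.keys (f s) \<subseteq> A"
    using bounded_supportE[OF f(1)] by blast
  have A0: "Poly_Mapping.lookup (f s) \<mu> = 0" if "\<mu> \<notin> A" for s \<mu>
    using A(2)[of s] that by (auto simp: in_keys_iff)
  have "\<not> (\<forall>\<mu>\<in>A. ev (\<lambda>s. Poly_Mapping.lookup (f s) \<mu> = 0))"
  proof
    assume "\<forall>\<mu>\<in>A. ev (\<lambda>s. Poly_Mapping.lookup (f s) \<mu> = 0)"
    then have "ev (\<lambda>s. \<forall>\<mu>\<in>A. Poly_Mapping.lookup (f s) \<mu> = 0)"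
      using A by (intro ev_all_finite) auto
    then have "ev (\<lambda>s. False)"
    proof (rule ev_mono)
      fix s assume "\<forall>\<mu>\<in>A. Poly_Mapping.lookup (f s) \<mu> = 0"
      then have "f s = 0" using A0 by (intro poly_mapping_eqI) (metis lookup_zero)
      then show False using f by simp
    qed
    then show False by simp
  qed
  then obtain \<nu> where \<nu>: "\<nu> \<in> A" "ev (\<lambda>s. Poly_Mapping.lookup (f s) \<nu> \<noteq> 0)"
    and dom: "\<And>\<mu>. \<mu> \<in> A \<Longrightarrow> fin (\<lambda>s. Poly_Mapping.lookup (f s) \<mu> * inverse (Poly_Mapping.lookup (f s) \<nu>))"
    using dominant_member[OF A(1), of "\<lambda>\<mu> s. Poly_Mapping.lookup (f s) \<mu>"] by blast
  define u where "u = (\<lambda>s. Poly_Mapping.lookup (f s) \<nu>)"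
  obtain f0 where f0: "plim (\<lambda>s. mconst (inverse (u s)) * f s) f0"
  proof (rule plim_exists)
    show "bounded_support (\<lambda>s. mconst (inverse (u s)) * f s)"
      using f(1) by (intro bounded_support_mult bounded_support_mconst)
    fix \<mu> show "fin (\<lambda>s. Poly_Mapping.lookup (mconst (inverse (u s)) * f s) \<mu>)"
      using dom[of \<mu>] A0[of \<mu>] by (cases "\<mu> \<in> A") (simp_all add: u_def mult.commute[of "inverse _"])
  qed
  have "lim (\<lambda>s. Poly_Mapping.lookup (mconst (inverse (u s)) * f s) \<nu>) (Poly_Mapping.lookup f0 \<nu>)"
    using f0 unfolding plim_def by blast
  then have "lim (\<lambda>s. 1) (Poly_Mapping.lookup f0 \<nu>)"
    by (rule lim_cong) (use \<nu>(2) in \<open>auto elim!: ev_mono simp: u_def\<close>)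
  then have "f0 \<noteq> 0" using lim_unique[OF lim_const[of 1]] by force
  then show ?thesis using that[of u f0] \<nu>(2) f0 by (simp add: u_def)
qed

end

section \<open>The Cartan decomposition\<close>

text \<open>Eliminating with these matrices alone, without permutations or scalings, keeps all
  factors inside SL.\<close>

definition transvection :: "'n \<Rightarrow> 'n \<Rightarrow> 'a \<Rightarrow> 'a::comm_ring_1 ^ 'n::finite ^ 'n" where
  "transvection i j c = (\<chi> k l. if k = l then 1 else if k = i \<and> l = j then c else 0)"

lemma transvection_mult:
  assumes "i \<noteq> j"
  shows "(transvection i j c ** M) $ k $ l = M $ k $ l + (if k = i then c * M $ j $ l else 0)"
proof -
  have "(transvection i j c ** M) $ k $ l =
      (\<Sum>m\<in>UNIV. (if m = k then M $ m $ l else 0) + (if m = j then (if k = i then c * M $ m $ l else 0) else 0))"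
    unfolding matrix_matrix_mult_def transvection_def using assms by (auto intro!: sum.cong)
  then show ?thesis by (simp add: sum.distrib)
qed

lemma transvection_cancel: "i \<noteq> j \<Longrightarrow> transvection i j c ** transvection i j (- c) = mat 1"
  by (simp add: vec_eq_iff transvection_mult) (auto simp: transvection_def mat_def)

lemma det_transvection: "i \<noteq> j \<Longrightarrow> det (transvection i j c) = 1"
proof -
  assume "i \<noteq> j"
  then have "transvection i j c = (\<chi> k. if k = i then row i (mat 1) + c *s row j (mat 1) else row k (mat 1))"
    by (auto simp: vec_eq_iff transvection_def row_def mat_def)
  then show ?thesis using det_row_operation[OF \<open>i \<noteq> j\<close>, of "mat 1" c] by simp
qed

context place
begin

text \<open>\<open>h\<close> is a point of \<open>SL\<close> over the valuation ring, with inverse \<open>h'\<close>.\<close>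

definition integral_sl :: "('s \<Rightarrow> 'a ^ 'n::finite ^ 'n) \<Rightarrow> ('s \<Rightarrow> 'a ^ 'n ^ 'n) \<Rightarrow> bool" where
  "integral_sl h h' \<longleftrightarrow> (\<exists>h0. mlim h h0) \<and> (\<exists>h0. mlim h' h0) \<and>
     (\<forall>s. det (h s) = 1 \<and> h s ** h' s = mat 1 \<and> h' s ** h s = mat 1)"

lemma integral_sl_one: "integral_sl (\<lambda>s. mat 1) (\<lambda>s. mat 1)"
  unfolding integral_sl_def mlim_def by auto

lemma integral_sl_mult:
  assumes "integral_sl h h'" "integral_sl k k'"
  shows "integral_sl (\<lambda>s. h s ** k s) (\<lambda>s. k' s ** h' s)"
proof -
  have "h s ** k s ** (k' s ** h' s) = h s ** (k s ** k' s) ** h' s"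
    "k' s ** h' s ** (h s ** k s) = k' s ** (h' s ** h s) ** k s" for s
    by (simp_all add: matrix_mul_assoc)
  then show ?thesis
    using assms unfolding integral_sl_def by (auto simp: det_mul intro: mlim_mult)
qed

lemma mlim_transpose: "mlim h h0 \<Longrightarrow> mlim (\<lambda>s. transpose (h s)) (transpose h0)"
  by (auto simp: mlim_def transpose_def)

lemma integral_sl_transpose:
  assumes "integral_sl h h'"
  shows "integral_sl (\<lambda>s. transpose (h s)) (\<lambda>s. transpose (h' s))"
proof -
  have "transpose (h s) ** transpose (h' s) = transpose (h' s ** h s)"
    "transpose (h' s) ** transpose (h s) = transpose (h s ** h' s)" for s
    by (simp_all only: matrix_transpose_mul)
  moreover obtain h0 h0' where "mlim h h0" "mlim h' h0'" using assms unfolding integral_sl_def by blast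
  then have "mlim (\<lambda>s. transpose (h s)) (transpose h0)" "mlim (\<lambda>s. transpose (h' s)) (transpose h0')"
    by (auto intro: mlim_transpose)
  ultimately show ?thesis
    using assms unfolding integral_sl_def by (auto simp: det_transpose transpose_mat)
qed

lemma integral_sl_transvection:
  assumes "i \<noteq> j" "fin c"
  shows "integral_sl (\<lambda>s. transvection i j (c s)) (\<lambda>s. transvection i j (- c s))"
proof -
  have "\<exists>h0. mlim (\<lambda>s. transvection i j (c s)) h0" if c: "fin c" for c
  proof -
    obtain a where a: "lim c a" using c unfolding fin_def by blast
    have "lim (\<lambda>s. transvection i j (c s) $ k $ l) (transvection i j a $ k $ l)" for k l
      using a by (cases "k = l"; cases "k = i"; cases "l = j") (simp_all add: transvection_def lim_const)
    then show ?thesis unfolding mlim_def by blast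
  qed
  from this[OF assms(2)] this[OF fin_uminus[OF assms(2)]]
  show ?thesis
    unfolding integral_sl_def
    using transvection_cancel[OF assms(1), of "c s" for s] transvection_cancel[OF assms(1), of "- c s" for s]
    by (simp add: det_transvection[OF assms(1)])
qed

section \<open>Elimination over the valuation ring\<close>

definition equivalent :: "('s \<Rightarrow> 'a ^ 'n::finite ^ 'n) \<Rightarrow> ('s \<Rightarrow> 'a ^ 'n ^ 'n) \<Rightarrow> bool" where
  "equivalent M N \<longleftrightarrow> (\<exists>h h' k k'. integral_sl h h' \<and> integral_sl k k' \<and> (\<forall>s. N s = h s ** M s ** k s))"

lemma equivalent_refl: "equivalent M M"
proof -
  have "\<forall>s. M s = mat 1 ** M s ** mat 1" by simp
  then show ?thesis unfolding equivalent_def using integral_sl_one by blast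
qed

lemma equivalent_trans: "equivalent M N \<Longrightarrow> equivalent N P \<Longrightarrow> equivalent M P"
  unfolding equivalent_def
proof (elim exE conjE)
  fix h h' k k' g g' l l'
  assume *: "integral_sl h h'" "integral_sl k k'" "integral_sl g g'" "integral_sl l l'"
    "\<forall>s. N s = h s ** M s ** k s" "\<forall>s. P s = g s ** N s ** l s"
  have "integral_sl (\<lambda>s. g s ** h s) (\<lambda>s. h' s ** g' s)" "integral_sl (\<lambda>s. k s ** l s) (\<lambda>s. l' s ** k' s)"
    using * by (auto intro: integral_sl_mult)
  moreover have "\<forall>s. P s = (g s ** h s) ** M s ** (k s ** l s)"
    using * by (simp add: matrix_mul_assoc)
  ultimately show "\<exists>h h' k k'. integral_sl h h' \<and> integral_sl k k' \<and> (\<forall>s. P s = h s ** M s ** k s)"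
    by blast
qed

text \<open>Column operations will be performed as row operations on the transpose.\<close>

lemma equivalent_transpose: "equivalent M N \<Longrightarrow> equivalent (\<lambda>s. transpose (M s)) (\<lambda>s. transpose (N s))"
  unfolding equivalent_def
proof (elim exE conjE)
  fix h h' k k'
  assume *: "integral_sl h h'" "integral_sl k k'" "\<forall>s. N s = h s ** M s ** k s"
  have "\<forall>s. transpose (N s) = transpose (k s) ** transpose (M s) ** transpose (h s)"
    using *(3) by (simp add: matrix_transpose_mul matrix_mul_assoc)
  then show "\<exists>h h' k k'. integral_sl h h' \<and> integral_sl k k' \<and> (\<forall>s. transpose (N s) = h s ** transpose (M s) ** k s)"
    using *(1,2) integral_sl_transpose by blast
qed

lemma equivalent_transvection:
  assumes "i \<noteq> j" "fin c"
  shows "equivalent M (\<lambda>s. transvection i j (c s) ** M s)"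
proof -
  have "\<forall>s. transvection i j (c s) ** M s = transvection i j (c s) ** M s ** mat 1" by simp
  then show ?thesis
    unfolding equivalent_def using integral_sl_transvection[OF assms] integral_sl_one by blast
qed

text \<open>
  The state of the elimination: the rows and columns in \<open>J\<close> are finished, the entries outside are
  dominated by \<open>u\<close>, and the column and the row of the pivot \<open>p\<close> have been cleared at \<open>A\<close> and \<open>B\<close>.
\<close>

definition elim_state ::
    "'n set \<Rightarrow> ('s \<Rightarrow> 'a) \<Rightarrow> 'n \<Rightarrow> 'n set \<Rightarrow> 'n set \<Rightarrow> ('s \<Rightarrow> 'a ^ 'n::finite ^ 'n) \<Rightarrow> bool" where
  "elim_state J u p A B M \<longleftrightarrow>
     (\<forall>i j. i \<noteq> j \<longrightarrow> i \<in> J \<or> j \<in> J \<longrightarrow> ev (\<lambda>s. M s $ i $ j = 0)) \<and>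
     (\<forall>i j. i \<notin> J \<longrightarrow> j \<notin> J \<longrightarrow> fin (\<lambda>s. M s $ i $ j * inverse (u s))) \<and>
     (\<forall>i\<in>A. ev (\<lambda>s. M s $ i $ p = 0)) \<and> (\<forall>j\<in>B. ev (\<lambda>s. M s $ p $ j = 0))"

lemma elim_stateD:
  assumes "elim_state J u p A B M"
  shows "i \<noteq> j \<Longrightarrow> i \<in> J \<or> j \<in> J \<Longrightarrow> ev (\<lambda>s. M s $ i $ j = 0)"
    and "i \<notin> J \<Longrightarrow> j \<notin> J \<Longrightarrow> fin (\<lambda>s. M s $ i $ j * inverse (u s))"
    and "i \<in> A \<Longrightarrow> ev (\<lambda>s. M s $ i $ p = 0)"
    and "j \<in> B \<Longrightarrow> ev (\<lambda>s. M s $ p $ j = 0)"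
  using assms unfolding elim_state_def by auto

lemma elim_state_transpose:
  "elim_state J u p A B M \<Longrightarrow> elim_state J u p B A (\<lambda>s. transpose (M s))"
  unfolding elim_state_def by (auto simp: transpose_def)

text \<open>Only row \<open>i\<close> changes. It must therefore avoid the cleared rows
  \<open>A\<close> and, once part of the pivot row has been cleared, the pivot row; finished columns
  stay zero because row \<open>l\<close> is unfinished as well.\<close>

lemma elim_state_transvection:
  assumes M: "elim_state J u p A B M" and i: "i \<noteq> l" "i \<notin> J" "l \<notin> J" "i \<notin> A" "B = {} \<or> i \<noteq> p" and c: "fin c"
  shows "elim_state J u p A B (\<lambda>s. transvection i l (c s) ** M s)"
  unfolding elim_state_def
proof (intro conjI allI impI ballI)
  fix k j assume kj: "k \<noteq> j" "k \<in> J \<or> j \<in> J"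
  show "ev (\<lambda>s. (transvection i l (c s) ** M s) $ k $ j = 0)"
  proof (cases "k = i")
    case True
    then have "ev (\<lambda>s. M s $ k $ j = 0)" "ev (\<lambda>s. M s $ l $ j = 0)"
      using elim_stateD(1)[OF M, of k j] elim_stateD(1)[OF M, of l j] kj i by auto
    then show ?thesis by (rule ev_mp) (simp add: transvection_mult[OF i(1)])
  qed (simp add: transvection_mult[OF i(1)] elim_stateD(1)[OF M kj])
next
  fix k j assume "k \<notin> J" "j \<notin> J"
  then have *: "fin (\<lambda>s. M s $ k $ j * inverse (u s))" "fin (\<lambda>s. M s $ l $ j * inverse (u s))"
    using elim_stateD(2)[OF M] i by auto
  have "fin (\<lambda>s. M s $ k $ j * inverse (u s) + (if k = i then c s else 0) * (M s $ l $ j * inverse (u s)))"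
    using c by (intro fin_add fin_mult *) (cases "k = i"; simp)
  moreover have "(transvection i l (c s) ** M s) $ k $ j * inverse (u s) =
      M s $ k $ j * inverse (u s) + (if k = i then c s else 0) * (M s $ l $ j * inverse (u s))" for s
    using i(1) by (simp add: transvection_mult algebra_simps)
  ultimately show "fin (\<lambda>s. (transvection i l (c s) ** M s) $ k $ j * inverse (u s))" by simp
next
  fix k assume "k \<in> A"
  then show "ev (\<lambda>s. (transvection i l (c s) ** M s) $ k $ p = 0)"
    using elim_stateD(3)[OF M, of k] i by (cases "k = i") (simp_all add: transvection_mult[OF i(1)])
next
  fix j assume "j \<in> B"
  then show "ev (\<lambda>s. (transvection i l (c s) ** M s) $ p $ j = 0)"
    using elim_stateD(4)[OF M, of j] i by (cases "p = i") (auto simp add: transvection_mult[OF i(1)])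
qed

text \<open>Adding the row \<open>l\<close> to the row \<open>p\<close>, if necessary, moves a dominant entry into the row \<open>p\<close>.\<close>

lemma elim_move_pivot:
  assumes M: "elim_state J u p {} {} M" and J: "p \<notin> J" "l \<notin> J" "q \<notin> J"
    and piv: "lim (\<lambda>s. M s $ l $ q * inverse (u s)) a" "a \<noteq> 0"
  obtains N b where "equivalent M N" "elim_state J u p {} {} N"
    "lim (\<lambda>s. N s $ p $ q * inverse (u s)) b" "b \<noteq> 0"
proof -
  obtain b where b: "lim (\<lambda>s. M s $ p $ q * inverse (u s)) b"
    using elim_stateD(2)[OF M J(1,3)] unfolding fin_def by blast
  show ?thesis
  proof (cases "b = 0")
    case False
    then show ?thesis using that[OF equivalent_refl M b] by blast
  next
    case True
    then have "p \<noteq> l" using b piv lim_unique by blast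
    define N where "N = (\<lambda>s. transvection p l 1 ** M s)"
    have "lim (\<lambda>s. M s $ p $ q * inverse (u s) + M s $ l $ q * inverse (u s)) (b + a)"
      using b piv by (intro lim_add)
    moreover have "N s $ p $ q * inverse (u s) = M s $ p $ q * inverse (u s) + M s $ l $ q * inverse (u s)" for s
      using \<open>p \<noteq> l\<close> by (simp add: N_def transvection_mult algebra_simps)
    ultimately have "lim (\<lambda>s. N s $ p $ q * inverse (u s)) a" using True by simp
    moreover have "equivalent M N" "elim_state J u p {} {} N"
      using equivalent_transvection[OF \<open>p \<noteq> l\<close> fin_const, of M 1]
        elim_state_transvection[OF M \<open>p \<noteq> l\<close> J(1,2) _ _ fin_const, of 1]
      unfolding N_def by auto
    ultimately show ?thesis using that piv(2) by blast
  qed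
qed

text \<open>The pivot has the least valuation, so the multiplier \<open>c\<close>, the quotient of
  an entry by the pivot, is bounded. Both are taken relative to \<open>u\<close>, since only these
  ratios are known to be bounded.\<close>

lemma elim_clear:
  assumes "finite A" "p \<notin> A" "A \<inter> J = {}" and J: "p \<notin> J" and M: "elim_state J u p {} B M"
    and u: "ev (\<lambda>s. u s \<noteq> 0)"
    and piv: "lim (\<lambda>s. M s $ p $ p * inverse (u s)) a" "a \<noteq> 0"
  shows "\<exists>N. equivalent M N \<and> elim_state J u p A B N \<and> lim (\<lambda>s. N s $ p $ p * inverse (u s)) a"
  using assms(1-3)
proof (induction A rule: finite_induct)
  case empty
  then show ?case using M piv equivalent_refl by blast
next
  case (insert i A)
  then obtain N where N: "equivalent M N" "elim_state J u p A B N" "lim (\<lambda>s. N s $ p $ p * inverse (u s)) a"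
    by auto
  define c where "c = (\<lambda>s. - (N s $ i $ p * inverse (u s)) * inverse (N s $ p $ p * inverse (u s)))"
  have i: "i \<noteq> p" "i \<notin> J" using insert.prems by auto
  have "fin (\<lambda>s. N s $ i $ p * inverse (u s))" using N(2) i J unfolding elim_state_def by blast
  moreover have "fin (\<lambda>s. inverse (N s $ p $ p * inverse (u s)))"
    using lim_inverse(1)[OF N(3) piv(2)] unfolding fin_def by blast
  ultimately have c: "fin c"
    unfolding c_def by (rule fin_mult[OF fin_uminus])
  define P where "P = (\<lambda>s. transvection i p (c s) ** N s)"
  have "elim_state J u p A B P"
    unfolding P_def by (rule elim_state_transvection) (use N i J c insert.hyps in auto)
  moreover have "ev (\<lambda>s. P s $ i $ p = 0)"
    using lim_inverse(2)[OF N(3) piv(2)]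
    by (rule ev_mono) (use i in \<open>simp add: P_def c_def transvection_mult field_simps\<close>)
  ultimately have "elim_state J u p (insert i A) B P" unfolding elim_state_def by blast
  moreover have "equivalent M P"
    using equivalent_trans[OF N(1) equivalent_transvection[OF i(1) c]] unfolding P_def .
  moreover have "lim (\<lambda>s. P s $ p $ p * inverse (u s)) a"
    using N(3) i by (simp add: P_def transvection_mult)
  ultimately show ?case by blast
qed

text \<open>An unfinished entry of least valuation dominates all the others. Its valuation is
  carried into row \<open>p\<close> and, on the transpose, to position \<open>(p, p)\<close>. Then
  the column is cleared and, after another transposition, the row.\<close>

lemma elim_step:
  assumes p: "p \<notin> J"
    and M: "\<And>i j. i \<noteq> j \<Longrightarrow> i \<in> J \<or> j \<in> J \<Longrightarrow> ev (\<lambda>s. M s $ i $ j = 0)"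
  obtains N where "equivalent M N"
    "\<And>i j. i \<noteq> j \<Longrightarrow> i \<in> insert p J \<or> j \<in> insert p J \<Longrightarrow> ev (\<lambda>s. N s $ i $ j = 0)"
proof -
  consider "\<forall>x\<in>(-J) \<times> (-J). ev (\<lambda>s. M s $ fst x $ snd x = 0)"
    | l q where "l \<notin> J" "q \<notin> J" "ev (\<lambda>s. M s $ l $ q \<noteq> 0)"
      "\<And>i j. i \<notin> J \<Longrightarrow> j \<notin> J \<Longrightarrow> fin (\<lambda>s. M s $ i $ j * inverse (M s $ l $ q))"
  proof -
    have "finite ((-J) \<times> (-J))" by simp
    from dominant_member[OF this, of "\<lambda>x s. M s $ fst x $ snd x"] show ?thesis
    proof
      assume "\<exists>x\<in>(-J) \<times> (-J). ev (\<lambda>s. M s $ fst x $ snd x \<noteq> 0) \<and>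
        (\<forall>y\<in>(-J) \<times> (-J). fin (\<lambda>s. M s $ fst y $ snd y * inverse (M s $ fst x $ snd x)))"
      then obtain l q where "l \<notin> J" "q \<notin> J" "ev (\<lambda>s. M s $ l $ q \<noteq> 0)"
        "\<forall>y\<in>(-J) \<times> (-J). fin (\<lambda>s. M s $ fst y $ snd y * inverse (M s $ l $ q))"
        by auto
      then show ?thesis by (intro that(2)[of l q]) auto
    qed (rule that(1))
  qed
  then show ?thesis
  proof cases
    case 1
    show ?thesis
    proof (rule that[OF equivalent_refl])
      fix i j assume ij: "i \<noteq> j" "i \<in> insert p J \<or> j \<in> insert p J"
      show "ev (\<lambda>s. M s $ i $ j = 0)"
        using M[OF ij(1)] 1 by (cases "i \<in> J \<or> j \<in> J") auto
    qed
  next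
    case 2
    define u where "u = (\<lambda>s. M s $ l $ q)"
    have u: "ev (\<lambda>s. u s \<noteq> 0)" using 2 by (simp add: u_def)
    have st: "elim_state J u p {} {} M" using 2 M unfolding elim_state_def u_def by blast
    have "lim (\<lambda>s. 1) 1" by (rule lim_const)
    then have "lim (\<lambda>s. M s $ l $ q * inverse (u s)) 1"
      by (rule lim_cong) (use 2(3) in \<open>auto elim!: ev_mono simp: u_def\<close>)
    then obtain N1 a where N1: "equivalent M N1" "elim_state J u p {} {} N1"
      "lim (\<lambda>s. N1 s $ p $ q * inverse (u s)) a" "a \<noteq> 0"
      by (rule elim_move_pivot[OF st p 2(1,2) _ one_neq_zero])
    have "lim (\<lambda>s. transpose (N1 s) $ q $ p * inverse (u s)) a" using N1(3) by (simp add: transpose_def)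
    then obtain N2 b where N2: "equivalent (\<lambda>s. transpose (N1 s)) N2" "elim_state J u p {} {} N2"
      "lim (\<lambda>s. N2 s $ p $ p * inverse (u s)) b" "b \<noteq> 0"
      by (rule elim_move_pivot[OF elim_state_transpose[OF N1(2)] p 2(2) p _ N1(4)])
    obtain N3 where N3: "equivalent N2 N3" "elim_state J u p (- insert p J) {} N3"
      "lim (\<lambda>s. N3 s $ p $ p * inverse (u s)) b"
      using elim_clear[of "- insert p J" p J u "{}" N2 b] p u N2 by auto
    have "lim (\<lambda>s. transpose (N3 s) $ p $ p * inverse (u s)) b" using N3(3) by (simp add: transpose_def)
    then obtain N4 where N4: "equivalent (\<lambda>s. transpose (N3 s)) N4"
      "elim_state J u p (- insert p J) (- insert p J) N4"
      using elim_clear[of "- insert p J" p J u "- insert p J" "\<lambda>s. transpose (N3 s)" b]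
        elim_state_transpose[OF N3(2)] p u N2(4) by auto
    have "equivalent N1 (\<lambda>s. transpose (N2 s))" using equivalent_transpose[OF N2(1)] by simp
    then have "equivalent M N4"
      using equivalent_trans N1(1) equivalent_transpose[OF N3(1)] N4(1) by blast
    then show ?thesis
    proof (rule that)
      fix i j assume "i \<noteq> j" "i \<in> insert p J \<or> j \<in> insert p J"
      then show "ev (\<lambda>s. N4 s $ i $ j = 0)"
        using N4(2) unfolding elim_state_def by (cases "i \<in> J \<or> j \<in> J") auto
    qed
  qed
qed

text \<open>A Smith normal form, over a valuation ring that need not be discrete: the diagonal
  entries are arbitrary functions instead of powers of a uniformizer.\<close>

lemma cartan_decomposition:
  fixes g :: "'s \<Rightarrow> 'a ^ 'n::finite ^ 'n"
  obtains h h' k k' y where "integral_sl h h'" "integral_sl k k'"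
    "ev (\<lambda>s. h s ** g s ** k s = (\<chi> i j. if i = j then y i s else 0))"
proof -
  have "\<exists>N. equivalent g N \<and> (\<forall>i j. i \<noteq> j \<longrightarrow> i \<in> J \<or> j \<in> J \<longrightarrow> ev (\<lambda>s. N s $ i $ j = 0))"
    if "finite J" for J :: "'n set"
    using that
  proof (induction J rule: finite_induct)
    case empty
    then show ?case using equivalent_refl by blast
  next
    case (insert p J)
    then obtain N where N: "equivalent g N" "\<And>i j. i \<noteq> j \<Longrightarrow> i \<in> J \<or> j \<in> J \<Longrightarrow> ev (\<lambda>s. N s $ i $ j = 0)"
      by blast
    obtain P where "equivalent N P"
      "\<And>i j. i \<noteq> j \<Longrightarrow> i \<in> insert p J \<or> j \<in> insert p J \<Longrightarrow> ev (\<lambda>s. P s $ i $ j = 0)"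
      using elim_step[OF insert.hyps(2) N(2)] by blast
    then show ?case using equivalent_trans N(1) by blast
  qed
  from this[of UNIV] obtain N where N: "equivalent g N" "\<And>i j. i \<noteq> j \<Longrightarrow> ev (\<lambda>s. N s $ i $ j = 0)"
    by auto
  obtain h h' k k' where hk: "integral_sl h h'" "integral_sl k k'" "\<And>s. N s = h s ** g s ** k s"
    using N(1) unfolding equivalent_def by blast
  have "ev (\<lambda>s. \<forall>x\<in>{(i, j). i \<noteq> j}. N s $ fst x $ snd x = 0)"
    by (rule ev_all_finite) (use N(2) in auto)
  then have "ev (\<lambda>s. h s ** g s ** k s = (\<chi> i j. if i = j then N s $ i $ i else 0))"
    by (rule ev_mono) (auto simp: vec_eq_iff hk(3)[symmetric])
  then show ?thesis by (rule that[OF hk(1,2)])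
qed

end

section \<open>One-parameter subgroups\<close>

text \<open>The cone \<open>C\<close> of the application is not known to be finitely generated, so
  separation is asked from a finite subset \<open>T\<close> only, and \<open>C\<close> enters
  through its closure properties. The induction removes a vector \<tau> from \<open>T\<close>; if
  the functional \<open>x\<close> found for the rest is negative on \<tau>, everything is projected
  along \<tau>.\<close>

lemma integer_farkas:
  fixes T :: "('n::finite \<Rightarrow> int) set" and C :: "('n \<Rightarrow> int) set"
  assumes "finite T" "T \<subseteq> C" "b \<notin> C"
    and zero: "(\<lambda>i. 0) \<in> C"
    and add: "\<And>a a'. a \<in> C \<Longrightarrow> a' \<in> C \<Longrightarrow> (\<lambda>i. a i + a' i) \<in> C"
    and saturated: "\<And>a n. n > 0 \<Longrightarrow> (\<lambda>i. n * a i) \<in> C \<Longrightarrow> a \<in> C"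
  shows "\<exists>w. (\<forall>t\<in>T. (\<Sum>i\<in>UNIV. t i * w i) \<ge> 0) \<and> (\<Sum>i\<in>UNIV. b i * w i) < 0"
  using assms(1-3)
proof (induction "card T" arbitrary: T b rule: less_induct)
  case less
  define dot :: "('n \<Rightarrow> int) \<Rightarrow> ('n \<Rightarrow> int) \<Rightarrow> int" where "dot = (\<lambda>t w. \<Sum>i\<in>UNIV. t i * w i)"
  have dot_lin: "dot (\<lambda>i. c * t i + d * t' i) w = c * dot t w + d * dot t' w"
    "dot w (\<lambda>i. c * t i + d * t' i) = c * dot w t + d * dot w t'" for c d t t' w
    by (simp_all add: dot_def algebra_simps sum.distrib sum_distrib_left)
  have scale: "(\<lambda>i. c * a i) \<in> C" if "c \<ge> 0" "a \<in> C" for c a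
    using that(1)
  proof (induction c rule: int_ge_induct)
    case base
    then show ?case using zero by simp
  next
    case (step c)
    then show ?case using add[OF step.IH that(2)] by (simp add: algebra_simps)
  qed
  show ?case
  proof (cases "T = {}")
    case True
    have "b \<noteq> (\<lambda>i. 0)" using less.prems zero by auto
    then obtain i where "b i \<noteq> 0" by auto
    then have "0 < (\<Sum>i\<in>UNIV. b i * b i)"
      by (intro sum_pos2[of _ i]) (auto simp: zero_less_mult_iff)
    then show ?thesis using True by (intro exI[of _ "\<lambda>i. - b i"]) (simp add: sum_negf)
  next
    case False
    then obtain \<tau> where \<tau>: "\<tau> \<in> T" by blast
    define T' where "T' = T - {\<tau>}"
    have T': "T = insert \<tau> T'" "finite T'" "card T' < card T"
      using \<tau> less.prems(1) card_Diff1_less[of T \<tau>] by (auto simp: T'_def)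
    obtain x where x: "\<forall>t\<in>T'. dot t x \<ge> 0" "dot b x < 0"
      using less.hyps[OF T'(3,2) _ less.prems(3)] less.prems(2) T'(1) unfolding dot_def by blast
    show ?thesis
    proof (cases "dot \<tau> x \<ge> 0")
      case True
      then show ?thesis using x T'(1) unfolding dot_def by blast
    next
      case neg: False
      define p where "p = - dot \<tau> x"
      have p: "p > 0" using neg by (simp add: p_def)
      \<comment> \<open>The projection along \<tau> onto the kernel of \<open>x\<close>, multiplied
        by \<open>p\<close> to stay integral.\<close>
      define shift where "shift = (\<lambda>t i. p * t i + dot t x * \<tau> i)"
      have \<tau>C: "\<tau> \<in> C" using \<tau> less.prems(2) by blast
      have sub: "shift ` T' \<subseteq> C"
      proof
        fix a assume "a \<in> shift ` T'"
        then obtain t where t: "t \<in> T'" "a = shift t" by blast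
        then have "t \<in> C" "dot t x \<ge> 0" using x less.prems(2) T'(1) by auto
        then show "a \<in> C"
          unfolding t(2) shift_def using add[OF scale scale] p \<tau>C by simp
      qed
      have notin: "shift b \<notin> C"
      proof
        assume "shift b \<in> C"
        then have "(\<lambda>i. shift b i + (- dot b x) * \<tau> i) \<in> C"
          using x(2) \<tau>C by (intro add scale) auto
        moreover have "(\<lambda>i. shift b i + (- dot b x) * \<tau> i) = (\<lambda>i. p * b i)"
          by (simp add: shift_def)
        ultimately show False using saturated[OF p] less.prems(3) by simp
      qed
      have card: "card (shift ` T') < card T"
        using T'(3) card_image_le[OF T'(2), of shift] by linarith
      have "\<exists>w. (\<forall>t\<in>shift ` T'. dot t w \<ge> 0) \<and> dot (shift b) w < 0"
        unfolding dot_def by (rule less.hyps[OF card finite_imageI[OF T'(2)] sub notin])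
      then obtain z where z: "\<forall>t\<in>T'. dot (shift t) z \<ge> 0" "dot (shift b) z < 0" by auto
      \<comment> \<open>The image of \<open>z\<close> under the adjoint of \<open>shift\<close>; it
        vanishes on \<tau>.\<close>
      define w where "w = (\<lambda>i. p * z i + dot \<tau> z * x i)"
      have w: "dot t w = dot (shift t) z" for t
      proof -
        have "dot t w = p * dot t z + dot \<tau> z * dot t x" unfolding w_def by (rule dot_lin(2))
        moreover have "dot (shift t) z = p * dot t z + dot t x * dot \<tau> z" unfolding shift_def by (rule dot_lin(1))
        ultimately show ?thesis by simp
      qed
      have "dot \<tau> w = p * dot \<tau> z + dot \<tau> z * dot \<tau> x" unfolding w_def by (rule dot_lin(2))
      then have "dot \<tau> w = 0" by (simp add: p_def)
      then have "\<forall>t\<in>T. dot t w \<ge> 0" "dot b w < 0" using z w T'(1) by auto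
      then show ?thesis unfolding dot_def by blast
    qed
  qed
qed

section \<open>Limits of one-parameter subgroups\<close>

lemma infinite_alg_closed_field: "infinite (UNIV :: 'a::alg_closed_field set)"
proof
  assume fin: "finite (UNIV :: 'a set)"
  define p :: "'a poly" where "p = (\<Prod>a\<in>UNIV. [:- a, 1:])"
  have "poly p a = 0" for a unfolding p_def poly_prod using fin by (intro prod_zero) auto
  moreover have "degree p = card (UNIV :: 'a set)"
    unfolding p_def by (subst degree_prod_eq_sum_degree) auto
  then have "degree p > 0" using fin by (simp add: card_gt_0_iff)
  then have "degree (p + 1) > 0" by (simp add: degree_add_eq_left)
  then obtain a where "poly (p + 1) a = 0" using alg_closed_imp_poly_has_root by blast
  ultimately show False by simp
qed

lemma exists_power_noteq_1:
  assumes "n > 0"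
  obtains c :: "'a::alg_closed_field" where "c \<noteq> 0" "c ^ n \<noteq> 1"
proof -
  have "finite {c::'a. poly (monom 1 n - 1) c = 0}"
    using assms by (intro poly_roots_finite) (metis degree_1 degree_monom_eq eq_iff_diff_eq_0 less_numeral_extra(3) zero_neq_one)
  then have "finite (insert 0 {c::'a. poly (monom 1 n - 1) c = 0})" by simp
  then obtain c :: 'a where "c \<notin> insert 0 {c::'a. poly (monom 1 n - 1) c = 0}"
    using infinite_alg_closed_field ex_new_if_finite by blast
  then show ?thesis using that[of c] by (simp add: poly_monom)
qed

definition mpoly_subspace :: "('x, 'a::comm_ring_1) mpoly set \<Rightarrow> bool" where
  "mpoly_subspace B \<longleftrightarrow> (\<forall>p\<in>B. \<forall>q\<in>B. p + q \<in> B) \<and> (\<forall>p\<in>B. \<forall>c. mconst c * p \<in> B)"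

text \<open>Orbits are closed relative to \<open>B\<close>, so a limit must first be shown to lie in
  \<open>B\<close>. Subtracting \<open>c ^ Suc M\<close> times the curve at \<open>t\<close> from
  the curve at \<open>c * t\<close> removes the top term and multiplies \<open>f 0\<close> by the
  nonzero scalar \<open>1 - c ^ Suc M\<close>.\<close>

lemma mpoly_subspace_curve:
  fixes f :: "nat \<Rightarrow> ('x, 'a::alg_closed_field) mpoly"
  assumes B: "mpoly_subspace B" and f: "\<And>t. t \<noteq> 0 \<Longrightarrow> (\<Sum>j\<le>M. mconst (t ^ j) * f j) \<in> B"
  shows "f 0 \<in> B"
  using f
proof (induction M arbitrary: f)
  case 0
  then show ?case using 0[of 1] by (simp add: mconst_def)
next
  case (Suc M)
  interpret mconst: ring_morphism "mconst :: 'a \<Rightarrow> ('x, 'a) mpoly" by (rule ring_morphism_mconst)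
  obtain c :: 'a where c: "c \<noteq> 0" "c ^ Suc M \<noteq> 1" using exists_power_noteq_1[of "Suc M"] by blast
  define e where "e j = c ^ j - c ^ Suc M" for j
  have "(\<Sum>j\<le>M. mconst (t ^ j) * (mconst (e j) * f j)) \<in> B" if "t \<noteq> 0" for t
  proof -
    have "(\<Sum>j\<le>Suc M. mconst ((c * t) ^ j) * f j) + mconst (- (c ^ Suc M)) * (\<Sum>j\<le>Suc M. mconst (t ^ j) * f j) \<in> B"
      using B Suc.prems c(1) that unfolding mpoly_subspace_def by (meson no_zero_divisors)
    also have "(\<Sum>j\<le>Suc M. mconst ((c * t) ^ j) * f j) + mconst (- (c ^ Suc M)) * (\<Sum>j\<le>Suc M. mconst (t ^ j) * f j)
        = (\<Sum>j\<le>Suc M. mconst (t ^ j) * (mconst (e j) * f j))"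
      unfolding sum_distrib_left sum.distrib[symmetric]
    proof (rule sum.cong[OF refl])
      fix j
      have "(c * t) ^ j + (- (c ^ Suc M)) * t ^ j = t ^ j * e j"
        by (simp add: e_def power_mult_distrib algebra_simps)
      then show "mconst ((c * t) ^ j) * f j + mconst (- (c ^ Suc M)) * (mconst (t ^ j) * f j) =
          mconst (t ^ j) * (mconst (e j) * f j)"
        by (metis mconst.add mconst.mult mult.assoc distrib_right)
    qed
    finally show ?thesis by (simp add: e_def)
  qed
  then have "mconst (e 0) * f 0 \<in> B" by (rule Suc.IH)
  then have "mconst (inverse (e 0)) * (mconst (e 0) * f 0) \<in> B" using B unfolding mpoly_subspace_def by blast
  moreover have "e 0 \<noteq> 0" using c by (simp add: e_def)
  then have "mconst (inverse (e 0)) * mconst (e 0) = (1 :: ('x, 'a) mpoly)"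
    by (simp add: mconst.mult[symmetric])
  ultimately show ?case by (simp add: mult.assoc[symmetric])
qed

definition subst_orbit :: "('n::finite \<times> nat, 'a::field) mpoly \<Rightarrow> ('n \<times> nat, 'a) mpoly set" where
  "subst_orbit F = {lin_subst h F |h. det h = 1}"

lemma det_1_inverse:
  fixes h :: "'a::field ^ 'n::finite ^ 'n"
  assumes "det h = 1"
  obtains h' where "h ** h' = mat 1" "h' ** h = mat 1" "det h' = 1"
proof -
  have "invertible h" using assms by (simp add: invertible_det_nz)
  then obtain h' where h': "h ** h' = mat 1" "h' ** h = mat 1" unfolding invertible_def by blast
  then have "det h * det h' = 1" by (metis det_I det_mul)
  then show ?thesis using that h' assms by simp
qed

text \<open>
  If \<open>\<lambda>(t) = diag (t^w)\<close> has a limit on \<open>F\<close>, then the limit lies in the closed orbit of \<open>F\<close> and is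
  fixed by \<open>\<lambda>\<close>; so \<open>\<lambda>\<close> is trivial when the stabilizer is finite.
\<close>

lemma one_parameter_subgroup_trivial:
  fixes F :: "('n::finite \<times> nat, 'a::alg_closed_field) mpoly" and w :: "'n \<Rightarrow> int"
  assumes B: "mpoly_subspace B"
    and closed: "zariski_closed_in B (subst_orbit F)"
    and stab: "finite {h. det h = 1 \<and> lin_subst h F = F}"
    and k: "det k = 1"
    and w: "(\<Sum>i\<in>UNIV. w i) = 0"
      "\<And>\<mu>. \<mu> \<in> Poly_Mapping.keys (lin_subst k F) \<Longrightarrow>
        0 \<le> (\<Sum>x\<in>Poly_Mapping.keys \<mu>. int (Poly_Mapping.lookup \<mu> x) * w (fst x))"
  shows "w i = 0"
proof -
  define F' where "F' = lin_subst k F"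
  define K where "K = Poly_Mapping.keys F'"
  define n where "n \<mu> = nat (\<Sum>x\<in>Poly_Mapping.keys \<mu>. int (Poly_Mapping.lookup \<mu> x) * w (fst x))"
    for \<mu> :: "'n \<times> nat \<Rightarrow>\<^sub>0 nat"
  define D :: "'a \<Rightarrow> 'a ^ 'n ^ 'n" where "D t = (\<chi> i j. if i = j then t powi w i else 0)" for t
  have powi_sum: "(\<Prod>i\<in>I. t powi f i) = t powi (\<Sum>i\<in>I. f i)" if "t \<noteq> 0"
    for t :: 'a and I :: "'x set" and f
    by (induction I rule: infinite_finite_induct) (use that in \<open>auto simp: power_int_add\<close>)
  have det_D: "det (D t) = 1" if "t \<noteq> 0" for t
    using that w(1) by (simp add: D_def det_diagonal powi_sum)
  \<comment> \<open>The curve of the translates of \<open>F'\<close> by \<open>D t\<close>, written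
    without negative powers so that \<open>t = 0\<close> makes sense. As \<open>0 ^ 0 = 1\<close>,
    its value there is the part of \<open>F'\<close> of weight 0.\<close>
  define Q where "Q t = (\<Sum>\<mu>\<in>K. mconst (t ^ n \<mu>) * Poly_Mapping.single \<mu> (Poly_Mapping.lookup F' \<mu>))" for t
  have lookup_Q: "Poly_Mapping.lookup (Q t) \<mu> = Poly_Mapping.lookup F' \<mu> * t ^ n \<mu>" for t \<mu>
  proof -
    have "Poly_Mapping.lookup (Q t) \<mu> = (\<Sum>\<nu>\<in>K. if \<nu> = \<mu> then Poly_Mapping.lookup F' \<mu> * t ^ n \<mu> else 0)"
      unfolding Q_def lookup_sum by (intro sum.cong) (auto simp: lookup_single)
    then show ?thesis by (auto simp: K_def in_keys_iff)
  qed
  have mono: "mono_val (\<lambda>x. t powi w (fst x)) \<mu> = t ^ n \<mu>" if "t \<noteq> 0" "\<mu> \<in> K" for t :: 'a and \<mu>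
  proof -
    have "mono_val (\<lambda>x. t powi w (fst x)) \<mu> = (\<Prod>x\<in>Poly_Mapping.keys \<mu>. t powi (int (Poly_Mapping.lookup \<mu> x) * w (fst x)))"
      by (intro prod.cong refl) (simp only: power_int_power' mult.commute[of "int _"])
    also have "\<dots> = t powi int (n \<mu>)"
      using w(2)[of \<mu>] that by (simp add: powi_sum n_def K_def F'_def)
    finally show ?thesis by simp
  qed
  have Q_orbit: "lin_subst (D t) F' = Q t" if "t \<noteq> 0" for t
  proof (rule poly_mapping_eqI)
    fix \<mu>
    have "Poly_Mapping.lookup (lin_subst (D t) F') \<mu> = mono_val (\<lambda>x. t powi w (fst x)) \<mu> * Poly_Mapping.lookup F' \<mu>"
      unfolding D_def by (rule lin_subst_diag)
    then show "Poly_Mapping.lookup (lin_subst (D t) F') \<mu> = Poly_Mapping.lookup (Q t) \<mu>"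
      using mono[OF that, of \<mu>] by (cases "\<mu> \<in> K") (auto simp: lookup_Q K_def in_keys_iff)
  qed
  have Q_in: "Q t \<in> subst_orbit F" if "t \<noteq> 0" for t
    unfolding subst_orbit_def Q_orbit[OF that, symmetric] F'_def lin_subst_comp
    using det_D[OF that] k by (auto simp: det_mul)
  obtain S where S: "subst_orbit F = {H \<in> B. \<forall>P\<in>S. meval (Poly_Mapping.lookup H) P = 0}"
    using closed unfolding zariski_closed_in_def by blast
  have "Q 0 \<in> B"
  proof -
    define f where "f j = (\<Sum>\<mu>\<in>{\<mu>\<in>K. n \<mu> = j}. Poly_Mapping.single \<mu> (Poly_Mapping.lookup F' \<mu>))" for j
    define M where "M = Max (insert 0 (n ` K))"
    have K: "finite K" by (simp add: K_def)
    have Q_f: "Q t = (\<Sum>j\<le>M. mconst (t ^ j) * f j)" for t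
    proof -
      have "Q t = (\<Sum>j\<in>{..M}. \<Sum>\<mu>\<in>{\<mu>\<in>K. n \<mu> = j}. mconst (t ^ n \<mu>) * Poly_Mapping.single \<mu> (Poly_Mapping.lookup F' \<mu>))"
        unfolding Q_def using K by (intro sum.group[symmetric]) (auto simp: M_def)
      then show ?thesis by (simp add: f_def sum_distrib_left)
    qed
    have "f 0 \<in> B"
      by (rule mpoly_subspace_curve[OF B, where M = M]) (use Q_in S Q_f in auto)
    moreover have "Q 0 = f 0"
    proof -
      have "Q 0 = (\<Sum>j\<le>M. if j = 0 then f j else 0)"
        unfolding Q_f by (intro sum.cong) (auto simp: zero_power ring_morphism.one[OF ring_morphism_mconst])
      then show ?thesis by simp
    qed
    ultimately show ?thesis by simp
  qed
  moreover have "meval (Poly_Mapping.lookup (Q 0)) P = 0" if "P \<in> S" for P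
  proof -
    \<comment> \<open>\<open>P\<close> along the curve, as a polynomial in \<open>t\<close>. It
      vanishes at the infinitely many nonzero \<open>t\<close>, hence identically.\<close>
    define p where "p = msubst (\<lambda>c. [:c:]) (\<lambda>\<mu>. monom (Poly_Mapping.lookup F' \<mu>) (n \<mu>)) P"
    have p: "poly p t = meval (Poly_Mapping.lookup (Q t)) P" for t
    proof -
      interpret ring_morphism "\<lambda>p. poly p t" by unfold_locales auto
      show ?thesis unfolding p_def msubst_comp ext[of "Poly_Mapping.lookup (Q t)", OF lookup_Q] by (simp add: poly_monom)
    qed
    have "\<not> finite {t. poly p t = 0}"
    proof
      assume "finite {t. poly p t = 0}"
      moreover have "UNIV \<subseteq> insert 0 {t. poly p t = 0}" using Q_in S p that by auto
      ultimately show False using infinite_alg_closed_field finite_subset by (metis finite_insert)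
    qed
    then have "p = 0" using poly_roots_finite by blast
    then show ?thesis using p[of 0] by simp
  qed
  ultimately have "Q 0 \<in> subst_orbit F" using S by blast
  then obtain h where h: "det h = 1" "Q 0 = lin_subst h F" unfolding subst_orbit_def by blast
  obtain h' where h': "h ** h' = mat 1" "h' ** h = mat 1" "det h' = 1" using det_1_inverse[OF h(1)] by blast
  have fixed: "lin_subst (D t) (Q 0) = Q 0" if "t \<noteq> 0" for t
  proof (rule poly_mapping_eqI)
    fix \<mu>
    have "Poly_Mapping.lookup (lin_subst (D t) (Q 0)) \<mu> = mono_val (\<lambda>x. t powi w (fst x)) \<mu> * Poly_Mapping.lookup (Q 0) \<mu>"
      unfolding D_def by (rule lin_subst_diag)
    then show "Poly_Mapping.lookup (lin_subst (D t) (Q 0)) \<mu> = Poly_Mapping.lookup (Q 0) \<mu>"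
      using mono[OF that, of \<mu>] by (cases "\<mu> \<in> K"; cases "n \<mu> = 0") (auto simp: lookup_Q K_def in_keys_iff)
  qed
  \<comment> \<open>The limit lies in the orbit, so the torus fixing it is conjugate to a subgroup
    of the stabilizer of \<open>F\<close>.\<close>
  have "h ** D t ** h' \<in> {h. det h = 1 \<and> lin_subst h F = F}" if "t \<noteq> 0" for t
  proof -
    have "lin_subst (h ** D t ** h') F = lin_subst h' (lin_subst (D t) (lin_subst h F))"
      by (simp add: lin_subst_comp)
    also have "\<dots> = lin_subst h' (lin_subst h F)" using fixed[OF that] h(2) by simp
    also have "\<dots> = F" by (rule lin_subst_cancel[OF h'(1)])
    finally show ?thesis using h h' det_D[OF that] by (simp add: det_mul)
  qed
  then have "finite ((\<lambda>t. h ** D t ** h') ` (- {0}))"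
    using stab by (elim finite_subset[rotated]) auto
  then have "finite ((\<lambda>g. (h' ** g ** h) $ i $ i) ` (\<lambda>t. h ** D t ** h') ` (- {0}))" by (rule finite_imageI)
  moreover have "(h' ** (h ** D t ** h') ** h) $ i $ i = t powi w i" for t
  proof -
    have "h' ** (h ** D t ** h') ** h = (h' ** h) ** D t ** (h' ** h)" by (simp only: matrix_mul_assoc)
    then show ?thesis using h' by (simp add: D_def)
  qed
  ultimately have fin: "finite ((\<lambda>t::'a. t powi w i) ` (- {0}))" by (simp add: image_image)
  show ?thesis
  proof (rule ccontr)
    assume "w i \<noteq> 0"
    \<comment> \<open>Finitely many stabilizer elements leave finitely many values of
      \<open>t powi w i\<close>, but for a nonzero exponent each value is taken finitely
      often.\<close>
    define m where "m = nat \<bar>w i\<bar>"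
    have m: "m > 0" using \<open>w i \<noteq> 0\<close> by (simp add: m_def)
    have "finite {t :: 'a. t ^ m = v}" for v
    proof -
      have "coeff (monom 1 m - [:v:]) m = (1 :: 'a)" using m by (simp add: coeff_pCons split: nat.split)
      then have "monom 1 m - [:v:] \<noteq> 0" by force
      then have "finite {t. poly (monom 1 m - [:v:]) t = 0}" by (rule poly_roots_finite)
      then show ?thesis by (simp add: poly_monom)
    qed
    moreover have "\<exists>v. {t :: 'a. t powi w i = u} \<subseteq> {t. t ^ m = v}" for u
    proof (cases "w i \<ge> 0")
      case True
      then show ?thesis by (intro exI[of _ u]) (auto simp: m_def power_int_def)
    next
      case False
      then show ?thesis by (intro exI[of _ "inverse u"]) (auto simp: m_def power_int_def power_inverse)
    qed
    ultimately have fibre: "finite {t :: 'a. t powi w i = u}" for u by (meson finite_subset)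
    have "- {0} \<subseteq> (\<Union>u\<in>(\<lambda>t::'a. t powi w i) ` (- {0}). {t. t powi w i = u})" by auto
    then have "finite (- {0 :: 'a})" using fin fibre by (meson finite_UN_I finite_subset)
    then show False using infinite_alg_closed_field[where 'a = 'a] by (simp add: finite_compl)
  qed
qed

section \<open>Properness of the orbit map and Gauss's lemma\<close>

context place
begin

lemma mlim_exists:
  assumes "\<And>i j. fin (\<lambda>s. h s $ i $ j)"
  obtains h0 where "mlim h h0"
proof -
  have "\<forall>i. \<exists>r. \<forall>j. lim (\<lambda>s. h s $ i $ j) (r j)"
    using assms unfolding fin_def by (intro allI choice) blast
  from choice[OF this] obtain r where "\<And>i j. lim (\<lambda>s. h s $ i $ j) (r i j)" by blast
  then have "mlim h (\<chi> i j. r i j)" by (simp add: mlim_def)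
  then show ?thesis by (rule that)
qed

lemma integral_sl_limits:
  assumes "integral_sl h h'"
  obtains h0 h0' where "mlim h h0" "mlim h' h0'" "det h0' = 1"
proof -
  obtain h0 h0' where lims: "mlim h h0" "mlim h' h0'" using assms unfolding integral_sl_def by blast
  have "det (h' s) = 1" for s
  proof -
    have "det (h s) * det (h' s) = det (mat 1 :: 'a ^ 'b ^ 'b)"
      using assms unfolding integral_sl_def by (metis det_mul)
    then show ?thesis using assms unfolding integral_sl_def by simp
  qed
  then have "det h0' = 1" using lim_det[OF lims(2)] lim_unique[OF lim_const[of 1]] by simp
  then show ?thesis using that lims by blast
qed

text \<open>
  Properness of the orbit map of a stable point. In the Cartan decomposition \<open>g = h' D k'\<close> the
  exponents \<open>a\<close> with \<open>D^a\<close> bounded form a saturated cone; if \<open>D\<close> is unbounded, an integral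
  functional separating a coordinate vector from the weights of \<open>F\<close> destabilizes \<open>F\<close>.
\<close>

lemma stable_orbit_map_proper:
  fixes F :: "('n::finite \<times> nat, 'a) mpoly" and g :: "'s \<Rightarrow> 'a ^ 'n ^ 'n"
  assumes B: "mpoly_subspace B"
    and closed: "zariski_closed_in B (subst_orbit F)"
    and stab: "finite {h. det h = 1 \<and> lin_subst h F = F}"
    and g: "\<And>s. det (g s) = 1"
    and gF: "plim (\<lambda>s. lin_subst (g s) F) F0"
  obtains g0 where "mlim g g0"
proof -
  obtain h h' k k' y where hk: "integral_sl h h'" "integral_sl k k'"
    and diag: "ev (\<lambda>s. h s ** g s ** k s = (\<chi> i j. if i = j then y i s else 0))"
    using cartan_decomposition[of g] by blast
  have inv: "det (h s) = 1" "h s ** h' s = mat 1" "h' s ** h s = mat 1"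
    "det (k s) = 1" "k s ** k' s = mat 1" "k' s ** k s = mat 1" for s
    using hk unfolding integral_sl_def by auto
  define D where "D s = h s ** g s ** k s" for s
  have det_D: "det (D s) = 1" for s by (simp add: D_def det_mul inv g)
  have g_D: "g s = h' s ** D s ** k' s" for s
  proof -
    have "h' s ** D s ** k' s = (h' s ** h s) ** g s ** (k s ** k' s)"
      by (simp only: D_def matrix_mul_assoc)
    then show ?thesis using inv by simp
  qed
  have prod_y: "ev (\<lambda>s. (\<Prod>i\<in>UNIV. y i s) = 1)"
    using diag
  proof (rule ev_mono)
    fix s assume "h s ** g s ** k s = (\<chi> i j. if i = j then y i s else 0)"
    then have "det (\<chi> i j. if i = j then y i s else 0) = 1" using det_D[of s] by (simp add: D_def)
    then show "(\<Prod>i\<in>UNIV. y i s) = 1" by (subst (asm) det_diagonal) auto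
  qed
  then have y_nz: "ev (\<lambda>s. \<forall>i. y i s \<noteq> 0)"
    by (rule ev_mono) (metis UNIV_I finite prod_zero_iff zero_neq_one)
  obtain h0 h0' where h0: "mlim h h0" "mlim h' h0'" "det h0' = 1" using integral_sl_limits[OF hk(1)] by blast
  obtain k0 k0' where k0: "mlim k k0" "mlim k' k0'" "det k0' = 1" using integral_sl_limits[OF hk(2)] by blast
  define f where "f s = lin_subst (h' s) F" for s
  define F' where "F' = lin_subst h0' F"
  have f: "plim f F'" unfolding f_def F'_def by (intro plim_lin_subst plim_const h0)
  have "lin_subst (D s) (f s) = lin_subst (k s) (lin_subst (g s) F)" for s
  proof -
    have "h' s ** D s = (h' s ** h s) ** g s ** k s" by (simp only: D_def matrix_mul_assoc)
    then show ?thesis using inv by (simp add: f_def lin_subst_comp)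
  qed
  then have Df: "plim (\<lambda>s. lin_subst (D s) (f s)) (lin_subst k0 F0)"
    using plim_lin_subst[OF gF k0(1)] by simp
  \<comment> \<open>The torus character of a monomial: the exponent of \<open>y i\<close> is the
    total degree in the variables of row \<open>i\<close>.\<close>
  define wt :: "('n \<times> nat \<Rightarrow>\<^sub>0 nat) \<Rightarrow> 'n \<Rightarrow> int" where
    "wt \<mu> i = (\<Sum>x\<in>{x\<in>Poly_Mapping.keys \<mu>. fst x = i}. int (Poly_Mapping.lookup \<mu> x))" for \<mu> i
  define C where "C = {a :: 'n \<Rightarrow> int. fin (\<lambda>s. \<Prod>i\<in>UNIV. y i s powi a i)}"
  have C_zero: "(\<lambda>i. 0) \<in> C" by (simp add: C_def)
  have C_add: "(\<lambda>i. a i + a' i) \<in> C" if "a \<in> C" "a' \<in> C" for a a'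
  proof -
    have "fin (\<lambda>s. (\<Prod>i\<in>UNIV. y i s powi a i) * (\<Prod>i\<in>UNIV. y i s powi a' i))"
      using that by (intro fin_mult) (auto simp: C_def)
    then have "fin (\<lambda>s. \<Prod>i\<in>UNIV. y i s powi (a i + a' i))"
      by (rule fin_cong) (use y_nz in \<open>auto elim!: ev_mono simp: power_int_add prod.distrib\<close>)
    then show ?thesis by (simp add: C_def)
  qed
  have C_saturated: "a \<in> C" if "n > 0" "(\<lambda>i. n * a i) \<in> C" for a n
  proof -
    have "(\<Prod>i\<in>UNIV. y i s powi a i) ^ nat n = (\<Prod>i\<in>UNIV. y i s powi (n * a i))" for s
      unfolding prod_power_distrib power_int_power' using that(1) by (simp add: mult.commute)
    then have "fin (\<lambda>s. (\<Prod>i\<in>UNIV. y i s powi a i) ^ nat n)"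
      using that(2) by (simp add: C_def)
    then show ?thesis using fin_of_fin_power that(1) by (simp add: C_def)
  qed
  \<comment> \<open>The coefficient of \<mu> in the bounded family
    \<open>lin_subst (D s) (f s)\<close> is the character of \<mu> times a coefficient of
    \<open>f s\<close> whose limit is nonzero. Dividing by the latter bounds the character.\<close>
  have wt_C: "wt \<mu> \<in> C" if "\<mu> \<in> Poly_Mapping.keys F'" for \<mu>
  proof -
    have mono: "mono_val (\<lambda>x. y (fst x) s) \<mu> = (\<Prod>i\<in>UNIV. y i s powi wt \<mu> i)" for s
    proof -
      have "mono_val (\<lambda>x. y (fst x) s) \<mu> =
          (\<Prod>i\<in>UNIV. \<Prod>x\<in>{x\<in>Poly_Mapping.keys \<mu>. fst x = i}. y (fst x) s ^ Poly_Mapping.lookup \<mu> x)"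
        by (rule prod.group[symmetric]) auto
      also have "\<dots> = (\<Prod>i\<in>UNIV. y i s powi wt \<mu> i)"
        by (intro prod.cong refl) (simp add: wt_def power_sum[symmetric] flip: of_nat_sum)
      finally show ?thesis .
    qed
    have "lim (\<lambda>s. Poly_Mapping.lookup (f s) \<mu>) (Poly_Mapping.lookup F' \<mu>)"
      using f unfolding plim_def by blast
    from lim_inverse[OF this] have fi: "fin (\<lambda>s. inverse (Poly_Mapping.lookup (f s) \<mu>))"
      "ev (\<lambda>s. Poly_Mapping.lookup (f s) \<mu> \<noteq> 0)"
      using that unfolding fin_def by (auto simp: in_keys_iff)
    have "fin (\<lambda>s. Poly_Mapping.lookup (lin_subst (D s) (f s)) \<mu>)"
      using Df unfolding plim_def fin_def by blast
    then have "fin (\<lambda>s. Poly_Mapping.lookup (lin_subst (D s) (f s)) \<mu> * inverse (Poly_Mapping.lookup (f s) \<mu>))"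
      using fi(1) by (rule fin_mult)
    then have "fin (\<lambda>s. mono_val (\<lambda>x. y (fst x) s) \<mu>)"
      by (rule fin_cong, intro ev_mp[OF diag fi(2)]) (simp add: D_def[symmetric] lin_subst_diag)
    then show ?thesis by (simp add: C_def mono)
  qed
  \<comment> \<open>The two constant vectors, bounded because \<open>D\<close> has determinant 1,
    force the weights \<open>w\<close> to have sum 0.\<close>
  define T where "T = insert (\<lambda>i. 1) (insert (\<lambda>i. -1) (wt ` Poly_Mapping.keys F'))"
  have "(\<lambda>i. 1) \<in> C"
    unfolding C_def mem_Collect_eq
    by (rule fin_cong[OF fin_const[of 1]]) (use prod_y in \<open>auto elim: ev_mono\<close>)
  moreover have "(\<Prod>i\<in>UNIV. inverse (y i s)) = inverse (\<Prod>i\<in>UNIV. y i s)" for s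
    using prod_inversef[of "\<lambda>i. y i s" UNIV] by (simp add: o_def)
  then have "(\<lambda>i. -1) \<in> C"
    unfolding C_def mem_Collect_eq
    by (intro fin_cong[OF fin_const[of 1]]) (use prod_y in \<open>auto elim!: ev_mono simp: power_int_minus\<close>)
  ultimately have T: "finite T" "T \<subseteq> C" using wt_C by (auto simp: T_def)
  have y_fin: "fin (y i)" for i
  proof (rule ccontr)
    assume "\<not> fin (y i)"
    moreover have "(\<Prod>j\<in>UNIV. y j s powi (if j = i then 1 else 0)) = y i s" for s
    proof -
      have "(\<Prod>j\<in>UNIV. y j s powi (if j = i then 1 else 0)) = (\<Prod>j\<in>UNIV. if j = i then y j s else 1)"
        by (intro prod.cong) auto
      then show ?thesis by simp
    qed
    ultimately have "(\<lambda>j. if j = i then 1 else 0) \<notin> C" by (simp add: C_def)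
    then have "\<exists>w. (\<forall>t\<in>T. (\<Sum>i\<in>UNIV. t i * w i) \<ge> 0) \<and> (\<Sum>j\<in>UNIV. (if j = i then 1 else 0) * w j) < 0"
      by (rule integer_farkas[OF T]) (fact C_zero, erule (1) C_add, erule (1) C_saturated)
    then obtain w where w: "\<And>t. t \<in> T \<Longrightarrow> (\<Sum>i\<in>UNIV. t i * w i) \<ge> 0"
      "(\<Sum>j\<in>UNIV. (if j = i then 1 else 0) * w j) < 0" by blast
    have "w i < 0" using w(2) by (simp add: if_distrib[of "\<lambda>x. x * _"] cong: if_cong)
    moreover have "w i = 0"
    proof (rule one_parameter_subgroup_trivial[OF B closed stab h0(3)])
      show "(\<Sum>i\<in>UNIV. w i) = 0"
        using w(1)[of "\<lambda>i. 1"] w(1)[of "\<lambda>i. -1"] by (simp add: T_def sum_negf)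
      fix \<mu> assume "\<mu> \<in> Poly_Mapping.keys (lin_subst h0' F)"
      then have "0 \<le> (\<Sum>i\<in>UNIV. wt \<mu> i * w i)" by (intro w) (simp add: T_def F'_def)
      also have "\<dots> = (\<Sum>i\<in>UNIV. \<Sum>x\<in>{x\<in>Poly_Mapping.keys \<mu>. fst x = i}. int (Poly_Mapping.lookup \<mu> x) * w (fst x))"
        by (intro sum.cong refl) (simp add: wt_def sum_distrib_right)
      also have "\<dots> = (\<Sum>x\<in>Poly_Mapping.keys \<mu>. int (Poly_Mapping.lookup \<mu> x) * w (fst x))"
        by (rule sum.group) auto
      finally show "0 \<le> (\<Sum>x\<in>Poly_Mapping.keys \<mu>. int (Poly_Mapping.lookup \<mu> x) * w (fst x))" .
    qed
    ultimately show False by simp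
  qed
  have "fin (\<lambda>s. D s $ i $ j)" for i j
  proof -
    have "fin (\<lambda>s. if i = j then y i s else 0)" using y_fin by (cases "i = j") auto
    then show ?thesis by (rule fin_cong) (use diag in \<open>auto elim!: ev_mono simp: D_def\<close>)
  qed
  then obtain D0 where "mlim D D0" by (rule mlim_exists)
  then have "mlim (\<lambda>s. h' s ** D s ** k' s) (h0' ** D0 ** k0')" by (intro mlim_mult h0 k0)
  then show ?thesis using that by (simp flip: g_D)
qed

section \<open>Gauss's lemma\<close>

lemma plim_zeroI:
  assumes "lim u 0" "plim f f0" "ev (\<lambda>s. g s = mconst (u s) * f s)" "bounded_support g"
  shows "plim g 0"
proof -
  have "plim (\<lambda>s. mconst (u s) * f s) (mconst 0 * f0)" using assms by (intro plim_mult plim_mconst)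
  then have "plim g (mconst 0 * f0)" by (rule plim_cong) (use assms in \<open>auto elim: ev_mono\<close>)
  then show ?thesis by simp
qed

text \<open>Gauss's lemma: the valuation of a product is the sum of the valuations.\<close>

lemma mult_families:
  fixes f g :: "'s \<Rightarrow> ('x::countable, 'a) mpoly"
  assumes f: "bounded_support f" "\<And>s. f s \<noteq> 0" and g: "bounded_support g" "\<And>s. g s \<noteq> 0"
    and fg: "plim (\<lambda>s. f s * g s) H"
    and not_zero: "\<not> plim g 0"
  shows "\<exists>f0. plim f f0"
    and "H = 0 \<Longrightarrow> plim f 0"
proof -
  obtain u f0 where u: "ev (\<lambda>s. u s \<noteq> 0)" "plim (\<lambda>s. mconst (inverse (u s)) * f s) f0" "f0 \<noteq> 0"
    using normalized_family[OF f] by blast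
  obtain v g0 where v: "ev (\<lambda>s. v s \<noteq> 0)" "plim (\<lambda>s. mconst (inverse (v s)) * g s) g0" "g0 \<noteq> 0"
    using normalized_family[OF g] by blast
  interpret mconst: ring_morphism "mconst :: 'a \<Rightarrow> ('x, 'a) mpoly" by (rule ring_morphism_mconst)
  have undo: "p = mconst c * (mconst (inverse c) * p)" if "c \<noteq> 0" for c :: 'a and p :: "('x, 'a) mpoly"
    using that by (simp add: mult.assoc[symmetric] mconst.mult[symmetric])
  have f_u: "ev (\<lambda>s. f s = mconst (u s) * (mconst (inverse (u s)) * f s))"
    using u(1) by (rule ev_mono) (rule undo)
  have g_v: "ev (\<lambda>s. g s = mconst (v s) * (mconst (inverse (v s)) * g s))"
    using v(1) by (rule ev_mono) (rule undo)
  have "f0 * g0 \<noteq> 0" using mpoly_no_zero_divisors u(3) v(3) by blast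
  then obtain \<kappa> where \<kappa>: "Poly_Mapping.lookup (f0 * g0) \<kappa> \<noteq> 0" by (metis poly_mapping_eqI lookup_zero)
  \<comment> \<open>A coefficient of the normalized product with nonzero limit. Dividing the same
    coefficient of \<open>f s * g s\<close> by it recovers \<open>u s * v s\<close>, which therefore
    has a limit.\<close>
  define c where "c s = Poly_Mapping.lookup (mconst (inverse (u s)) * f s * (mconst (inverse (v s)) * g s)) \<kappa>" for s
  have c: "lim c (Poly_Mapping.lookup (f0 * g0) \<kappa>)"
    using plim_mult[OF u(2) v(2)] unfolding plim_def c_def by blast
  have "ev (\<lambda>s. u s * v s \<noteq> 0)" using u(1) v(1) by (rule ev_mp) simp
  then have uv_eq: "ev (\<lambda>s. Poly_Mapping.lookup (f s * g s) \<kappa> * inverse (c s) = u s * v s)"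
    using lim_inverse(2)[OF c \<kappa>]
  proof (rule ev_mp)
    fix s assume s: "u s * v s \<noteq> 0" "c s \<noteq> 0"
    have "mconst (inverse (u s)) * f s * (mconst (inverse (v s)) * g s) = mconst (inverse (u s * v s)) * (f s * g s)"
      by (simp add: mconst.mult mult_ac)
    then have "c s = inverse (u s * v s) * Poly_Mapping.lookup (f s * g s) \<kappa>" by (simp add: c_def)
    then have "Poly_Mapping.lookup (f s * g s) \<kappa> = u s * v s * c s" using s(1) by (simp add: field_simps)
    then show "Poly_Mapping.lookup (f s * g s) \<kappa> * inverse (c s) = u s * v s"
      using s(2) by (simp add: mult.assoc)
  qed
  have "lim (\<lambda>s. Poly_Mapping.lookup (f s * g s) \<kappa> * inverse (c s))
      (Poly_Mapping.lookup H \<kappa> * inverse (Poly_Mapping.lookup (f0 * g0) \<kappa>))"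
    using fg lim_inverse(1)[OF c \<kappa>] unfolding plim_def by (intro lim_mult) auto
  then have uv: "lim (\<lambda>s. u s * v s) (Poly_Mapping.lookup H \<kappa> * inverse (Poly_Mapping.lookup (f0 * g0) \<kappa>))"
    using uv_eq by (rule lim_cong)
  have v_not_0: "\<not> lim v 0" using plim_zeroI[OF _ v(2) g_v g(1)] not_zero by blast
  have v_of_u: "lim v (b * d)" if "lim (\<lambda>s. u s * v s) b" "lim (\<lambda>s. inverse (u s)) d" for b d
    using lim_mult[OF that] by (rule lim_cong) (use u(1) in \<open>auto elim!: ev_mono\<close>)
  \<comment> \<open>Otherwise \<open>v\<close>, the product of the bounded \<open>u * v\<close> with
    \<open>inverse u\<close>, would tend to 0.\<close>
  have "fin u"
    using not_fin(1)[of u] v_of_u[OF uv, of 0] v_not_0 by auto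
  then obtain a where a: "lim u a" unfolding fin_def by blast
  have "plim (\<lambda>s. mconst (u s) * (mconst (inverse (u s)) * f s)) (mconst a * f0)"
    using a u(2) by (intro plim_mult plim_mconst)
  then have f_lim: "plim f (mconst a * f0)"
    by (rule plim_cong) (use f_u f(1) in \<open>auto elim: ev_mono\<close>)
  then show "\<exists>f0. plim f f0" by blast
  assume "H = 0"
  have "a = 0"
  proof (rule ccontr)
    assume "a \<noteq> 0"
    from v_of_u[OF uv lim_inverse(1)[OF a this]] show False using v_not_0 \<open>H = 0\<close> by simp
  qed
  then show "plim f 0" using f_lim by simp
qed

end

section \<open>Stability of products and Chow forms\<close>

lemma bounded_support_lin_subst:
  fixes F :: "('n::finite \<times> nat, 'a::comm_ring_1) mpoly"
  shows "bounded_support (\<lambda>s. lin_subst (h s) F)"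
proof -
  have power: "bounded_support (\<lambda>s. f s ^ n)" if "bounded_support f"
    for f :: "'s \<Rightarrow> ('x, 'a) mpoly" and n
    by (induction n) (auto intro: bounded_support_const bounded_support_mult that)
  have prod: "bounded_support (\<lambda>s. \<Prod>i\<in>I. f i s)" if "\<And>i. i \<in> I \<Longrightarrow> bounded_support (f i)"
    for f :: "'i \<Rightarrow> 's \<Rightarrow> ('x, 'a) mpoly" and I
    using that by (induction I rule: infinite_finite_induct) (auto intro: bounded_support_const bounded_support_mult)
  show ?thesis
    unfolding lin_subst_def msubst_def case_prod_unfold
    by (intro bounded_support_sum bounded_support_mult bounded_support_const prod power bounded_support_mconst)
qed

lemma lin_subst_eq_0_iff:
  fixes h :: "'a::field ^ 'n::finite ^ 'n"
  assumes "det h = 1"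
  shows "lin_subst h F = 0 \<longleftrightarrow> F = 0"
proof -
  obtain h' where "h ** h' = mat 1" using det_1_inverse[OF assms] by blast
  then show ?thesis using lin_subst_cancel[of h h' F] by (metis lin_subst.zero)
qed

lemma matrix_inv_det_1:
  fixes g :: "'a::field ^ 'n::finite ^ 'n"
  assumes "det g = 1"
  shows "g ** matrix_inv g = mat 1" "matrix_inv g ** g = mat 1" "det (matrix_inv g) = 1"
proof -
  obtain h where "g ** h = mat 1 \<and> h ** g = mat 1" using det_1_inverse[OF assms] by blast
  then have "g ** matrix_inv g = mat 1 \<and> matrix_inv g ** g = mat 1"
    unfolding matrix_inv_def by (rule someI)
  then show inv: "g ** matrix_inv g = mat 1" "matrix_inv g ** g = mat 1" by auto
  have "det g * det (matrix_inv g) = 1" using inv by (metis det_I det_mul)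
  then show "det (matrix_inv g) = 1" using assms by simp
qed

lemma sl_act_lin_subst: "sl_act g = lin_subst (matrix_inv g)"
  by (rule ext) (simp add: sl_act_def lin_subst_def)

text \<open>Inversion permutes SL, so the inverse in the action does not change the set of
  translates.\<close>

lemma sl_orbit_eq: "sl_orbit F = subst_orbit F"
proof (intro equalityI subsetI)
  fix H assume "H \<in> sl_orbit F"
  then obtain g where "det g = 1" "H = lin_subst (matrix_inv g) F"
    by (auto simp: sl_orbit_def special_linear_def sl_act_lin_subst)
  then show "H \<in> subst_orbit F" unfolding subst_orbit_def using matrix_inv_det_1(3) by blast
next
  fix H assume "H \<in> subst_orbit F"
  then obtain h where h: "det h = 1" "H = lin_subst h F" by (auto simp: subst_orbit_def)
  define g where "g = matrix_inv h"
  have g: "h ** g = mat 1" "g ** h = mat 1" "det g = 1" using matrix_inv_det_1[OF h(1)] by (auto simp: g_def)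
  have "matrix_inv g = (h ** g) ** matrix_inv g" using g by simp
  also have "\<dots> = h" using matrix_inv_det_1(1)[OF g(3)] by (simp flip: matrix_mul_assoc)
  finally have "sl_act g F = H" using h by (simp add: sl_act_lin_subst)
  then show "H \<in> sl_orbit F" using g(3) by (auto simp: sl_orbit_def special_linear_def)
qed

lemma sl_stabilizer_eq:
  fixes F :: "('n::finite \<times> nat, 'a::field) mpoly"
  shows "sl_stabilizer F = {h. det h = 1 \<and> lin_subst h F = F}"
proof -
  have "lin_subst (matrix_inv g) F = F \<longleftrightarrow> lin_subst g F = F" if "det g = 1" for g :: "'a ^ 'n ^ 'n"
    using lin_subst_cancel[of g "matrix_inv g" F] lin_subst_cancel[of "matrix_inv g" g F]
      matrix_inv_det_1[OF that] by metis
  then show ?thesis by (auto simp: sl_stabilizer_def special_linear_def sl_act_lin_subst)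
qed

section \<open>Places from closure points and from unbounded functions\<close>

text \<open>Restriction of a polynomial function to the family is sent to the value of that function
  at \<open>H\<close>; the closure hypothesis is exactly well-definedness. The coordinate functions
  \<open>mvar \<mu>\<close> then give the coefficientwise limit.\<close>

lemma mpoly_limit_place:
  fixes q :: "'s \<Rightarrow> ('x, 'a::alg_closed_field) mpoly"
  assumes "bounded_support q"
    and closure: "\<And>P. (\<And>s. meval (Poly_Mapping.lookup (q s)) P = 0) \<Longrightarrow> meval (Poly_Mapping.lookup H) P = 0"
  obtains lim where "place lim" "place.plim lim q H"
proof -
  define lim0 where "lim0 x a \<longleftrightarrow> (\<exists>P. x = (\<lambda>s. meval (Poly_Mapping.lookup (q s)) P) \<and> a = meval (Poly_Mapping.lookup H) P)"
    for x and a :: 'a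
  have const: "lim0 (\<lambda>s. c) c" for c
    unfolding lim0_def by (rule exI[of _ "mconst c"]) (simp add: ring_morphism.msubst_mconst[OF ring_morphism_id])
  have add: "lim0 (\<lambda>s. x s + y s) (a + b)" if "lim0 x a" "lim0 y b" for x y a b
    using that unfolding lim0_def
  proof (elim exE conjE)
    fix P Q assume "x = (\<lambda>s. meval (Poly_Mapping.lookup (q s)) P)" "a = meval (Poly_Mapping.lookup H) P"
      "y = (\<lambda>s. meval (Poly_Mapping.lookup (q s)) Q)" "b = meval (Poly_Mapping.lookup H) Q"
    then show "\<exists>R. (\<lambda>s. x s + y s) = (\<lambda>s. meval (Poly_Mapping.lookup (q s)) R) \<and> a + b = meval (Poly_Mapping.lookup H) R"
      by (intro exI[of _ "P + Q"]) (simp add: mpoly_eval.add)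
  qed
  have mult: "lim0 (\<lambda>s. x s * y s) (a * b)" if "lim0 x a" "lim0 y b" for x y a b
    using that unfolding lim0_def
  proof (elim exE conjE)
    fix P Q assume "x = (\<lambda>s. meval (Poly_Mapping.lookup (q s)) P)" "a = meval (Poly_Mapping.lookup H) P"
      "y = (\<lambda>s. meval (Poly_Mapping.lookup (q s)) Q)" "b = meval (Poly_Mapping.lookup H) Q"
    then show "\<exists>R. (\<lambda>s. x s * y s) = (\<lambda>s. meval (Poly_Mapping.lookup (q s)) R) \<and> a * b = meval (Poly_Mapping.lookup H) R"
      by (intro exI[of _ "P * Q"]) (simp add: mpoly_eval.mult)
  qed
  have zero: "a = 0" if "lim0 (\<lambda>s. 0) a" for a
    using that unfolding lim0_def
  proof (elim exE conjE)
    fix P assume P: "(\<lambda>s. 0) = (\<lambda>s. meval (Poly_Mapping.lookup (q s)) P)" "a = meval (Poly_Mapping.lookup H) P"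
    have "meval (Poly_Mapping.lookup (q s)) P = 0" for s using fun_cong[OF P(1), of s] by simp
    then show "a = 0" using P(2) closure by simp
  qed
  obtain lim where lim: "place lim" "\<And>x a. lim0 x a \<Longrightarrow> lim x a"
    using place_exists[of lim0, OF const add mult zero] by blast
  have "lim0 (\<lambda>s. Poly_Mapping.lookup (q s) \<mu>) (Poly_Mapping.lookup H \<mu>)" for \<mu>
    unfolding lim0_def by (rule exI[of _ "mvar \<mu>"]) (simp add: ring_morphism.msubst_mvar[OF ring_morphism_id])
  then have "place.plim lim q H" using assms(1) lim unfolding place.plim_def[OF lim(1)] by blast
  then show ?thesis using that lim(1) by blast
qed

text \<open>A polynomial in \<open>inverse x\<close> is sent to its value at 0. This is well defined
  because a polynomial vanishing at infinitely many values of \<open>inverse x\<close> is zero.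
  Functions are compared only where \<open>x\<close> is nonzero, so that
  \<open>x * inverse x\<close> counts as 1 and excludes a limit of \<open>x\<close>.\<close>

lemma unbounded_place:
  fixes x :: "'s \<Rightarrow> 'a::alg_closed_field"
  assumes "infinite (range x)"
  obtains lim where "place lim" "\<not> place.fin lim x"
proof -
  define lim0 where "lim0 y a \<longleftrightarrow> (\<exists>p. (\<forall>s. x s \<noteq> 0 \<longrightarrow> y s = poly p (inverse (x s))) \<and> a = poly p 0)"
    for y and a :: 'a
  have const: "lim0 (\<lambda>s. c) c" for c
    unfolding lim0_def by (rule exI[of _ "[:c:]"]) simp
  have add: "lim0 (\<lambda>s. y s + z s) (a + b)" if "lim0 y a" "lim0 z b" for y z a b
    using that unfolding lim0_def
  proof (elim exE conjE)
    fix p q assume "\<forall>s. x s \<noteq> 0 \<longrightarrow> y s = poly p (inverse (x s))" "a = poly p 0"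
      "\<forall>s. x s \<noteq> 0 \<longrightarrow> z s = poly q (inverse (x s))" "b = poly q 0"
    then show "\<exists>r. (\<forall>s. x s \<noteq> 0 \<longrightarrow> y s + z s = poly r (inverse (x s))) \<and> a + b = poly r 0"
      by (intro exI[of _ "p + q"]) simp
  qed
  have mult: "lim0 (\<lambda>s. y s * z s) (a * b)" if "lim0 y a" "lim0 z b" for y z a b
    using that unfolding lim0_def
  proof (elim exE conjE)
    fix p q assume "\<forall>s. x s \<noteq> 0 \<longrightarrow> y s = poly p (inverse (x s))" "a = poly p 0"
      "\<forall>s. x s \<noteq> 0 \<longrightarrow> z s = poly q (inverse (x s))" "b = poly q 0"
    then show "\<exists>r. (\<forall>s. x s \<noteq> 0 \<longrightarrow> y s * z s = poly r (inverse (x s))) \<and> a * b = poly r 0"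
      by (intro exI[of _ "p * q"]) simp
  qed
  have zero: "a = 0" if lim0: "lim0 (\<lambda>s. 0) a" for a
  proof -
    obtain p where p: "\<And>s. x s \<noteq> 0 \<Longrightarrow> poly p (inverse (x s)) = 0" "a = poly p 0"
      using lim0 unfolding lim0_def by metis
    have "infinite (range x - {0})" using assms by simp
    then have "infinite (inverse ` (range x - {0}))"
      using finite_imageD[of inverse "range x - {0}"] by (auto simp: inj_on_def)
    moreover have "inverse ` (range x - {0}) \<subseteq> {z. poly p z = 0}" using p(1) by auto
    ultimately have "p = 0" using poly_roots_finite finite_subset by blast
    then show ?thesis using p(2) by simp
  qed
  obtain lim where lim: "place lim" "\<And>y a. lim0 y a \<Longrightarrow> lim y a"
    using place_exists[of lim0, OF const add mult zero] by blast
  interpret place lim by (rule lim(1))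
  have inv: "lim (\<lambda>s. inverse (x s)) 0"
    by (rule lim(2)) (auto simp: lim0_def intro!: exI[of _ "[:0, 1:]"])
  have one: "lim (\<lambda>s. x s * inverse (x s)) 1"
    by (rule lim(2)) (auto simp: lim0_def intro!: exI[of _ "1"])
  have "\<not> fin x"
  proof
    assume "fin x"
    then obtain a where "lim x a" unfolding fin_def by blast
    from lim_mult[OF this inv] one show False using lim_unique by fastforce
  qed
  then show ?thesis using that lim(1) by blast
qed

section \<open>Semi-stability and stability of a product\<close>

definition semistability_witness :: "('n::finite \<times> nat, 'a::field) mpoly \<Rightarrow> ('n \<times> nat \<Rightarrow>\<^sub>0 nat, 'a) mpoly \<Rightarrow> bool" where
  "semistability_witness F P \<longleftrightarrow> (\<forall>H\<in>subst_orbit F. meval (Poly_Mapping.lookup H) P = 0) \<and>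
     meval (Poly_Mapping.lookup 0) P \<noteq> 0"

text \<open>If the orbit left \<open>B\<close>, no closed set would contain it, and its closure, an
  intersection over the empty family, would contain 0. Thus semi-stability itself yields that the
  orbit stays in \<open>B\<close>.\<close>

lemma closure_zero_iff:
  assumes "0 \<in> B"
  shows "0 \<notin> zariski_closure_in B (subst_orbit F) \<longleftrightarrow> subst_orbit F \<subseteq> B \<and> (\<exists>P. semistability_witness F P)"
proof
  assume "0 \<notin> zariski_closure_in B (subst_orbit F)"
  then obtain T S where T: "subst_orbit F \<subseteq> T" "0 \<notin> T" "T = {F \<in> B. \<forall>P\<in>S. meval (Poly_Mapping.lookup F) P = 0}"
    unfolding zariski_closure_in_def zariski_closed_in_def by auto
  then obtain P where "P \<in> S" "meval (Poly_Mapping.lookup 0) P \<noteq> 0" using assms by blast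
  then show "subst_orbit F \<subseteq> B \<and> (\<exists>P. semistability_witness F P)"
    using T unfolding semistability_witness_def by blast
next
  assume "subst_orbit F \<subseteq> B \<and> (\<exists>P. semistability_witness F P)"
  then obtain P where P: "subst_orbit F \<subseteq> B" "semistability_witness F P" by blast
  define T where "T = {H \<in> B. \<forall>Q\<in>{P}. meval (Poly_Mapping.lookup H) Q = 0}"
  have "zariski_closed_in B T" unfolding zariski_closed_in_def T_def by blast
  moreover have "subst_orbit F \<subseteq> T" "0 \<notin> T" using P by (auto simp: T_def semistability_witness_def)
  ultimately show "0 \<notin> zariski_closure_in B (subst_orbit F)"
    unfolding zariski_closure_in_def by blast
qed

lemma in_subst_orbit: "det h = 1 \<Longrightarrow> lin_subst h F \<in> subst_orbit F"
  unfolding subst_orbit_def by blast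

lemma semistability_witness_nonzero:
  assumes "semistability_witness F P"
  shows "F \<noteq> 0"
  using assms in_subst_orbit[of "mat 1" F] unfolding semistability_witness_def by fastforce

lemma (in place) lim_meval:
  "plim f f0 \<Longrightarrow> lim (\<lambda>s. meval (Poly_Mapping.lookup (f s)) P) (meval (Poly_Mapping.lookup f0) P)"
  unfolding msubst_def plim_def by (intro lim_sum lim_mult lim_const lim_prod lim_power) blast

text \<open>Polynomial functions commute with limits, so the witness would vanish at 0 as it does
  along the orbit.\<close>

lemma (in place) semistable_orbit_not_null:
  assumes "semistability_witness F P" "\<And>s. det (g s) = 1"
  shows "\<not> plim (\<lambda>s. lin_subst (g s) F) 0"
proof
  assume "plim (\<lambda>s. lin_subst (g s) F) 0"
  moreover have "meval (Poly_Mapping.lookup (lin_subst (g s) F)) P = 0" for s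
    using assms(1) in_subst_orbit[OF assms(2)] unfolding semistability_witness_def by blast
  ultimately have "lim (\<lambda>s. 0) (meval (Poly_Mapping.lookup 0) P)"
    using lim_meval[of "\<lambda>s. lin_subst (g s) F" 0 P] by simp
  then show False using assms(1) lim_unique unfolding semistability_witness_def by blast
qed

lemma subst_orbit_mult_subset:
  assumes "subst_orbit F \<subseteq> A" "subst_orbit G \<subseteq> B" "\<And>p q. p \<in> A \<Longrightarrow> q \<in> B \<Longrightarrow> p * q \<in> C"
  shows "subst_orbit (F * G) \<subseteq> C"
  using assms unfolding subst_orbit_def by (auto simp: lin_subst.mult)

lemma (in place) product_limit:
  fixes F G :: "('n::finite \<times> nat, 'a) mpoly" and g :: "'s \<Rightarrow> 'a ^ 'n ^ 'n"
  assumes nz: "F \<noteq> 0" "G \<noteq> 0" and g: "\<And>s. det (g s) = 1" and G: "semistability_witness G Q"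
    and lim: "plim (\<lambda>s. lin_subst (g s) (F * G)) H"
  shows "\<exists>F0. plim (\<lambda>s. lin_subst (g s) F) F0" "H = 0 \<Longrightarrow> plim (\<lambda>s. lin_subst (g s) F) 0"
  using mult_families[of "\<lambda>s. lin_subst (g s) F" "\<lambda>s. lin_subst (g s) G" H]
    lim semistable_orbit_not_null[OF G g]
  by (simp_all add: bounded_support_lin_subst lin_subst_eq_0_iff g nz lin_subst.mult)

text \<open>The tautological family of SL, indexed by the type of all matrices; outside SL the
  identity serves as a filler.\<close>

definition sl_points :: "'a::field ^ 'n::finite ^ 'n \<Rightarrow> 'a ^ 'n ^ 'n" where
  "sl_points s = (if det s = 1 then s else mat 1)"

lemma det_sl_points [simp]: "det (sl_points s) = 1"
  by (simp add: sl_points_def)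

lemma orbit_limit_place:
  fixes F :: "('n::finite \<times> nat, 'a::alg_closed_field) mpoly"
  assumes "\<And>P. (\<And>K. K \<in> subst_orbit F \<Longrightarrow> meval (Poly_Mapping.lookup K) P = 0) \<Longrightarrow> meval (Poly_Mapping.lookup H) P = 0"
  obtains lim where "place lim" "place.plim lim (\<lambda>s. lin_subst (sl_points s) F) H"
proof (rule mpoly_limit_place[OF bounded_support_lin_subst])
  fix P assume *: "\<And>s. meval (Poly_Mapping.lookup (lin_subst (sl_points s) F)) P = 0"
  show "meval (Poly_Mapping.lookup H) P = 0"
  proof (rule assms)
    fix K assume "K \<in> subst_orbit F"
    then obtain h where "det h = 1" "K = lin_subst h F" unfolding subst_orbit_def by blast
    then show "meval (Poly_Mapping.lookup K) P = 0" using *[of h] by (simp add: sl_points_def)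
  qed
qed (rule that)

lemma semistable_mult:
  fixes F G :: "('n::finite \<times> nat, 'a::alg_closed_field) mpoly"
  assumes F: "semistability_witness F P" and G: "semistability_witness G Q"
  shows "\<exists>R. semistability_witness (F * G) R"
proof (rule ccontr)
  assume "\<not> ?thesis"
  then obtain lim where lim: "place lim" "place.plim lim (\<lambda>s. lin_subst (sl_points s) (F * G)) 0"
    using orbit_limit_place[of "F * G" 0] unfolding semistability_witness_def by blast
  interpret place lim by (rule lim(1))
  have "plim (\<lambda>s. lin_subst (sl_points s) F) 0"
    using product_limit(2)[OF _ _ det_sl_points G lim(2)] F G semistability_witness_nonzero by blast
  then show False using semistable_orbit_not_null[OF F, of sl_points] by simp
qed

lemma finite_matrices:
  fixes \<Sigma> :: "('a ^ 'n::finite ^ 'm::finite) set"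
  assumes "\<And>i j. finite ((\<lambda>h. h $ i $ j) ` \<Sigma>)"
  shows "finite \<Sigma>"
proof -
  define A where "A = (\<Union>i j. (\<lambda>h. h $ i $ j) ` \<Sigma>)"
  have "finite A" unfolding A_def using assms by simp
  then have "finite {f :: 'm \<times> 'n \<Rightarrow> 'a. \<forall>x. (x \<in> UNIV \<longrightarrow> f x \<in> A) \<and> (x \<notin> UNIV \<longrightarrow> f x = undefined)}"
    by (intro finite_set_of_finite_funs) auto
  then have "finite ((\<lambda>h (i, j). h $ i $ j) ` \<Sigma>)"
    by (rule finite_subset[rotated]) (auto simp: A_def)
  moreover have "inj_on (\<lambda>h (i, j). h $ i $ j) \<Sigma>"
    by (auto simp: inj_on_def fun_eq_iff vec_eq_iff)
  ultimately show ?thesis by (rule finite_imageD)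
qed

lemma stable_mult:
  fixes F G :: "('n::finite \<times> nat, 'a::alg_closed_field) mpoly"
  assumes A: "mpoly_subspace A" and closed: "zariski_closed_in A (subst_orbit F)"
    and stab: "finite {h. det h = 1 \<and> lin_subst h F = F}" and F: "F \<noteq> 0"
    and G: "semistability_witness G Q"
    and C: "subst_orbit (F * G) \<subseteq> C"
  shows "zariski_closed_in C (subst_orbit (F * G))"
    and "finite {h. det h = 1 \<and> lin_subst h (F * G) = F * G}"
proof -
  have G_nz: "G \<noteq> 0" using semistability_witness_nonzero[OF G] .
  \<comment> \<open>All polynomial functions vanishing on the orbit, so that a common zero of
    \<open>S\<close> is a limit point of the orbit along some place.\<close>
  define S where "S = {P. \<forall>K\<in>subst_orbit (F * G). meval (Poly_Mapping.lookup K) P = 0}"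
  have "H \<in> subst_orbit (F * G)" if H: "H \<in> C" "\<forall>P\<in>S. meval (Poly_Mapping.lookup H) P = 0" for H
  proof -
    obtain lim where lim: "place lim" "place.plim lim (\<lambda>s. lin_subst (sl_points s) (F * G)) H"
      using orbit_limit_place[of "F * G" H] H(2) unfolding S_def by blast
    interpret place lim by (rule lim(1))
    obtain F0 where "plim (\<lambda>s. lin_subst (sl_points s) F) F0"
      using product_limit(1)[OF F G_nz det_sl_points G lim(2)] by blast
    then obtain g0 where g0: "mlim sl_points g0"
      using stable_orbit_map_proper[where g = sl_points, OF A closed stab det_sl_points] by blast
    have "plim (\<lambda>s. lin_subst (sl_points s) (F * G)) (lin_subst g0 (F * G))"
      by (intro plim_lin_subst plim_const g0)
    then have "H = lin_subst g0 (F * G)" using lim(2) plim_unique by blast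
    moreover have "det g0 = 1" using lim_det[OF g0] lim_unique[OF lim_const[of 1]] by simp
    ultimately show ?thesis using in_subst_orbit by blast
  qed
  then have "subst_orbit (F * G) = {H \<in> C. \<forall>P\<in>S. meval (Poly_Mapping.lookup H) P = 0}"
    using C by (auto simp: S_def)
  then show "zariski_closed_in C (subst_orbit (F * G))" unfolding zariski_closed_in_def by blast
  define \<Sigma> where "\<Sigma> = {h. det h = 1 \<and> lin_subst h (F * G) = F * G}"
  show "finite {h. det h = 1 \<and> lin_subst h (F * G) = F * G}"
    unfolding \<Sigma>_def[symmetric]
  proof (rule finite_matrices, rule ccontr)
    fix i j assume inf: "infinite ((\<lambda>h. h $ i $ j) ` \<Sigma>)"
    \<comment> \<open>The tautological family of the stabilizer. It fixes \<open>F * G\<close>, so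
      the family of translates is constant and in particular bounded; properness then contradicts an
      unbounded entry.\<close>
    define g where "g s = (if s \<in> \<Sigma> then s else mat 1)" for s
    have g: "det (g s) = 1" "lin_subst (g s) (F * G) = F * G" for s by (auto simp: g_def \<Sigma>_def)
    have "(\<lambda>h. h $ i $ j) ` \<Sigma> \<subseteq> range (\<lambda>s. g s $ i $ j)" by (force simp: g_def)
    then have "infinite (range (\<lambda>s. g s $ i $ j))" using inf finite_subset by blast
    then obtain lim where lim: "place lim" "\<not> place.fin lim (\<lambda>s. g s $ i $ j)"
      using unbounded_place by blast
    interpret place lim by (rule lim(1))
    have "plim (\<lambda>s. lin_subst (g s) (F * G)) (F * G)" unfolding g by (rule plim_const)
    then obtain F0 where "plim (\<lambda>s. lin_subst (g s) F) F0"
      using product_limit(1)[where g = g, OF F G_nz g(1) G] by blast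
    then obtain g0 where "mlim g g0" using stable_orbit_map_proper[where g = g, OF A closed stab g(1)] by blast
    then show False using lim(2) unfolding mlim_def fin_def by blast
  qed
qed

section \<open>Graded pieces of the Pluecker ring and equations of divisors\<close>

lemma homogeneous_mult: "homogeneous d p \<Longrightarrow> homogeneous e q \<Longrightarrow> homogeneous (d + e) (p * q)"
  unfolding homogeneous_def
proof
  fix \<kappa> assume *: "\<forall>\<mu>\<in>Poly_Mapping.keys p. (\<Sum>i\<in>Poly_Mapping.keys \<mu>. Poly_Mapping.lookup \<mu> i) = d"
    "\<forall>\<mu>\<in>Poly_Mapping.keys q. (\<Sum>i\<in>Poly_Mapping.keys \<mu>. Poly_Mapping.lookup \<mu> i) = e"
    "\<kappa> \<in> Poly_Mapping.keys (p * q)"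
  obtain \<mu> \<nu> where \<mu>\<nu>: "\<mu> \<in> Poly_Mapping.keys p" "\<nu> \<in> Poly_Mapping.keys q" "\<kappa> = \<mu> + \<nu>"
    using *(3) keys_mult_subset[of p q] by auto
  have "(\<Sum>i\<in>Poly_Mapping.keys (\<mu> + \<nu>). Poly_Mapping.lookup (\<mu> + \<nu>) i) =
      (\<Sum>i\<in>Poly_Mapping.keys \<mu>. Poly_Mapping.lookup \<mu> i) + (\<Sum>i\<in>Poly_Mapping.keys \<nu>. Poly_Mapping.lookup \<nu> i)"
    by (rule setsum_keys_plus_distrib) auto
  then show "(\<Sum>i\<in>Poly_Mapping.keys \<kappa>. Poly_Mapping.lookup \<kappa> i) = d + e" using * \<mu>\<nu> by simp
qed

lemma homogeneous_mconst: "homogeneous 0 (mconst c)"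
  by (auto simp: homogeneous_def mconst_def)

lemma homogeneous_add: "homogeneous d p \<Longrightarrow> homogeneous d q \<Longrightarrow> homogeneous d (p + q)"
  unfolding homogeneous_def using keys_add[of p q] by blast

lemma plucker_ring_deg_mult:
  "F \<in> plucker_ring_deg m d \<Longrightarrow> G \<in> plucker_ring_deg m e \<Longrightarrow> F * G \<in> plucker_ring_deg m (d + e)"
  unfolding plucker_ring_deg_def
  using homogeneous_mult[of "m * d" F "m * e" G] by (auto simp: distrib_left intro: plucker_ring.mult)

lemma mpoly_subspace_plucker_ring_deg: "mpoly_subspace (plucker_ring_deg m d)"
  unfolding mpoly_subspace_def plucker_ring_deg_def
  using homogeneous_mult[OF homogeneous_mconst]
  by (auto intro: plucker_ring.add plucker_ring.mult plucker_ring.const homogeneous_add)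

lemma zero_in_plucker_ring_deg: "0 \<in> plucker_ring_deg m d"
  using plucker_ring.const[of 0 m] by (simp add: plucker_ring_deg_def homogeneous_def)

lemma one_in_plucker_ring: "1 \<in> plucker_ring m"
  using plucker_ring.const[of 1 m] by (simp add: ring_morphism.one[OF ring_morphism_mconst])

lemma prime_divisor_equation_dvd:
  assumes "prime_divisor_equation m D f" "prime_divisor_equation m D g"
  shows "g dvd f"
proof -
  have "f * 1 \<in> plucker_ideal m D"
    using assms(1) one_in_plucker_ring unfolding prime_divisor_equation_def by blast
  then show ?thesis using assms(2) unfolding prime_divisor_equation_def by auto
qed

text \<open>Two equations of one divisor divide each other, and the units of the polynomial ring are
  the nonzero constants.\<close>

lemma prime_divisor_equation_unique:
  fixes f g :: "('n::finite \<times> nat, 'a::field) mpoly"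
  assumes "prime_divisor_equation m D f" "prime_divisor_equation m D g" "g \<noteq> 0"
  obtains c where "c \<noteq> 0" "f = mconst c * g"
proof -
  obtain H where H: "f = g * H" using prime_divisor_equation_dvd[OF assms(1,2)] by (elim dvdE)
  obtain K where K: "g = f * K" using prime_divisor_equation_dvd[OF assms(2,1)] by (elim dvdE)
  have "g * (1 - H * K) = 0" using H K by (simp add: algebra_simps)
  then have "H * K = 1" using mpoly_no_zero_divisors[of g "1 - H * K"] assms(3) by simp
  then obtain c where "H = mconst c" "c \<noteq> 0" by (rule mpoly_unit_const)
  then show ?thesis using that H by (simp add: mult.commute)
qed

section \<open>Chow forms of sums of cycles\<close>

lemma mpoly_prod_mset_zero_iff:
  fixes f :: "'i \<Rightarrow> ('x::countable, 'a::idom) mpoly"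
  shows "(\<Prod>V\<in>#X. f V) = 0 \<longleftrightarrow> (\<exists>V\<in>#X. f V = 0)"
  by (induction X) (auto dest: mpoly_no_zero_divisors)

text \<open>Stability and semi-stability of a cycle each come with a Chow form of their own.
  Nonvanishing, known from semi-stability, is transferred here to the form used for
  stability.\<close>

lemma chow_form_nonzero:
  fixes X :: "('a::field, 'n::finite) cycle"
  assumes "chow_form m d X F" "F \<noteq> 0" "chow_form m e X G"
  shows "G \<noteq> 0"
proof
  assume "G = 0"
  obtain c f where f: "\<And>V. V \<in># X \<Longrightarrow> prime_divisor_equation m (chow_divisor m V) (f V)"
    "F = mconst c * (\<Prod>V\<in>#X. f V)" using assms(1) unfolding chow_form_def by blast
  obtain b g where g: "b \<noteq> 0" "\<And>V. V \<in># X \<Longrightarrow> prime_divisor_equation m (chow_divisor m V) (g V)"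
    "G = mconst b * (\<Prod>V\<in>#X. g V)" using assms(3) unfolding chow_form_def by blast
  have "mconst b \<noteq> (0 :: ('n \<times> nat, 'a) mpoly)" using g(1) by (metis lookup_single_eq lookup_zero mconst_def)
  then have "(\<Prod>V\<in>#X. g V) = 0" using mpoly_no_zero_divisors g(3) \<open>G = 0\<close> by metis
  then obtain V where V: "V \<in># X" "g V = 0" by (auto simp: mpoly_prod_mset_zero_iff)
  then have "f V = 0" using prime_divisor_equation_dvd[OF f(1) g(2), of V] by simp
  then have "(\<Prod>V\<in>#X. f V) = 0" using V(1) by (auto simp: mpoly_prod_mset_zero_iff)
  then show False using f(2) assms(2) by simp
qed

text \<open>A component common to \<open>Y\<close> and \<open>Z\<close> may come with two different
  equations, whereas \<open>chow_form\<close> allows one per variety. The equations of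
  \<open>Z\<close> are exchanged for those of \<open>Y\<close> at the cost of nonzero scalars,
  collected by induction over the submultisets of \<open>Z\<close>.\<close>

lemma chow_form_add:
  fixes Y Z :: "('a::field, 'n::finite) cycle"
  assumes Y: "chow_form m d Y F" and Z: "chow_form m e Z G" and "G \<noteq> 0"
  shows "chow_form m (d + e) (Y + Z) (F * G)"
proof -
  interpret mconst: ring_morphism "mconst :: 'a \<Rightarrow> ('n \<times> nat, 'a) mpoly" by (rule ring_morphism_mconst)
  obtain c f where f: "c \<noteq> 0" "\<And>V. V \<in># Y \<Longrightarrow> prime_divisor_equation m (chow_divisor m V) (f V)"
    "F = mconst c * (\<Prod>V\<in>#Y. f V)" using Y unfolding chow_form_def by blast
  obtain b g where g: "b \<noteq> 0" "\<And>V. V \<in># Z \<Longrightarrow> prime_divisor_equation m (chow_divisor m V) (g V)"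
    "G = mconst b * (\<Prod>V\<in>#Z. g V)" using Z unfolding chow_form_def by blast
  have g_nz: "g V \<noteq> 0" if "V \<in># Z" for V
    using \<open>G \<noteq> 0\<close> g(3) that mpoly_prod_mset_zero_iff[of g Z] by auto
  define h where "h V = (if V \<in># Y then f V else g V)" for V
  have h: "prime_divisor_equation m (chow_divisor m V) (h V)" if "V \<in># Y + Z" for V
    using that f(2) g(2) by (auto simp: h_def)
  have "\<exists>a. a \<noteq> 0 \<and> (\<Prod>V\<in>#X. g V) = mconst a * (\<Prod>V\<in>#X. h V)" if "X \<subseteq># Z" for X
    using that
  proof (induction X)
    case empty
    show ?case by (auto intro: exI[of _ 1])
  next
    case (add V X)
    have V: "V \<in># Z" "X \<subseteq># Z"
      using mset_subset_eq_insertD[OF add.prems] by (auto dest: subset_mset.less_imp_le)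
    then obtain a where a: "a \<noteq> 0" "(\<Prod>V\<in>#X. g V) = mconst a * (\<Prod>V\<in>#X. h V)"
      using add.IH by blast
    have "h V \<noteq> 0"
    proof
      assume "h V = 0"
      then have "g V = 0" using prime_divisor_equation_dvd[OF g(2) h, of V] V by simp
      then show False using g_nz V by blast
    qed
    then obtain a' where "a' \<noteq> 0" "g V = mconst a' * h V"
      using prime_divisor_equation_unique[OF g(2) h, of V] V by auto
    then show ?case using a by (intro exI[of _ "a' * a"]) (simp add: mconst.mult mult_ac)
  qed
  then obtain a where a: "a \<noteq> 0" "(\<Prod>V\<in>#Z. g V) = mconst a * (\<Prod>V\<in>#Z. h V)" by blast
  have "(\<Prod>V\<in>#Y. f V) = (\<Prod>V\<in>#Y. h V)"
    by (intro arg_cong[of _ _ prod_mset] image_mset_cong) (simp add: h_def)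
  then have "F * G = mconst (c * b * a) * (\<Prod>V\<in>#Y + Z. h V)"
    using f(3) g(3) a(2) by (simp add: mconst.mult mult_ac)
  moreover have "F * G \<in> plucker_ring_deg m (d + e)"
    using Y Z plucker_ring_deg_mult unfolding chow_form_def by blast
  moreover have "c * b * a \<noteq> 0" using f(1) g(1) a(1) by simp
  ultimately show ?thesis unfolding chow_form_def using h by blast
qed

theorem proposition1p3:
  fixes Y Z :: "('a::alg_closed_field, 'n::finite) cycle"
    and n r :: nat
  assumes "CARD('n) = n + 1" and "r < n"
    and "effective_cycle r Y" and "effective_cycle r Z"
    and "chow_semistable r Y" and "chow_semistable r Z"
  shows "chow_semistable r (Y + Z) \<and> (chow_stable r Y \<longrightarrow> chow_stable r (Y + Z))"
proof -
  define m where "m = CARD('n) - 1 - r"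
  have semistable_iff: "chow_semistable r X \<longleftrightarrow> (\<exists>d F. chow_form m d X F \<and>
      subst_orbit F \<subseteq> plucker_ring_deg m d \<and> (\<exists>P. semistability_witness F P))"
    for X :: "('a, 'n) cycle"
    by (simp add: chow_semistable_def m_def Let_def sl_orbit_eq closure_zero_iff[OF zero_in_plucker_ring_deg])
  have stable_iff: "chow_stable r X \<longleftrightarrow> (\<exists>d F. chow_form m d X F \<and>
      zariski_closed_in (plucker_ring_deg m d) (subst_orbit F) \<and>
      finite {h. det h = 1 \<and> lin_subst h F = F})" for X :: "('a, 'n) cycle"
    by (simp add: chow_stable_def m_def Let_def sl_orbit_eq sl_stabilizer_eq)
  obtain d F P where F: "chow_form m d Y F" "subst_orbit F \<subseteq> plucker_ring_deg m d" "semistability_witness F P"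
    using assms(5) semistable_iff by blast
  obtain e G Q where G: "chow_form m e Z G" "subst_orbit G \<subseteq> plucker_ring_deg m e" "semistability_witness G Q"
    using assms(6) semistable_iff by blast
  have G_nz: "G \<noteq> 0" using semistability_witness_nonzero[OF G(3)] .
  have "chow_semistable r (Y + Z)"
    using chow_form_add[OF F(1) G(1) G_nz] subst_orbit_mult_subset[OF F(2) G(2) plucker_ring_deg_mult]
      semistable_mult[OF F(3) G(3)] semistable_iff by blast
  moreover have "chow_stable r (Y + Z)" if stable: "chow_stable r Y"
  proof -
    obtain d' F' where F': "chow_form m d' Y F'"
      "zariski_closed_in (plucker_ring_deg m d') (subst_orbit F')"
      "finite {h. det h = 1 \<and> lin_subst h F' = F'}"
      using stable stable_iff by blast
    have "F' \<noteq> 0" using chow_form_nonzero[OF F(1) _ F'(1)] semistability_witness_nonzero[OF F(3)] by blast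
    moreover have "subst_orbit F' \<subseteq> plucker_ring_deg m d'"
      using F'(2) unfolding zariski_closed_in_def by blast
    then have "subst_orbit (F' * G) \<subseteq> plucker_ring_deg m (d' + e)"
      by (rule subst_orbit_mult_subset[OF _ G(2) plucker_ring_deg_mult])
    ultimately show ?thesis
      using stable_mult[OF mpoly_subspace_plucker_ring_deg F'(2,3) _ G(3)]
        chow_form_add[OF F'(1) G(1) G_nz] stable_iff by blast
  qed
  ultimately show ?thesis by blast
qed

end
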